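(* Let $\Omega=\{(m,k,l;n,r,t):\ m,n\in\mathbb{Z}_+,\ k,l,r,t\in\mathbb{Z}\}$ and let $\{u_{m,k,l;n,r,t}\}_{(m,k,l;n,r,t)\in\Omega}$ be a given family of complex numbers. Consider the extended two-dimensional moment problem: find a non-negative Borel measure $\mu$ on $\mathbb{R}^2$ such that $$\int_{\mathbb{R}^2} x_1^m (x_1+i)^k (x_1-i)^l\, x_2^n (x_2+i)^r (x_2-i)^t\, d\mu = u_{m,k,l;n,r,t},\qquad (m,k,l;n,r,t)\in\Omega .$$ This problem has a solution if and only if the following two conditions hold. (i) For all complex coefficients $\{\alpha_{m,k,l;n,r,t}\}_{(m,k,l;n,r,t)\in\Omega}$, all but finitely many of which are zero, $$\sum_{(m,k,l;n,r,t),(m',k',l';n',r',t')\in\Omega}\alpha_{m,k,l;n,r,t}\,\overline{\alpha_{m',k',l';n',r',t'}}\;u_{m+m',k+l',l+k';n+n',r+t',t+r'}\ \ge 0 .$$ (ii) For all $(m,k,l;n,r,t),(a,b,c;d,e,f)\in\Omega$, $$u_{m+1+a,k+c,l+b;n+d,r+f,t+e}+i\,u_{m+a,k+c,l+b;n+d,r+f,t+e}=u_{m+a,k+1+c,l+b;n+d,r+f,t+e},$$ $$u_{m+1+a,k+c,l+b;n+d,r+f,t+e}-i\,u_{m+a,k+c,l+b;n+d,r+f,t+e}=u_{m+a,k+c,l+1+b;n+d,r+f,t+e},$$ $$u_{m+a,k+c,l+b;n+1+d,r+f,t+e}+i\,u_{m+a,k+c,l+b;n+d,r+f,t+e}=u_{m+a,k+c,l+b;n+d,r+1+f,t+e},$$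 $$u_{m+a,k+c,l+b;n+1+d,r+f,t+e}-i\,u_{m+a,k+c,l+b;n+d,r+f,t+e}=u_{m+a,k+c,l+b;n+d,r+f,t+1+e}.$$ If these conditions are satisfied, then the solution of the moment problem is unique and it is given by $$\mu(\Delta)=\big(E(\Delta)x_{0,0,0;0,0,0},\,x_{0,0,0;0,0,0}\big)_H,\qquad \Delta\in\mathfrak{B}(\mathbb{R}^2),$$ where the Hilbert space $H$, the vector $x_{0,0,0;0,0,0}\in H$ and the spectral measure $E$ are those constructed from $\{u_{m,k,l;n,r,t}\}$ as described in the context.
   Context: $\mathbb{Z}_+$ denotes the non-negative integers; $\mathfrak{B}(\mathbb{R}^2)$ the Borel subsets of $\mathbb{R}^2$. Hilbert spaces are complex and separable, with scalar product linear in the first argument. A solution of the moment problem is a measure for which all the integrals exist and have the prescribed values. Construction of $H$, $x_{0,0,0;0,0,0}$ and $E$ (when (i) and (ii) hold). By (i) there are a separable Hilbert space $H$ and a family $\{x_{m,k,l;n,r,t}\}_{(m,k,l;n,r,t)\in\Omega}$ in $H$ whose closed linear span is $H$ and such that $$(x_{m,k,l;n,r,t},x_{m',k',l';n',r',t'})_H=u_{m+m',k+l',l+k';n+n',r+t',t+r'}$$ for all pairs of indices in $\Omega$. Let $L$ be the (algebraic) linear span of the family $\{x_{m,k,l;n,r,t}\}$. On $L$ define linear operators $A_0,B_0$ by $A_0x_{m,k,l;n,r,t}=x_{m+1,k,l;n,r,t}$ and $B_0x_{m,k,l;n,r,t}=x_{m,k,l;n+1,r,t}$. Under (i), (ii)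 these are well defined, symmetric and essentially self-adjoint, and their closures $A=\overline{A_0}$, $B=\overline{B_0}$ are commuting self-adjoint operators. $E$ is the joint (orthogonal, projection-valued) spectral measure on $\mathfrak{B}(\mathbb{R}^2)$ of the pair $(A,B)$, i.e. $A=\int_{\mathbb{R}^2}x_1\,dE(x)$ and $B=\int_{\mathbb{R}^2}x_2\,dE(x)$. *)

theory Defs
  imports "HOL-Analysis.Analysis" "HOL-Library.Nonpos_Ints"
begin

section \<open>Complex Hilbert spaces\<close>

text \<open>The scalar product is linear in the first argument. The norm, the metric and the topology
  are those of the underlying real inner product space.\<close>

class complex_inner = real_inner +
  fixes scaleC :: "complex \<Rightarrow> 'a \<Rightarrow> 'a" (infixr "*\<^sub>C" 75)
    and cinner :: "'a \<Rightarrow> 'a \<Rightarrow> complex"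
  assumes scaleC_add_right: "a *\<^sub>C (x + y) = a *\<^sub>C x + a *\<^sub>C y"
    and scaleC_add_left: "(a + b) *\<^sub>C x = a *\<^sub>C x + b *\<^sub>C x"
    and scaleC_scaleC: "a *\<^sub>C (b *\<^sub>C x) = (a * b) *\<^sub>C x"
    and scaleC_one: "1 *\<^sub>C x = x"
    and scaleR_eq_scaleC: "r *\<^sub>R x = complex_of_real r *\<^sub>C x"
    and cinner_add_left: "cinner (x + y) z = cinner x z + cinner y z"
    and cinner_scaleC_left: "cinner (a *\<^sub>C x) y = a * cinner x y"
    and cinner_commute: "cinner x y = cnj (cinner y x)"
    and inner_eq_Re_cinner: "inner x y = Re (cinner x y)"

class chilbert_space = complex_inner + complete_space

global_interpretation complex_vector:
  vector_space "scaleC :: complex \<Rightarrow> 'a \<Rightarrow> 'a::complex_inner"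
  by standard (simp_all add: scaleC_add_right scaleC_add_left scaleC_scaleC scaleC_one)

section \<open>The Hilbert space of square-summable sequences\<close>

typedef ell2 = "{f :: nat \<Rightarrow> complex. summable (\<lambda>n. (cmod (f n))\<^sup>2)}"
  morphisms ell2_nth Abs_ell2
  by (rule exI[of _ "\<lambda>_. 0"]) simp

setup_lifting type_definition_ell2

lemma ell2_summable_add:
  fixes f g :: "nat \<Rightarrow> complex"
  assumes "summable (\<lambda>n. (cmod (f n))\<^sup>2)" "summable (\<lambda>n. (cmod (g n))\<^sup>2)"
  shows "summable (\<lambda>n. (cmod (f n + g n))\<^sup>2)"
proof (rule summable_comparison_test')
  show "summable (\<lambda>n. 2 * (cmod (f n))\<^sup>2 + 2 * (cmod (g n))\<^sup>2)"
    by (intro summable_add summable_mult assms)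
  fix n :: nat
  have "(cmod (f n + g n))\<^sup>2 \<le> (cmod (f n) + cmod (g n))\<^sup>2"
    by (intro power_mono norm_triangle_ineq) auto
  also have "\<dots> \<le> 2 * (cmod (f n))\<^sup>2 + 2 * (cmod (g n))\<^sup>2"
    using sum_squares_bound[of "cmod (f n)" "cmod (g n)"] by (simp add: power2_sum)
  finally show "norm ((cmod (f n + g n))\<^sup>2) \<le> 2 * (cmod (f n))\<^sup>2 + 2 * (cmod (g n))\<^sup>2"
    by simp
qed

lemma ell2_summable_mult:
  fixes f g :: "nat \<Rightarrow> complex"
  assumes "summable (\<lambda>n. (cmod (f n))\<^sup>2)" "summable (\<lambda>n. (cmod (g n))\<^sup>2)"
  shows "summable (\<lambda>n. f n * cnj (g n))"
proof (rule summable_comparison_test')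
  show "summable (\<lambda>n. (cmod (f n))\<^sup>2 + (cmod (g n))\<^sup>2)"
    by (intro summable_add assms)
  fix n :: nat
  have "cmod (f n) * cmod (g n) \<le> 2 * cmod (f n) * cmod (g n)" by simp
  also have "\<dots> \<le> (cmod (f n))\<^sup>2 + (cmod (g n))\<^sup>2"
    by (rule sum_squares_bound)
  finally show "norm (f n * cnj (g n)) \<le> (cmod (f n))\<^sup>2 + (cmod (g n))\<^sup>2"
    by (simp add: norm_mult)
qed

lemma ell2_summable_scale:
  fixes f :: "nat \<Rightarrow> complex"
  assumes "summable (\<lambda>n. (cmod (f n))\<^sup>2)"
  shows "summable (\<lambda>n. (cmod (a * f n))\<^sup>2)"
  using summable_mult[OF assms, of "(cmod a)\<^sup>2"] by (simp add: norm_mult power_mult_distrib)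

lemma summable_ell2_nth: "summable (\<lambda>n. (cmod (ell2_nth x n))\<^sup>2)"
  using ell2_nth[of x] by simp

instantiation ell2 :: complex_inner
begin

lift_definition zero_ell2 :: ell2 is "\<lambda>_. 0" by simp

lift_definition plus_ell2 :: "ell2 \<Rightarrow> ell2 \<Rightarrow> ell2" is "\<lambda>f g n. f n + g n"
  by (rule ell2_summable_add)

lift_definition uminus_ell2 :: "ell2 \<Rightarrow> ell2" is "\<lambda>f n. - f n" by simp

lift_definition minus_ell2 :: "ell2 \<Rightarrow> ell2 \<Rightarrow> ell2" is "\<lambda>f g n. f n - g n"
  subgoal for f g using ell2_summable_add[of f "\<lambda>n. - g n"] by simp
  done

lift_definition scaleC_ell2 :: "complex \<Rightarrow> ell2 \<Rightarrow> ell2" is "\<lambda>a f n. a * f n"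
  by (rule ell2_summable_scale)

lift_definition scaleR_ell2 :: "real \<Rightarrow> ell2 \<Rightarrow> ell2" is "\<lambda>r f n. complex_of_real r * f n"
  by (rule ell2_summable_scale)

definition cinner_ell2 :: "ell2 \<Rightarrow> ell2 \<Rightarrow> complex" where
  "cinner_ell2 x y = (\<Sum>n. ell2_nth x n * cnj (ell2_nth y n))"

definition inner_ell2 :: "ell2 \<Rightarrow> ell2 \<Rightarrow> real" where
  "inner_ell2 x y = Re (cinner x y)"

definition norm_ell2 :: "ell2 \<Rightarrow> real" where
  "norm_ell2 x = sqrt (inner x x)"

definition dist_ell2 :: "ell2 \<Rightarrow> ell2 \<Rightarrow> real" where
  "dist_ell2 x y = norm (x - y)"

definition sgn_ell2 :: "ell2 \<Rightarrow> ell2" where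
  "sgn_ell2 x = inverse (norm x) *\<^sub>R x"

definition uniformity_ell2 :: "(ell2 \<times> ell2) filter" where
  "uniformity_ell2 = (INF e\<in>{0 <..}. principal {(x, y). dist x y < e})"

definition open_ell2 :: "ell2 set \<Rightarrow> bool" where
  "open_ell2 U \<longleftrightarrow> (\<forall>x\<in>U. eventually (\<lambda>(x', y). x' = x \<longrightarrow> y \<in> U) uniformity)"

lemma cinner_ell2_sums: "(\<lambda>n. ell2_nth x n * cnj (ell2_nth y n)) sums cinner x y"
  unfolding cinner_ell2_def by (intro summable_sums ell2_summable_mult summable_ell2_nth)

lemma cinner_ell2_add: "cinner (x + y) z = cinner x z + cinner y (z::ell2)"
proof -
  have "(\<lambda>n. ell2_nth (x + y) n * cnj (ell2_nth z n)) sums (cinner x z + cinner y z)"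
    using sums_add[OF cinner_ell2_sums[of x z] cinner_ell2_sums[of y z]]
    by (simp add: plus_ell2.rep_eq algebra_simps)
  then show ?thesis using cinner_ell2_sums sums_unique2 by blast
qed

lemma cinner_ell2_scale: "cinner (a *\<^sub>C x) y = a * cinner x (y::ell2)"
proof -
  have "(\<lambda>n. ell2_nth (a *\<^sub>C x) n * cnj (ell2_nth y n)) sums (a * cinner x y)"
    using sums_mult[OF cinner_ell2_sums[of x y], of a]
    by (simp add: scaleC_ell2.rep_eq algebra_simps)
  then show ?thesis using cinner_ell2_sums sums_unique2 by blast
qed

lemma cinner_ell2_cnj: "cinner x y = cnj (cinner y (x::ell2))"
proof -
  have "(\<lambda>n. ell2_nth x n * cnj (ell2_nth y n)) sums cnj (cinner y x)"
    using cinner_ell2_sums[of y x, THEN sums_cnj[THEN iffD2]] by (simp add: mult.commute)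
  then show ?thesis using cinner_ell2_sums sums_unique2 by blast
qed

lemma inner_ell2_sums: "(\<lambda>n. (cmod (ell2_nth x n))\<^sup>2) sums inner x x"
proof -
  have "(\<lambda>n. Re (ell2_nth x n * cnj (ell2_nth x n))) sums Re (cinner x x)"
    by (rule sums_Re[OF cinner_ell2_sums])
  moreover have "Re (z * cnj z) = (cmod z)\<^sup>2" for z
    unfolding cmod_power2 by (simp add: power2_eq_square)
  ultimately show ?thesis by (simp only: inner_ell2_def)
qed

lemma scaleR_ell2_eq: "r *\<^sub>R x = complex_of_real r *\<^sub>C (x::ell2)"
  by transfer simp

instance
proof
  fix x y z :: ell2 and a b :: complex and r s :: real
  show "x + y + z = x + (y + z)" by transfer (simp add: add.assoc)
  show "x + y = y + x" by transfer (simp add: add.commute)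
  show "0 + x = x" by transfer simp
  show "- x + x = 0" by transfer simp
  show "x - y = x + - y" by transfer simp
  show "r *\<^sub>R (x + y) = r *\<^sub>R x + r *\<^sub>R y" by transfer (simp add: algebra_simps)
  show "(r + s) *\<^sub>R x = r *\<^sub>R x + s *\<^sub>R x" by transfer (simp add: algebra_simps)
  show "r *\<^sub>R s *\<^sub>R x = (r * s) *\<^sub>R x" by transfer (simp add: algebra_simps)
  show "1 *\<^sub>R x = x" by transfer simp
  show "dist x y = norm (x - y)" by (rule dist_ell2_def)
  show "sgn x = inverse (norm x) *\<^sub>R x" by (rule sgn_ell2_def)
  show "uniformity = (INF e\<in>{0 <..}. principal {(x::ell2, y). dist x y < e})"
    by (rule uniformity_ell2_def)
  show "open U = (\<forall>x\<in>U. \<forall>\<^sub>F (x', y) in uniformity. x' = x \<longrightarrow> y \<in> U)" for U :: "ell2 set"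
    by (rule open_ell2_def)
  show "inner x y = inner y x"
    unfolding inner_ell2_def by (subst cinner_ell2_cnj) simp
  show "inner (x + y) z = inner x z + inner y z"
    by (simp add: inner_ell2_def cinner_ell2_add)
  show "inner (r *\<^sub>R x) y = r * inner x y"
    by (simp add: inner_ell2_def scaleR_ell2_eq cinner_ell2_scale)
  show nonneg: "0 \<le> inner x x"
    using sums_le[OF _ sums_zero inner_ell2_sums[of x]] by simp
  show "inner x x = 0 \<longleftrightarrow> x = 0"
  proof
    assume "inner x x = 0"
    then have "(\<lambda>n. (cmod (ell2_nth x n))\<^sup>2) sums 0" using inner_ell2_sums[of x] by simp
    then have "\<forall>n. (cmod (ell2_nth x n))\<^sup>2 = 0"
      using suminf_eq_zero_iff[of "\<lambda>n. (cmod (ell2_nth x n))\<^sup>2"]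
      by (simp add: sums_iff)
    then have "ell2_nth x = (\<lambda>_. 0)" by auto
    then show "x = 0" by (simp add: ell2_nth_inject[symmetric] zero_ell2.rep_eq)
  next
    assume "x = 0"
    then show "inner x x = 0" by (simp add: inner_ell2_def cinner_ell2_def zero_ell2.rep_eq)
  qed
  show "norm x = sqrt (inner x x)" by (rule norm_ell2_def)
  show "a *\<^sub>C (x + y) = a *\<^sub>C x + a *\<^sub>C y" by transfer (simp add: algebra_simps)
  show "(a + b) *\<^sub>C x = a *\<^sub>C x + b *\<^sub>C x" by transfer (simp add: algebra_simps)
  show "a *\<^sub>C b *\<^sub>C x = (a * b) *\<^sub>C x" by transfer (simp add: algebra_simps)
  show "1 *\<^sub>C x = x" by transfer simp
  show "r *\<^sub>R x = complex_of_real r *\<^sub>C x" by (rule scaleR_ell2_eq)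
  show "cinner (x + y) z = cinner x z + cinner y z" by (rule cinner_ell2_add)
  show "cinner (a *\<^sub>C x) y = a * cinner x y" by (rule cinner_ell2_scale)
  show "cinner x y = cnj (cinner y x)" by (rule cinner_ell2_cnj)
  show "inner x y = Re (cinner x y)" by (rule inner_ell2_def)
qed

end

lemma norm_ell2_power2_sums: "(\<lambda>n. (cmod (ell2_nth x n))\<^sup>2) sums ((norm x)\<^sup>2)"
  using inner_ell2_sums[of x] by (simp add: power2_norm_eq_inner)

lemma sum_le_norm_ell2: "(\<Sum>n<N. (cmod (ell2_nth x n))\<^sup>2) \<le> (norm x)\<^sup>2"
  using sum_le_suminf[OF summable_ell2_nth[of x], of "{..<N}"] norm_ell2_power2_sums[of x]
  by (simp add: sums_iff)

lemma cmod_ell2_nth_le: "cmod (ell2_nth x n) \<le> norm x"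
proof -
  have "(cmod (ell2_nth x n))\<^sup>2 \<le> (\<Sum>k<Suc n. (cmod (ell2_nth x k))\<^sup>2)"
    by (simp add: sum_nonneg)
  also have "\<dots> \<le> (norm x)\<^sup>2" by (rule sum_le_norm_ell2)
  finally show ?thesis by (rule power2_le_imp_le) simp
qed

instance ell2 :: chilbert_space
proof
  fix X :: "nat \<Rightarrow> ell2"
  assume C: "Cauchy X"
  have "Cauchy (\<lambda>m. ell2_nth (X m) n)" for n
    unfolding Cauchy_iff
  proof (intro allI impI)
    fix e :: real assume "e > 0"
    then obtain M where M: "\<And>i j. i \<ge> M \<Longrightarrow> j \<ge> M \<Longrightarrow> norm (X i - X j) < e"
      using C unfolding Cauchy_iff by blast
    show "\<exists>M. \<forall>i\<ge>M. \<forall>j\<ge>M. cmod (ell2_nth (X i) n - ell2_nth (X j) n) < e"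
      using M cmod_ell2_nth_le[of "X _ - X _" n]
      by (metis (no_types, lifting) minus_ell2.rep_eq order_le_less_trans)
  qed
  then have "\<forall>n. \<exists>l. (\<lambda>m. ell2_nth (X m) n) \<longlonglongrightarrow> l"
    using Cauchy_convergent_iff convergent_def by blast
  then obtain f where f: "\<And>n. (\<lambda>m. ell2_nth (X m) n) \<longlonglongrightarrow> f n" by metis
  have bound: "(\<Sum>n<N. (cmod (ell2_nth (X i) n - f n))\<^sup>2) \<le> e\<^sup>2"
    if M: "\<And>i j. i \<ge> M \<Longrightarrow> j \<ge> M \<Longrightarrow> norm (X i - X j) < e" and i: "i \<ge> M" for e M i N
  proof (rule LIMSEQ_le_const2)
    show "(\<lambda>j. \<Sum>n<N. (cmod (ell2_nth (X i) n - ell2_nth (X j) n))\<^sup>2)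
        \<longlonglongrightarrow> (\<Sum>n<N. (cmod (ell2_nth (X i) n - f n))\<^sup>2)"
      by (intro tendsto_intros f)
    have "(\<Sum>n<N. (cmod (ell2_nth (X i) n - ell2_nth (X j) n))\<^sup>2) \<le> e\<^sup>2" if j: "j \<ge> M" for j
    proof -
      have "(\<Sum>n<N. (cmod (ell2_nth (X i) n - ell2_nth (X j) n))\<^sup>2) \<le> (norm (X i - X j))\<^sup>2"
        using sum_le_norm_ell2[where x = "X i - X j" and N = N] by (simp add: minus_ell2.rep_eq)
      also have "\<dots> \<le> e\<^sup>2"
        using M[OF i j] by (intro power_mono) auto
      finally show ?thesis .
    qed
    then show "\<exists>M. \<forall>j\<ge>M. (\<Sum>n<N. (cmod (ell2_nth (X i) n - ell2_nth (X j) n))\<^sup>2) \<le> e\<^sup>2"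
      by blast
  qed
  obtain M1 where M1: "\<And>i j. i \<ge> M1 \<Longrightarrow> j \<ge> M1 \<Longrightarrow> norm (X i - X j) < 1"
    using C unfolding Cauchy_iff by (meson zero_less_one)
  have diff: "summable (\<lambda>n. (cmod (f n - ell2_nth (X M1) n))\<^sup>2)"
    using bound[OF M1, of M1 M1]
    by (intro summableI_nonneg_bounded[where x = "1\<^sup>2"]) (auto simp: norm_minus_commute)
  have "summable (\<lambda>n. (cmod (f n))\<^sup>2)"
    using ell2_summable_add[OF diff summable_ell2_nth[of "X M1"]] by simp
  then obtain L where L: "ell2_nth L = f"
    using Abs_ell2_inverse by blast
  have "X \<longlonglongrightarrow> L"
    unfolding LIMSEQ_iff
  proof (intro allI impI)
    fix e :: real assume e: "e > 0"
    then obtain M where M: "\<And>i j. i \<ge> M \<Longrightarrow> j \<ge> M \<Longrightarrow> norm (X i - X j) < e / 2"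
      using C unfolding Cauchy_iff by (meson half_gt_zero)
    have "norm (X i - L) < e" if i: "i \<ge> M" for i
    proof -
      have "(norm (X i - L))\<^sup>2 \<le> (e / 2)\<^sup>2"
      proof (rule LIMSEQ_le_const2)
        show "(\<lambda>N. \<Sum>n<N. (cmod (ell2_nth (X i - L) n))\<^sup>2) \<longlonglongrightarrow> (norm (X i - L))\<^sup>2"
          using norm_ell2_power2_sums[of "X i - L"] by (simp add: sums_def)
        show "\<exists>M. \<forall>N\<ge>M. (\<Sum>n<N. (cmod (ell2_nth (X i - L) n))\<^sup>2) \<le> (e / 2)\<^sup>2"
          using bound[OF M i] by (simp add: minus_ell2.rep_eq L)
      qed
      then have "norm (X i - L) \<le> e / 2" by (rule power2_le_imp_le) (use e in simp)
      then show ?thesis using e by simp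
    qed
    then show "\<exists>M. \<forall>i\<ge>M. norm (X i - L) < e" by blast
  qed
  then show "convergent X" unfolding convergent_def by blast
qed

section \<open>Spectral measures on the plane and integrals with respect to them\<close>

text \<open>A Hilbert space is given as a closed complex subspace \<open>H\<close> of an ambient type of class
  \<^class>\<open>chilbert_space\<close> (with \<open>H = UNIV\<close> allowed), so that it may have any dimension.
  Operators on \<open>H\<close> are functions on the ambient type; their values outside \<open>H\<close>
  are irrelevant.\<close>

definition orth_projection_on :: "'h::chilbert_space set \<Rightarrow> ('h \<Rightarrow> 'h) \<Rightarrow> bool" where
  "orth_projection_on H P \<longleftrightarrow>
     (\<forall>h\<in>H. P h \<in> H) \<and>
     (\<forall>h\<in>H. \<forall>g\<in>H. P (h + g) = P h + P g) \<and>
     (\<forall>c. \<forall>h\<in>H. P (c *\<^sub>C h) = c *\<^sub>C P h) \<and>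
     (\<forall>h\<in>H. P (P h) = P h) \<and>
     (\<forall>h\<in>H. \<forall>g\<in>H. cinner (P h) g = cinner h (P g))"

definition spectral_measure_on ::
  "'h::chilbert_space set \<Rightarrow> ((real \<times> real) set \<Rightarrow> 'h \<Rightarrow> 'h) \<Rightarrow> bool" where
  "spectral_measure_on H E \<longleftrightarrow>
     (\<forall>\<Delta>\<in>sets borel. orth_projection_on H (E \<Delta>)) \<and>
     (\<forall>h\<in>H. E UNIV h = h) \<and>
     (\<forall>D :: nat \<Rightarrow> (real \<times> real) set. range D \<subseteq> sets borel \<longrightarrow> disjoint_family D \<longrightarrow>
        (\<forall>h\<in>H. (\<lambda>n. E (D n) h) sums E (\<Union>n. D n) h))"

text \<open>The scalar measure \<open>\<Delta> \<mapsto> (E(\<Delta>)h, h)\<close>.\<close>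

definition scalar_spectral_measure ::
  "((real \<times> real) set \<Rightarrow> 'h \<Rightarrow> 'h) \<Rightarrow> 'h::chilbert_space \<Rightarrow> (real \<times> real) measure" where
  "scalar_spectral_measure E h =
     measure_of UNIV (sets borel) (\<lambda>\<Delta>. ennreal (Re (cinner (E \<Delta> h) h)))"

text \<open>The graph of the operator \<open>\<integral> \<phi> dE\<close> on \<open>H\<close>: one has \<open>(\<integral> s dE) h = (\<Sum>y. y E(s = y) h)\<close>
  for simple \<open>s\<close>, and \<open>(\<integral> \<phi> dE) h\<close> is the limit of \<open>(\<integral> s\<^sub>n dE) h\<close> for simple functions
  \<open>s\<^sub>n\<close> converging to \<open>\<phi>\<close> in the \<open>L\<^sup>2\<close> space of the measure \<open>(E(\<cdot>)h, h)\<close>. As simple functions are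
  dense in this \<open>L\<^sup>2\<close> space, the domain is \<open>{h \<in> H. \<integral> \<bar>\<phi>\<bar>\<^sup>2 d(E h, h) < \<infinity>}\<close>.\<close>

definition spectral_integral ::
  "'h::chilbert_space set \<Rightarrow> ((real \<times> real) set \<Rightarrow> 'h \<Rightarrow> 'h) \<Rightarrow> (real \<times> real \<Rightarrow> real)
     \<Rightarrow> ('h \<times> 'h) set" where
  "spectral_integral H E \<phi> =
     {(h, g). h \<in> H \<and> g \<in> H \<and>
        (\<exists>s :: nat \<Rightarrow> real \<times> real \<Rightarrow> real.
           (\<forall>n. simple_function borel (s n)) \<and>
           (\<lambda>n. \<integral>\<^sup>+ z. ennreal ((\<phi> z - s n z)\<^sup>2) \<partial>scalar_spectral_measure E h) \<longlonglongrightarrow> 0 \<and>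
           (\<lambda>n. \<Sum>y\<in>range (s n). y *\<^sub>R E (s n -` {y}) h) \<longlonglongrightarrow> g)}"

section \<open>The extended two-dimensional moment problem\<close>

text \<open>The index set \<open>\<Omega>\<close> is the whole type; \<open>(m, k, l, n, r, t)\<close> stands for
  \<open>(m, k, l; n, r, t)\<close>.\<close>

type_synonym mindex = "nat \<times> int \<times> int \<times> nat \<times> int \<times> int"

fun moment_fun :: "mindex \<Rightarrow> real \<times> real \<Rightarrow> complex" where
  "moment_fun (m, k, l, n, r, t) (x1, x2) =
     complex_of_real x1 ^ m * (complex_of_real x1 + \<i>) powi k * (complex_of_real x1 - \<i>) powi l *
     complex_of_real x2 ^ n * (complex_of_real x2 + \<i>) powi r * (complex_of_real x2 - \<i>) powi t"

definition moment_solution :: "(mindex \<Rightarrow> complex) \<Rightarrow> (real \<times> real) measure \<Rightarrow> bool" where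
  "moment_solution u \<mu> \<longleftrightarrow> sets \<mu> = sets borel \<and>
     (\<forall>\<omega>. integrable \<mu> (moment_fun \<omega>) \<and> (\<integral>z. moment_fun \<omega> z \<partial>\<mu>) = u \<omega>)"

text \<open>The index of the product of \<open>moment_fun \<omega>\<close> with the conjugate of \<open>moment_fun \<omega>'\<close>.\<close>

fun gram_index :: "mindex \<Rightarrow> mindex \<Rightarrow> mindex" where
  "gram_index (m, k, l, n, r, t) (m', k', l', n', r', t') =
     (m + m', k + l', l + k', n + n', r + t', t + r')"

definition moment_positive :: "(mindex \<Rightarrow> complex) \<Rightarrow> bool" where
  "moment_positive u \<longleftrightarrow>
     (\<forall>\<alpha> :: mindex \<Rightarrow> complex. finite {\<omega>. \<alpha> \<omega> \<noteq> 0} \<longrightarrow>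
        (\<Sum>\<omega> | \<alpha> \<omega> \<noteq> 0. \<Sum>\<omega>' | \<alpha> \<omega>' \<noteq> 0. \<alpha> \<omega> * cnj (\<alpha> \<omega>') * u (gram_index \<omega> \<omega>'))
          \<in> \<real>\<^sub>\<ge>\<^sub>0)"

definition moment_relations :: "(mindex \<Rightarrow> complex) \<Rightarrow> bool" where
  "moment_relations u \<longleftrightarrow>
     (\<forall>(m :: nat) (k :: int) (l :: int) (n :: nat) (r :: int) (t :: int)
       (a :: nat) (b :: int) (c :: int) (d :: nat) (e :: int) (f :: int).
        u (m + 1 + a, k + c, l + b, n + d, r + f, t + e)
          + \<i> * u (m + a, k + c, l + b, n + d, r + f, t + e)
          = u (m + a, k + 1 + c, l + b, n + d, r + f, t + e) \<and>
        u (m + 1 + a, k + c, l + b, n + d, r + f, t + e)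
          - \<i> * u (m + a, k + c, l + b, n + d, r + f, t + e)
          = u (m + a, k + c, l + 1 + b, n + d, r + f, t + e) \<and>
        u (m + a, k + c, l + b, n + 1 + d, r + f, t + e)
          + \<i> * u (m + a, k + c, l + b, n + d, r + f, t + e)
          = u (m + a, k + c, l + b, n + d, r + 1 + f, t + e) \<and>
        u (m + a, k + c, l + b, n + 1 + d, r + f, t + e)
          - \<i> * u (m + a, k + c, l + b, n + d, r + f, t + e)
          = u (m + a, k + c, l + b, n + d, r + f, t + 1 + e))"

section \<open>The Hilbert space, the operators and the joint spectral measure\<close>

text \<open>A family with the prescribed Gram matrix. The Hilbert space \<open>H\<close> is its closed linear span,
  which is separable since the family is countable.\<close>

definition gram_family :: "(mindex \<Rightarrow> complex) \<Rightarrow> (mindex \<Rightarrow> 'h::chilbert_space) \<Rightarrow> bool" where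
  "gram_family u x \<longleftrightarrow> (\<forall>\<omega> \<omega>'. cinner (x \<omega>) (x \<omega>') = u (gram_index \<omega> \<omega>'))"

definition closed_span :: "(mindex \<Rightarrow> 'h::chilbert_space) \<Rightarrow> 'h set" where
  "closed_span x = closure (complex_vector.span (range x))"

text \<open>The graph of the linear operator on the linear span of the family that maps \<open>x \<omega>\<close> to
  \<open>x (\<sigma> \<omega>)\<close>; the operator is well defined iff this relation is single-valued.\<close>

definition index_operator ::
  "(mindex \<Rightarrow> 'h::chilbert_space) \<Rightarrow> (mindex \<Rightarrow> mindex) \<Rightarrow> ('h \<times> 'h) set" where
  "index_operator x \<sigma> =
     {(\<Sum>\<omega>\<in>S. \<alpha> \<omega> *\<^sub>C x \<omega>, \<Sum>\<omega>\<in>S. \<alpha> \<omega> *\<^sub>C x (\<sigma> \<omega>)) | S \<alpha>. finite S}"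

fun shift1 :: "mindex \<Rightarrow> mindex" where
  "shift1 (m, k, l, n, r, t) = (m + 1, k, l, n, r, t)"

fun shift2 :: "mindex \<Rightarrow> mindex" where
  "shift2 (m, k, l, n, r, t) = (m, k, l, n + 1, r, t)"

text \<open>The closure of an operator is given by the closure of its graph.\<close>

definition operator_A :: "(mindex \<Rightarrow> 'h::chilbert_space) \<Rightarrow> ('h \<times> 'h) set" where
  "operator_A x = closure (index_operator x shift1)"

definition operator_B :: "(mindex \<Rightarrow> 'h::chilbert_space) \<Rightarrow> ('h \<times> 'h) set" where
  "operator_B x = closure (index_operator x shift2)"

definition joint_spectral_measure ::
  "(mindex \<Rightarrow> 'h::chilbert_space) \<Rightarrow> ((real \<times> real) set \<Rightarrow> 'h \<Rightarrow> 'h) \<Rightarrow> bool" where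
  "joint_spectral_measure x E \<longleftrightarrow>
     spectral_measure_on (closed_span x) E \<and>
     operator_A x = spectral_integral (closed_span x) E fst \<and>
     operator_B x = spectral_integral (closed_span x) E snd"

end

theory Submission
  imports Defs "HOL-Probability.Probability"
begin

text \<open>The Cayley transform \<open>w = (x + i) / (x - i)\<close> maps the plane onto the torus minus the two circles
  \<open>w\<^sub>1 = 1\<close> and \<open>w\<^sub>2 = 1\<close>, and the moment functions become trigonometric polynomials times powers of
  \<open>(1 + x\<^sub>1\<^sup>2) (1 + x\<^sub>2\<^sup>2)\<close>, where \<open>1 / (1 + x\<^sup>2) = \<bar>1 - w\<bar>\<^sup>2 / 4\<close>. Positivity makes \<open>u\<close> positive definite on
  each level of fixed power, so Herglotz' theorem represents the level by a measure on the torus;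
  relation (ii) passes from level \<open>N + 1\<close> to level \<open>N\<close> through the factor \<open>\<bar>1 - w\<^sub>1\<bar>\<^sup>2 \<bar>1 - w\<^sub>2\<bar>\<^sup>2 / 16\<close>, which
  vanishes on the two circles. The resulting measures on the plane fit together because
  trigonometric moments determine a finite measure, and this also gives uniqueness.

  For a solution \<open>\<mu>\<close> the Hilbert space is \<open>L\<^sup>2(\<mu>)\<close> with \<open>x \<omega>\<close> the moment function of \<open>\<omega>\<close>, and the spectral
  measure is multiplication by indicator functions. Conversely, for any joint spectral measure \<open>E\<close>
  the cyclic subspace of \<open>x\<^sub>0\<close> is \<open>L\<^sup>2\<close> of \<open>\<nu> = (E(\<cdot>)x\<^sub>0, x\<^sub>0)\<close>, and every \<open>x \<omega>\<close> corresponds to its moment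
  function there since \<open>A \<plusminus> i\<close> and \<open>B \<plusminus> i\<close> are injective; hence \<open>\<nu>\<close> is a solution.\<close>

section \<open>Trigonometric polynomials on the torus and the Cayley transform\<close>

text \<open>Neither the construction of the solution nor that of the spectral measure uses a
  spectral theorem for unbounded operators. A solution is produced first, by harmonic analysis, and
  only then is a spectral measure read off from it. The obstacle is mass at infinity: a Herglotz
  measure of one level may charge the exceptional circles, to which no point of the plane
  corresponds, and this forces the detour through the next level. Every level is needed, since the
  moment functions have unbounded degree of growth. The weak compactness behind Herglotz' theorem is
  used for probability measures on the real line. For this reason torus points are coded by real
  numbers, and the representing measure lives on a real parameter with two unimodular functions of
  it. Essential self-adjointness is replaced by two elementary facts: the family of moment functions
  is stable under division by \<open>x + i\<close>, and adding a nonreal multiple of the identity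
  makes a symmetric operator injective.\<close>

definition cayley :: "real \<Rightarrow> complex" where
  "cayley x = (complex_of_real x + \<i>) / (complex_of_real x - \<i>)"

definition cayley2 :: "real \<times> real \<Rightarrow> complex \<times> complex" where
  "cayley2 z = (cayley (fst z), cayley (snd z))"

text \<open>On the unit circle without 1 the quotient is already real; \<open>Re\<close> only gives
  the map a real type. At \<open>w = 1\<close> division by zero yields 0, which is harmless because
  such points will carry weight 0.\<close>

definition cayley_inv :: "complex \<Rightarrow> real" where
  "cayley_inv w = Re (\<i> * (w + 1) / (w - 1))"

definition torus :: "(complex \<times> complex) set" where
  "torus = sphere 0 1 \<times> sphere 0 1"

text \<open>Monomials and sums alone, so that inductions have two cases. Products are recovered
  afterwards, on \<open>torus\<close> only.\<close>

inductive trig_poly :: "(complex \<times> complex \<Rightarrow> complex) \<Rightarrow> bool" where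
  trig_poly_monom: "trig_poly (\<lambda>w. c * (fst w powi j * snd w powi k))"
| trig_poly_add: "trig_poly F \<Longrightarrow> trig_poly G \<Longrightarrow> trig_poly (\<lambda>w. F w + G w)"

section \<open>Elementary properties of the Cayley transform\<close>

lemma of_real_plus_i_neq_0 [simp]:
  "complex_of_real x + \<i> \<noteq> 0" "complex_of_real x - \<i> \<noteq> 0" "complex_of_real x \<noteq> \<i>"
  by (auto simp: complex_eq_iff)

lemma norm_of_real_plus_i:
  "cmod (complex_of_real x + \<i>) = sqrt (1 + x\<^sup>2)" "cmod (complex_of_real x - \<i>) = sqrt (1 + x\<^sup>2)"
  by (simp_all add: cmod_def add.commute)

lemma norm_cayley [simp]: "cmod (cayley x) = 1"
proof -
  have "sqrt (1 + x\<^sup>2) \<noteq> 0" by (simp add: add_nonneg_eq_0_iff)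
  then show ?thesis by (simp add: cayley_def norm_divide norm_of_real_plus_i)
qed

lemma cayley_neq_0 [simp]: "cayley x \<noteq> 0"
  using norm_cayley[of x] by force

lemma cayley2_in_torus [simp]: "cayley2 z \<in> torus"
  by (simp add: cayley2_def torus_def)

lemma cayley_neq_1 [simp]: "cayley x \<noteq> 1"
proof
  assume "cayley x = 1"
  then have "complex_of_real x + \<i> = complex_of_real x - \<i>"
    by (simp only: cayley_def divide_eq_1_iff of_real_plus_i_neq_0)
  then show False by (simp add: complex_eq_iff)
qed

lemma cayley_inv_cayley [simp]: "cayley_inv (cayley x) = x"
proof -
  have "cayley x + 1 = 2 * complex_of_real x / (complex_of_real x - \<i>)"
    "cayley x - 1 = 2 * \<i> / (complex_of_real x - \<i>)"
    unfolding cayley_def by (simp_all add: field_simps)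
  then have "\<i> * (cayley x + 1) / (cayley x - 1) = complex_of_real x"
    by simp
  then show ?thesis unfolding cayley_inv_def by (metis Re_complex_of_real)
qed

text \<open>On the unit circle \<open>cnj w = 1 / w\<close>, so the quotient in
  \<open>cayley_inv\<close> equals its own conjugate and \<open>Re\<close> discards nothing.\<close>

lemma cayley_cayley_inv:
  assumes "cmod w = 1" "w \<noteq> 1"
  shows "cayley (cayley_inv w) = w"
proof -
  let ?z = "\<i> * (w + 1) / (w - 1)"
  have w: "w * cnj w = 1" using assms(1) by (simp add: complex_norm_square[symmetric])
  then have w0: "w \<noteq> 0" by auto
  have cw: "cnj w = 1 / w" using w w0 by (simp add: field_simps)
  have "cnj ?z = - \<i> * (1 / w + 1) / (1 / w - 1)" by (simp add: cw)
  also have "\<dots> = ?z"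
  proof -
    have "1 / w - 1 \<noteq> 0" "w - 1 \<noteq> 0" using assms(2) w0 by auto
    then show ?thesis using w0 by (simp add: field_simps)
  qed
  finally have "?z \<in> \<real>" by (simp only: Reals_cnj_iff)
  then have "complex_of_real (cayley_inv w) = ?z"
    unfolding cayley_inv_def by (rule of_real_Re)
  then have "cayley (cayley_inv w) = (?z + \<i>) / (?z - \<i>)" unfolding cayley_def by simp
  also have "?z + \<i> = 2 * \<i> * w / (w - 1)" using assms(2) by (simp add: field_simps)
  also have "?z - \<i> = 2 * \<i> / (w - 1)" using assms(2) by (simp add: field_simps)
  finally show ?thesis using assms(2) by simp
qed

lemma continuous_on_cayley [continuous_intros]:
  "continuous_on S f \<Longrightarrow> continuous_on S (\<lambda>x. cayley (f x))"
  unfolding cayley_def by (intro continuous_intros) auto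

lemma borel_measurable_cayley [measurable]: "cayley \<in> borel_measurable borel"
  by (intro borel_measurable_continuous_onI continuous_intros)

lemma borel_measurable_cayley_inv [measurable]: "cayley_inv \<in> borel_measurable borel"
  unfolding cayley_inv_def by measurable

section \<open>Algebra and density of trigonometric polynomials\<close>

lemma torus_neq_0: "w \<in> torus \<Longrightarrow> fst w \<noteq> 0 \<and> snd w \<noteq> 0"
  by (auto simp: torus_def)

lemma compact_torus: "compact torus"
  by (auto simp: torus_def intro: compact_Times)

text \<open>The agreement is claimed on the torus only, because adding integer exponents needs
  nonzero bases.\<close>

lemma trig_poly_mult:
  assumes "trig_poly F" "trig_poly G"
  shows "\<exists>H. trig_poly H \<and> (\<forall>w\<in>torus. H w = F w * G w)"
  using assms
proof (induction arbitrary: G rule: trig_poly.induct)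
  case (trig_poly_monom c j k)
  then show ?case
  proof (induction rule: trig_poly.induct)
    case (trig_poly_monom c' j' k')
    show ?case
    proof (intro exI conjI ballI)
      show "trig_poly (\<lambda>w. (c * c') * (fst w powi (j + j') * snd w powi (k + k')))"
        by (rule trig_poly.trig_poly_monom)
    qed (use torus_neq_0 in \<open>simp add: power_int_add\<close>)
  next
    case (trig_poly_add F G)
    then obtain H1 H2 where "trig_poly H1" "trig_poly H2"
      "\<forall>w\<in>torus. H1 w = c * (fst w powi j * snd w powi k) * F w"
      "\<forall>w\<in>torus. H2 w = c * (fst w powi j * snd w powi k) * G w" by blast
    then show ?case
      by (intro exI[of _ "\<lambda>w. H1 w + H2 w"]) (auto simp: distrib_left intro: trig_poly.trig_poly_add)
  qed
next
  case (trig_poly_add F1 F2)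
  then obtain H1 H2 where "trig_poly H1" "trig_poly H2"
    "\<forall>w\<in>torus. H1 w = F1 w * G w" "\<forall>w\<in>torus. H2 w = F2 w * G w" by blast
  then show ?case
    by (intro exI[of _ "\<lambda>w. H1 w + H2 w"]) (auto simp: distrib_right intro: trig_poly.trig_poly_add)
qed

text \<open>Real Stone-Weierstrass, applied to the algebra of real functions that coincide on the
  torus with some trigonometric polynomial. It separates points because it contains the real and
  imaginary parts of both coordinates.\<close>

lemma trig_poly_dense:
  fixes \<psi> :: "complex \<times> complex \<Rightarrow> real"
  assumes "continuous_on torus \<psi>" "0 < e"
  shows "\<exists>F. trig_poly F \<and> (\<forall>w\<in>torus. cmod (F w - complex_of_real (\<psi> w)) < e)"
proof -
  let ?P = "\<lambda>f. continuous_on torus f \<and>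
    (\<exists>F. trig_poly F \<and> (\<forall>w\<in>torus. complex_of_real (f w) = F w))"
  have P: "?P f" if f: "continuous_on torus f" "trig_poly F" "\<forall>w\<in>torus. complex_of_real (f w) = F w"
    for f F
    using that by blast
  \<comment> \<open>On the unit circle the inverse is the conjugate, so \<open>Re\<close> and
    \<open>Im\<close> are combinations of the exponents 1 and -1.\<close>
  have Re_Im: "complex_of_real (Re w) = 1/2 * w powi 1 + 1/2 * w powi (-1)"
    "complex_of_real (Im w) = -\<i>/2 * w powi 1 + \<i>/2 * w powi (-1)" if "cmod w = 1" for w
  proof -
    have "w * cnj w = 1" using that by (simp add: complex_norm_square[symmetric])
    then have "w powi (-1) = cnj w" by (simp add: power_int_minus inverse_unique)
    then show "complex_of_real (Re w) = 1/2 * w powi 1 + 1/2 * w powi (-1)"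
      "complex_of_real (Im w) = -\<i>/2 * w powi 1 + \<i>/2 * w powi (-1)"
      by (simp_all add: complex_eq_iff)
  qed
  have "\<exists>g. ?P g \<and> (\<forall>w\<in>torus. \<bar>\<psi> w - g w\<bar> < e)"
  proof (rule Stone_Weierstrass_HOL[OF compact_torus])
    show "?P (\<lambda>x. c)" for c
      by (rule P[OF _ trig_poly_monom[of "complex_of_real c" 0 0]]) auto
    show "?P (\<lambda>x. f x + g x)" if fg: "?P f \<and> ?P g" for f g
    proof -
      obtain F G where "trig_poly F" "trig_poly G" "\<forall>w\<in>torus. complex_of_real (f w) = F w"
        "\<forall>w\<in>torus. complex_of_real (g w) = G w" using fg by blast
      then show ?thesis
        using fg by (intro P[of _ "\<lambda>w. F w + G w"] trig_poly_add continuous_on_add) auto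
    qed
    show "?P (\<lambda>x. f x * g x)" if fg: "?P f \<and> ?P g" for f g
    proof -
      obtain F G where FG: "trig_poly F" "trig_poly G" "\<forall>w\<in>torus. complex_of_real (f w) = F w"
        "\<forall>w\<in>torus. complex_of_real (g w) = G w" using fg by blast
      obtain H where "trig_poly H" "\<forall>w\<in>torus. H w = F w * G w"
        using trig_poly_mult[OF FG(1,2)] by blast
      then show ?thesis
        using fg FG by (intro P[of _ H] continuous_on_mult) auto
    qed
    fix x y assume xy: "x \<in> torus \<and> y \<in> torus \<and> x \<noteq> y"
    have 1: "?P (\<lambda>w. Re (fst w))"
    proof (rule P)
      show "trig_poly (\<lambda>w. 1/2 * (fst w powi 1 * snd w powi 0) + 1/2 * (fst w powi (-1) * snd w powi 0))"
        by (intro trig_poly_monom trig_poly_add)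
    qed (auto simp: torus_def Re_Im intro!: continuous_intros)
    have 2: "?P (\<lambda>w. Im (fst w))"
    proof (rule P)
      show "trig_poly (\<lambda>w. -\<i>/2 * (fst w powi 1 * snd w powi 0) + \<i>/2 * (fst w powi (-1) * snd w powi 0))"
        by (intro trig_poly_monom trig_poly_add)
    qed (auto simp: torus_def Re_Im intro!: continuous_intros)
    have 3: "?P (\<lambda>w. Re (snd w))"
    proof (rule P)
      show "trig_poly (\<lambda>w. 1/2 * (fst w powi 0 * snd w powi 1) + 1/2 * (fst w powi 0 * snd w powi (-1)))"
        by (intro trig_poly_monom trig_poly_add)
    qed (auto simp: torus_def Re_Im intro!: continuous_intros)
    have 4: "?P (\<lambda>w. Im (snd w))"
    proof (rule P)
      show "trig_poly (\<lambda>w. -\<i>/2 * (fst w powi 0 * snd w powi 1) + \<i>/2 * (fst w powi 0 * snd w powi (-1)))"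
        by (intro trig_poly_monom trig_poly_add)
    qed (auto simp: torus_def Re_Im intro!: continuous_intros)
    have "Re (fst x) \<noteq> Re (fst y) \<or> Im (fst x) \<noteq> Im (fst y) \<or> Re (snd x) \<noteq> Re (snd y) \<or>
      Im (snd x) \<noteq> Im (snd y)"
      using xy by (auto simp: prod_eq_iff complex_eq_iff)
    then show "\<exists>f. ?P f \<and> f x \<noteq> f y"
      using 1 2 3 4 by (elim disjE) blast+
  qed (use assms in auto)
  then obtain g F where gF: "\<forall>w\<in>torus. \<bar>\<psi> w - g w\<bar> < e" "trig_poly F"
    "\<forall>w\<in>torus. complex_of_real (g w) = F w" by blast
  have "cmod (F w - complex_of_real (\<psi> w)) < e" if "w \<in> torus" for w
  proof -
    have "F w - complex_of_real (\<psi> w) = complex_of_real (g w - \<psi> w)" using gF that by simp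
    then show ?thesis using gF(1) that by (simp only: norm_of_real) (simp add: abs_minus_commute)
  qed
  then show ?thesis using gF(2) by blast
qed

text \<open>The Cayley map carries \<open>U\<close> to the trace on the torus of an open set
  \<open>W\<close>. Truncated multiples of the distance to the complement of \<open>W\<close> tend
  to its indicator, and each is uniformly close on the torus to a trigonometric polynomial. The
  common bound is there for dominated convergence.\<close>

lemma indicator_open_limit_trig_poly:
  assumes "open U"
  shows "\<exists>F :: nat \<Rightarrow> _. (\<forall>n. trig_poly (F n)) \<and> (\<forall>n z. cmod (F n (cayley2 z)) \<le> 2) \<and>
           (\<forall>z. (\<lambda>n. F n (cayley2 z)) \<longlonglongrightarrow> indicator U z)"
proof -
  define V where "V = {w :: complex \<times> complex. fst w \<noteq> 1 \<and> snd w \<noteq> 1}"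
  \<comment> \<open>The inverse Cayley formula is used off the torus as well, so that
    \<open>W\<close> is open in the whole space and not merely relative to the torus.\<close>
  define j where "j w = (cayley_inv (fst w), cayley_inv (snd w))" for w
  define W where "W = V \<inter> j -` U"
  have "V = (- {1}) \<times> (- {1})" by (auto simp: V_def)
  then have "open V" by (auto intro!: open_Times)
  moreover have "continuous_on V j"
    unfolding j_def cayley_inv_def V_def by (intro continuous_intros) auto
  ultimately have "open W" unfolding W_def using assms by (intro continuous_open_preimage) auto
  have W: "cayley2 z \<in> W \<longleftrightarrow> z \<in> U" for z
    by (simp add: W_def V_def j_def cayley2_def)
  \<comment> \<open>A nonempty complement is required for \<open>infdist\<close> to be a genuine
    distance.\<close>
  have "(1, 1) \<in> - W" by (simp add: W_def V_def)
  then have ne: "- W \<noteq> {}" by blast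
  define \<psi> where "\<psi> n w = min 1 (real n * infdist w (- W))" for n w
  have cont: "continuous_on torus (\<psi> n)" for n
    unfolding \<psi>_def by (intro continuous_intros)
  have "\<exists>F. trig_poly F \<and> (\<forall>w\<in>torus. cmod (F w - complex_of_real (\<psi> n w)) < 1 / real (Suc n))" for n
    by (rule trig_poly_dense[OF cont]) simp
  then obtain F where F: "\<And>n. trig_poly (F n)"
    "\<And>n w. w \<in> torus \<Longrightarrow> cmod (F n w - complex_of_real (\<psi> n w)) < 1 / real (Suc n)" by metis
  have psi01: "0 \<le> \<psi> n w" "\<psi> n w \<le> 1" for n w unfolding \<psi>_def by (auto simp: infdist_nonneg)
  have bd: "cmod (F n (cayley2 z)) \<le> 2" for n z
  proof -
    have "cmod (F n (cayley2 z)) \<le> cmod (complex_of_real (\<psi> n (cayley2 z))) + 1 / real (Suc n)"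
      using F(2)[of "cayley2 z" n] norm_triangle_sub[of "F n (cayley2 z)" "complex_of_real (\<psi> n (cayley2 z))"]
      by simp
    also have "\<dots> \<le> 1 + 1" using psi01 by (intro add_mono) auto
    finally show ?thesis by simp
  qed
  have lim: "(\<lambda>n. F n (cayley2 z)) \<longlonglongrightarrow> indicator U z" for z
  proof -
    have "(\<lambda>n. \<psi> n (cayley2 z)) \<longlonglongrightarrow> indicator U z"
    proof (cases "z \<in> U")
      case False
      then have "cayley2 z \<in> - W" using W by auto
      then show ?thesis using False by (simp add: \<psi>_def)
    next
      case True
      then have "infdist (cayley2 z) (- W) > 0"
        using W ne \<open>open W\<close>
        by (metis Compl_iff closed_Compl in_closed_iff_infdist_zero infdist_nonneg less_eq_real_def)
      then obtain N where N: "1 / infdist (cayley2 z) (- W) < real N" "0 < infdist (cayley2 z) (- W)"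
        using reals_Archimedean2 by blast
      have "\<psi> n (cayley2 z) = 1" if "n \<ge> N" for n
      proof -
        have "1 / infdist (cayley2 z) (- W) \<le> real n" using N that by linarith
        then have "1 \<le> real n * infdist (cayley2 z) (- W)"
          using N(2) by (simp add: field_simps)
        then show ?thesis by (simp add: \<psi>_def)
      qed
      then show ?thesis
        using True by (intro tendsto_eventually) (auto simp: eventually_sequentially)
    qed
    then have 1: "(\<lambda>n. complex_of_real (\<psi> n (cayley2 z))) \<longlonglongrightarrow> complex_of_real (indicator U z)"
      by (rule tendsto_of_real)
    have "(\<lambda>n. F n (cayley2 z) - complex_of_real (\<psi> n (cayley2 z))) \<longlonglongrightarrow> 0"
    proof (rule Lim_null_comparison)
      show "(\<lambda>n. 1 / real (Suc n)) \<longlonglongrightarrow> 0" using LIMSEQ_inverse_real_of_nat by (simp add: field_simps)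
      show "\<forall>\<^sub>F n in sequentially. norm (F n (cayley2 z) - complex_of_real (\<psi> n (cayley2 z))) \<le> 1 / real (Suc n)"
        using F(2)[of "cayley2 z"] by (intro always_eventually) (auto intro: less_imp_le)
    qed
    from tendsto_add[OF this 1] show ?thesis by (cases "z \<in> U") simp_all
  qed
  show ?thesis using F(1) bd lim by blast
qed

section \<open>Trigonometric moments determine a finite measure\<close>

lemma trig_poly_measurable:
  assumes "trig_poly F" shows "(\<lambda>z. F (cayley2 z)) \<in> borel_measurable borel"
  using assms
proof (induction rule: trig_poly.induct)
  case (trig_poly_monom c j k)
  have "continuous_on UNIV (\<lambda>z :: real \<times> real. c * (cayley (fst z) powi j * cayley (snd z) powi k))"
    by (intro continuous_intros) auto
  then show ?case by (simp add: cayley2_def borel_measurable_continuous_onI)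
qed auto

lemma trig_poly_bounded:
  assumes "trig_poly F" shows "\<exists>B. \<forall>z. cmod (F (cayley2 z)) \<le> B"
  using assms
proof (induction rule: trig_poly.induct)
  case (trig_poly_monom c j k)
  show ?case by (intro exI[of _ "cmod c"]) (simp add: cayley2_def norm_mult norm_power_int)
next
  case (trig_poly_add F G)
  then obtain A B where AB: "\<And>z. cmod (F (cayley2 z)) \<le> A" "\<And>z. cmod (G (cayley2 z)) \<le> B" by auto
  then have "cmod (F (cayley2 z) + G (cayley2 z)) \<le> A + B" for z
    by (meson add_mono norm_triangle_ineq order_trans)
  then show ?case by blast
qed

lemma trig_poly_integrable:
  assumes "trig_poly F" "finite_measure M" "sets M = sets borel"
  shows "integrable M (\<lambda>z. F (cayley2 z))"
proof -
  interpret finite_measure M by fact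
  note [measurable_cong] = assms(3) and [measurable] = trig_poly_measurable[OF assms(1)]
  obtain B where "\<And>z. cmod (F (cayley2 z)) \<le> B" using trig_poly_bounded[OF assms(1)] by blast
  then show ?thesis by (intro integrable_const_bound[of _ B]) auto
qed

text \<open>Equal moments give equal integrals of the trigonometric approximants of an open set,
  hence equal masses of open sets by dominated convergence. Open sets form an intersection-stable
  generator of the Borel sets.\<close>

lemma measure_eqI_cayley:
  fixes M N :: "(real \<times> real) measure"
  assumes fin: "finite_measure M" "finite_measure N"
    and sets [measurable_cong]: "sets M = sets borel" "sets N = sets borel"
    and eq: "\<And>j k. (\<integral>z. cayley (fst z) powi j * cayley (snd z) powi k \<partial>M) =
                  (\<integral>z. cayley (fst z) powi j * cayley (snd z) powi k \<partial>N)"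
  shows "M = N"
proof -
  interpret M: finite_measure M by fact
  interpret N: finite_measure N by fact
  have trig: "(\<integral>z. F (cayley2 z) \<partial>M) = (\<integral>z. F (cayley2 z) \<partial>N)" if "trig_poly F" for F
    using that
  proof (induction rule: trig_poly.induct)
    case (trig_poly_monom c j k)
    then show ?case using eq by (simp add: cayley2_def)
  next
    case (trig_poly_add F G)
    then show ?case using fin sets by (simp add: trig_poly_integrable)
  qed
  have open_eq: "emeasure M U = emeasure N U" if U: "open U" for U
  proof -
    obtain F :: "nat \<Rightarrow> _" where F: "\<And>n. trig_poly (F n)" "\<And>n z. cmod (F n (cayley2 z)) \<le> 2"
      "\<And>z. (\<lambda>n. F n (cayley2 z)) \<longlonglongrightarrow> indicator U z"
      using indicator_open_limit_trig_poly[OF U] by blast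
    have [measurable]: "(\<lambda>z. F n (cayley2 z)) \<in> borel_measurable borel" for n
      by (rule trig_poly_measurable[OF F(1)])
    have [measurable]: "U \<in> sets borel" using U by simp
    have lim: "(\<lambda>n. \<integral>z. F n (cayley2 z) \<partial>K) \<longlonglongrightarrow> (\<integral>z. indicator U z \<partial>K)"
      if K: "finite_measure K" "sets K = sets borel" for K
    proof -
      interpret finite_measure K by fact
      note [measurable_cong] = K(2)
      show ?thesis
        by (rule integral_dominated_convergence[where w = "\<lambda>_. 2"]) (use F in auto)
    qed
    have "(\<integral>z. indicator U z \<partial>M) = (\<integral>z. indicator U z \<partial>N :: complex)"
      using LIMSEQ_unique[OF lim[OF fin(1) sets(1)]] lim[OF fin(2) sets(2)] trig[OF F(1)] by simp
    moreover have "(indicator U :: _ \<Rightarrow> complex) = (\<lambda>z. complex_of_real (indicator U z))"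
      by (auto simp: indicator_def)
    ultimately have "(\<integral>z. indicator U z \<partial>M) = (\<integral>z. indicator U z \<partial>N :: real)"
      by (simp only: integral_complex_of_real of_real_eq_iff)
    then have "measure M U = measure N U"
      using sets_eq_imp_space_eq[OF sets(1)] sets_eq_imp_space_eq[OF sets(2)] by simp
    then show ?thesis by (simp add: M.emeasure_eq_measure N.emeasure_eq_measure)
  qed
  show ?thesis
  proof (rule measure_eqI_generator_eq[where E = "{S. open S}" and \<Omega> = UNIV and A = "\<lambda>_. UNIV"])
    show "Int_stable {S :: (real \<times> real) set. open S}" by (auto simp: Int_stable_def)
    show "sets M = sigma_sets UNIV {S. open S}" "sets N = sigma_sets UNIV {S. open S}"
      using sets by (simp_all add: borel_def)
  qed (auto simp: open_eq)
qed

section \<open>Complex inner product spaces\<close>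

lemma cinner_add_right: "cinner x (y + z) = cinner x y + cinner x (z::'h::complex_inner)"
  by (metis cinner_add_left cinner_commute complex_cnj_add)

lemma cinner_scaleC_right: "cinner x (a *\<^sub>C y) = cnj a * cinner x (y::'h::complex_inner)"
  by (metis cinner_scaleC_left cinner_commute complex_cnj_mult)

lemma scaleC_minus1: "(-1) *\<^sub>C x = - (x::'h::complex_inner)"
  using scaleR_eq_scaleC[of "-1" x] by simp

lemma cinner_minus_left: "cinner (- x) y = - cinner x (y::'h::complex_inner)"
  using cinner_scaleC_left[of "-1" x y] by (simp add: scaleC_minus1)

lemma cinner_minus_right: "cinner x (- y) = - cinner x (y::'h::complex_inner)"
  using cinner_scaleC_right[of x "-1" y] by (simp add: scaleC_minus1)

lemma cinner_diff_left: "cinner (x - y) z = cinner x z - cinner y (z::'h::complex_inner)"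
  using cinner_add_left[of x "- y" z] by (simp add: cinner_minus_left)

lemma cinner_diff_right: "cinner z (x - y) = cinner z x - cinner z (y::'h::complex_inner)"
  using cinner_add_right[of z x "- y"] by (simp add: cinner_minus_right)

lemma cinner_zero [simp]: "cinner 0 x = 0" "cinner x 0 = (0::complex)" for x :: "'h::complex_inner"
  using cinner_diff_left[of x x x] cinner_diff_right[of x x x] by simp_all

lemma cinner_sum_left: "cinner (\<Sum>i\<in>S. f i) x = (\<Sum>i\<in>S. cinner (f i) (x::'h::complex_inner))"
  by (induction S rule: infinite_finite_induct) (auto simp: cinner_add_left)

lemma cinner_sum_right: "cinner x (\<Sum>i\<in>S. f i) = (\<Sum>i\<in>S. cinner (x::'h::complex_inner) (f i))"
  by (induction S rule: infinite_finite_induct) (auto simp: cinner_add_right)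

lemma cinner_self: "cinner x x = complex_of_real ((norm (x::'h::complex_inner))\<^sup>2)"
proof -
  have "Im (cinner x x) = 0" using cinner_commute[of x x] by (simp add: complex_eq_iff)
  moreover have "Re (cinner x x) = (norm x)\<^sup>2"
    by (simp add: power2_norm_eq_inner inner_eq_Re_cinner)
  ultimately show ?thesis by (simp add: complex_eq_iff)
qed

lemma norm_scaleC [simp]: "norm (a *\<^sub>C x) = cmod a * norm (x::'h::complex_inner)"
proof -
  have "complex_of_real ((norm (a *\<^sub>C x))\<^sup>2) = complex_of_real ((cmod a)\<^sup>2 * (norm x)\<^sup>2)"
    unfolding cinner_self[symmetric] cinner_scaleC_left cinner_scaleC_right
    by (simp add: cinner_self complex_norm_square[symmetric] mult.commute)
  then have "(norm (a *\<^sub>C x))\<^sup>2 = (cmod a * norm x)\<^sup>2"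
    by (simp only: of_real_eq_iff power_mult_distrib)
  then show ?thesis by (rule power2_eq_imp_eq) auto
qed

lemma scaleC_zero [simp]: "a *\<^sub>C (0::'h::complex_inner) = 0"
  using norm_scaleC[of a "0::'h"] by simp

lemma scaleC_diff_right: "a *\<^sub>C (x - y) = a *\<^sub>C x - a *\<^sub>C (y::'h::complex_inner)"
  using scaleC_add_right[of a "x - y" y] by (simp add: algebra_simps)

lemma tendsto_scaleC [tendsto_intros]:
  fixes f :: "_ \<Rightarrow> 'h::complex_inner"
  assumes "(f \<longlongrightarrow> x) net"
  shows "((\<lambda>n. a *\<^sub>C f n) \<longlongrightarrow> a *\<^sub>C x) net"
proof -
  have "((\<lambda>n. cmod a * norm (f n - x)) \<longlongrightarrow> cmod a * 0) net"
    by (intro tendsto_mult_left tendsto_norm_zero LIM_zero assms)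
  then have "((\<lambda>n. norm (a *\<^sub>C f n - a *\<^sub>C x)) \<longlongrightarrow> 0) net"
    by (simp flip: scaleC_diff_right)
  then show ?thesis by (rule LIM_zero_cancel[OF tendsto_norm_zero_cancel])
qed

text \<open>Reduces continuity of the complex scalar product to that of the real one.\<close>

lemma cinner_eq_inner: "cinner x y = Complex (inner x y) (inner x (\<i> *\<^sub>C y))"
  for x y :: "'h::complex_inner"
  by (simp add: complex_eq_iff inner_eq_Re_cinner cinner_scaleC_right)

lemma tendsto_cinner [tendsto_intros]:
  fixes f g :: "_ \<Rightarrow> 'h::complex_inner"
  assumes "(f \<longlongrightarrow> x) net" "(g \<longlongrightarrow> y) net"
  shows "((\<lambda>n. cinner (f n) (g n)) \<longlongrightarrow> cinner x y) net"
  unfolding cinner_eq_inner using assms by (intro tendsto_intros)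

lemma norm_diff_squared_cinner:
  "complex_of_real ((norm (x - y))\<^sup>2) =
     cinner x x - cinner x y - cinner y x + cinner y (y::'h::complex_inner)"
  unfolding cinner_self[symmetric] by (simp add: cinner_diff_left cinner_diff_right)

lemma limit_in_closure:
  fixes X :: "nat \<Rightarrow> 'b::metric_space"
  assumes "\<And>n. X n \<in> A" "X \<longlonglongrightarrow> p"
  shows "p \<in> closure A"
  using assms unfolding closure_sequential by blast

section \<open>Square integrable functions\<close>

text \<open>Square integrable functions stay functions, without classes modulo null sets; functions
  that agree almost everywhere are identified only through their image under an isometry.\<close>

definition sqint :: "'a measure \<Rightarrow> ('a \<Rightarrow> complex) \<Rightarrow> bool" where
  "sqint M f \<longleftrightarrow> f \<in> borel_measurable M \<and> integrable M (\<lambda>z. (cmod (f z))\<^sup>2)"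

text \<open>The squared norm is used throughout, at the price of a factor 2 in the triangle
  inequality.\<close>

definition l2 :: "'a measure \<Rightarrow> ('a \<Rightarrow> complex) \<Rightarrow> real" where
  "l2 M f = (\<integral>z. (cmod (f z))\<^sup>2 \<partial>M)"

definition l2ip :: "'a measure \<Rightarrow> ('a \<Rightarrow> complex) \<Rightarrow> ('a \<Rightarrow> complex) \<Rightarrow> complex" where
  "l2ip M f g = (\<integral>z. f z * cnj (g z) \<partial>M)"

lemma sqint_measurable [measurable_dest]: "sqint M f \<Longrightarrow> f \<in> borel_measurable M"
  by (simp add: sqint_def)

lemma sqint_bound:
  assumes "sqint M g" "f \<in> borel_measurable M" "\<And>z. cmod (f z) \<le> C * cmod (g z)"
  shows "sqint M f"
proof -
  have "integrable M (\<lambda>z. C\<^sup>2 * (cmod (g z))\<^sup>2)" using assms(1) by (simp add: sqint_def)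
  then have "integrable M (\<lambda>z. (cmod (f z))\<^sup>2)"
  proof (rule Bochner_Integration.integrable_bound)
    show "(\<lambda>z. (cmod (f z))\<^sup>2) \<in> borel_measurable M" using assms(2) by measurable
    have "(cmod (f z))\<^sup>2 \<le> (C * cmod (g z))\<^sup>2" for z using assms(3) by (intro power_mono) auto
    then show "AE z in M. norm ((cmod (f z))\<^sup>2) \<le> norm (C\<^sup>2 * (cmod (g z))\<^sup>2)"
      by (simp add: power_mult_distrib)
  qed
  then show ?thesis using assms(2) by (simp add: sqint_def)
qed

lemma norm_add_squared_le: "(norm (a + b))\<^sup>2 \<le> 2 * (norm a)\<^sup>2 + 2 * (norm (b::'b::real_normed_vector))\<^sup>2"
proof -
  have "(norm (a + b))\<^sup>2 \<le> (norm a + norm b)\<^sup>2"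
    by (intro power_mono norm_triangle_ineq) auto
  also have "\<dots> \<le> 2 * (norm a)\<^sup>2 + 2 * (norm b)\<^sup>2"
    using sum_squares_bound[of "norm a" "norm b"] by (simp add: power2_sum)
  finally show ?thesis .
qed

lemma sqint_add: assumes "sqint M f" "sqint M g" shows "sqint M (\<lambda>z. f z + g z)"
proof -
  have [measurable]: "f \<in> borel_measurable M" "g \<in> borel_measurable M" using assms by auto
  have "integrable M (\<lambda>z. 2 * (cmod (f z))\<^sup>2 + 2 * (cmod (g z))\<^sup>2)"
    using assms by (simp add: sqint_def)
  then have "integrable M (\<lambda>z. (cmod (f z + g z))\<^sup>2)"
    by (rule Bochner_Integration.integrable_bound) (use norm_add_squared_le in auto)
  then show ?thesis by (simp add: sqint_def)
qed

lemma sqint_scale: "sqint M f \<Longrightarrow> sqint M (\<lambda>z. c * f z)"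
  by (rule sqint_bound[of _ f _ "cmod c"]) (auto simp: norm_mult)

lemma sqint_diff: "sqint M f \<Longrightarrow> sqint M g \<Longrightarrow> sqint M (\<lambda>z. f z - g z)"
  using sqint_add[of M f "\<lambda>z. (-1) * g z"] sqint_scale[of M g "-1"] by simp

lemma sqint_0 [simp]: "sqint M (\<lambda>z. 0)"
  by (simp add: sqint_def)

lemma sqint_sum: "(\<And>i. i \<in> S \<Longrightarrow> sqint M (f i)) \<Longrightarrow> sqint M (\<lambda>z. \<Sum>i\<in>S. f i z)"
  by (induction S rule: infinite_finite_induct) (auto intro: sqint_add)

lemma l2_nonneg [simp]: "0 \<le> l2 M f"
  by (simp add: l2_def)

lemma nn_integral_sqint: "sqint M f \<Longrightarrow> (\<integral>\<^sup>+z. ennreal ((cmod (f z))\<^sup>2) \<partial>M) = ennreal (l2 M f)"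
  unfolding sqint_def l2_def by (intro nn_integral_eq_integral) auto

lemma sqint_iff_nn_integral:
  "sqint M f \<longleftrightarrow> f \<in> borel_measurable M \<and> (\<integral>\<^sup>+z. ennreal ((cmod (f z))\<^sup>2) \<partial>M) < \<infinity>"
  unfolding sqint_def by (auto simp: integrable_iff_bounded)

lemma integrable_mult_sqint:
  assumes "sqint M f" "sqint M g"
  shows "integrable M (\<lambda>z. f z * g z)"
proof -
  have [measurable]: "f \<in> borel_measurable M" "g \<in> borel_measurable M" using assms by auto
  have "integrable M (\<lambda>z. (cmod (f z))\<^sup>2 + (cmod (g z))\<^sup>2)"
    using assms by (simp add: sqint_def)
  then show ?thesis
  proof (rule Bochner_Integration.integrable_bound)
    have "cmod (f z) * cmod (g z) \<le> (cmod (f z))\<^sup>2 + (cmod (g z))\<^sup>2" for z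
    proof -
      have "cmod (f z) * cmod (g z) \<le> 2 * cmod (f z) * cmod (g z)" by simp
      also have "\<dots> \<le> (cmod (f z))\<^sup>2 + (cmod (g z))\<^sup>2" by (rule sum_squares_bound)
      finally show ?thesis .
    qed
    then show "AE z in M. norm (f z * g z) \<le> norm ((cmod (f z))\<^sup>2 + (cmod (g z))\<^sup>2)"
      by (simp add: norm_mult)
  qed simp
qed

lemma sqint_cnj: "sqint M f \<Longrightarrow> sqint M (\<lambda>z. cnj (f z))"
  by (rule sqint_bound[of _ f _ 1])
    (auto intro!: borel_measurable_continuous_on[of cnj] continuous_intros)

lemma sqint_indicator_times:
  assumes f: "sqint M f" and [measurable]: "A \<in> sets M"
  shows "sqint M (\<lambda>z. indicator A z * f z)"
proof -
  have [measurable]: "f \<in> borel_measurable M" using f by auto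
  show ?thesis by (rule sqint_bound[OF f, of _ 1]) (auto simp: indicator_def)
qed

lemma integrable_l2ip: "sqint M f \<Longrightarrow> sqint M g \<Longrightarrow> integrable M (\<lambda>z. f z * cnj (g z))"
  using integrable_mult_sqint sqint_cnj by blast

lemma l2ip_add_left:
  "sqint M f \<Longrightarrow> sqint M g \<Longrightarrow> sqint M h \<Longrightarrow> l2ip M (\<lambda>z. f z + g z) h = l2ip M f h + l2ip M g h"
  unfolding l2ip_def by (simp add: distrib_right integrable_l2ip)

lemma l2ip_diff_left:
  "sqint M f \<Longrightarrow> sqint M g \<Longrightarrow> sqint M h \<Longrightarrow> l2ip M (\<lambda>z. f z - g z) h = l2ip M f h - l2ip M g h"
  unfolding l2ip_def by (simp add: left_diff_distrib integrable_l2ip)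

lemma l2ip_scale_left: "l2ip M (\<lambda>z. c * f z) h = c * l2ip M f h"
  unfolding l2ip_def by (simp add: mult.assoc)

lemma l2ip_commute: "l2ip M f g = cnj (l2ip M g f)"
  unfolding l2ip_def Bochner_Integration.integral_cnj[symmetric] by (simp add: mult.commute)

lemma l2ip_add_right:
  "sqint M f \<Longrightarrow> sqint M g \<Longrightarrow> sqint M h \<Longrightarrow> l2ip M h (\<lambda>z. f z + g z) = l2ip M h f + l2ip M h g"
  by (subst (1 2 3) l2ip_commute) (simp add: l2ip_add_left)

lemma l2ip_diff_right:
  "sqint M f \<Longrightarrow> sqint M g \<Longrightarrow> sqint M h \<Longrightarrow> l2ip M h (\<lambda>z. f z - g z) = l2ip M h f - l2ip M h g"
  by (subst (1 2 3) l2ip_commute) (simp add: l2ip_diff_left)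

lemma l2ip_scale_right: "l2ip M h (\<lambda>z. c * f z) = cnj c * l2ip M h f"
  by (subst (1 2) l2ip_commute) (simp add: l2ip_scale_left)

lemma l2ip_self: "l2ip M f f = complex_of_real (l2 M f)"
proof -
  have "l2ip M f f = (\<integral>z. complex_of_real ((cmod (f z))\<^sup>2) \<partial>M)"
    unfolding l2ip_def by (simp only: complex_norm_square)
  then show ?thesis unfolding l2_def by (simp only: integral_complex_of_real)
qed

lemma l2_diff_expand:
  assumes "sqint M f" "sqint M g"
  shows "complex_of_real (l2 M (\<lambda>z. f z - g z)) =
     l2ip M f f - l2ip M f g - l2ip M g f + l2ip M g g"
  unfolding l2ip_self[symmetric] using assms
  by (simp add: l2ip_diff_left l2ip_diff_right sqint_diff)

lemma l2_diff_commute: "l2 M (\<lambda>z. f z - g z) = l2 M (\<lambda>z. g z - f z)"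
  unfolding l2_def by (simp add: norm_minus_commute)

lemma l2_mono_bound:
  assumes "sqint M g" "f \<in> borel_measurable M" "\<And>z. cmod (f z) \<le> C * cmod (g z)"
  shows "l2 M f \<le> C\<^sup>2 * l2 M g"
proof -
  have "sqint M f" using sqint_bound assms by blast
  have "l2 M f \<le> (\<integral>z. C\<^sup>2 * (cmod (g z))\<^sup>2 \<partial>M)"
    unfolding l2_def
  proof (rule integral_mono)
    show "(cmod (f z))\<^sup>2 \<le> C\<^sup>2 * (cmod (g z))\<^sup>2" for z
      using power_mono[OF assms(3)[of z], of 2] by (simp add: power_mult_distrib)
  qed (use \<open>sqint M f\<close> assms in \<open>auto simp: sqint_def\<close>)
  then show ?thesis by (simp add: l2_def)
qed

lemma l2_add_le:
  assumes "sqint M f" "sqint M g"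
  shows "l2 M (\<lambda>z. f z + g z) \<le> 2 * l2 M f + 2 * l2 M g"
proof -
  have "l2 M (\<lambda>z. f z + g z) \<le> (\<integral>z. 2 * (cmod (f z))\<^sup>2 + 2 * (cmod (g z))\<^sup>2 \<partial>M)"
    unfolding l2_def
    by (rule integral_mono) (use sqint_add[OF assms] assms norm_add_squared_le in \<open>auto simp: sqint_def\<close>)
  also have "\<dots> = 2 * l2 M f + 2 * l2 M g"
    unfolding l2_def using assms by (simp add: sqint_def)
  finally show ?thesis .
qed

lemma l2_diff_triangle:
  assumes "sqint M f" "sqint M g" "sqint M h"
  shows "l2 M (\<lambda>z. f z - h z) \<le> 2 * l2 M (\<lambda>z. f z - g z) + 2 * l2 M (\<lambda>z. g z - h z)"
  using l2_add_le[OF sqint_diff[OF assms(1,2)] sqint_diff[OF assms(2,3)]] by simp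

lemma l2ip_Cauchy_Schwarz:
  assumes "sqint M f" "sqint M g"
  shows "(cmod (l2ip M f g))\<^sup>2 \<le> l2 M f * l2 M g"
proof -
  have [measurable]: "f \<in> borel_measurable M" "g \<in> borel_measurable M" using assms by auto
  have "ennreal (cmod (l2ip M f g)) \<le> (\<integral>\<^sup>+z. ennreal (cmod (f z)) * ennreal (cmod (g z)) \<partial>M)"
    unfolding l2ip_def
    using integral_norm_bound_ennreal[OF integrable_l2ip[OF assms]]
    by (simp add: norm_mult ennreal_mult)
  then have "(ennreal (cmod (l2ip M f g)))\<^sup>2 \<le>
      (\<integral>\<^sup>+z. ennreal (cmod (f z)) * ennreal (cmod (g z)) \<partial>M)\<^sup>2"
    by (intro power_mono) auto
  also have "\<dots> \<le> (\<integral>\<^sup>+z. (ennreal (cmod (f z)))\<^sup>2 \<partial>M) * (\<integral>\<^sup>+z. (ennreal (cmod (g z)))\<^sup>2 \<partial>M)"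
    by (intro Cauchy_Schwarz_nn_integral) auto
  also have "\<dots> = ennreal (l2 M f * l2 M g)"
    by (simp add: ennreal_power nn_integral_sqint assms ennreal_mult)
  finally show ?thesis by (simp add: ennreal_power)
qed

text \<open>The difference splits into one error in each argument, and Cauchy-Schwarz bounds both;
  \<open>2 * ?b n + 2 * l2 M g\<close> controls the norms of the \<open>G n\<close>.\<close>

lemma tendsto_l2ip:
  assumes f: "\<And>n. sqint M (F n)" "sqint M f" "(\<lambda>n. l2 M (\<lambda>z. F n z - f z)) \<longlonglongrightarrow> 0"
    and g: "\<And>n. sqint M (G n)" "sqint M g" "(\<lambda>n. l2 M (\<lambda>z. G n z - g z)) \<longlonglongrightarrow> 0"
  shows "(\<lambda>n. l2ip M (F n) (G n)) \<longlonglongrightarrow> l2ip M f g"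
proof -
  let ?a = "\<lambda>n. l2 M (\<lambda>z. F n z - f z)" and ?b = "\<lambda>n. l2 M (\<lambda>z. G n z - g z)"
  have "(\<lambda>n. l2ip M (F n) (G n) - l2ip M f g) \<longlonglongrightarrow> 0"
  proof (rule Lim_null_comparison)
    show "(\<lambda>n. sqrt (?a n * (2 * ?b n + 2 * l2 M g)) + sqrt (l2 M f * ?b n)) \<longlonglongrightarrow> 0"
      by (rule tendsto_eq_intros refl f(3) g(3))+ simp
    have "cmod (l2ip M (F n) (G n) - l2ip M f g) \<le>
        sqrt (?a n * (2 * ?b n + 2 * l2 M g)) + sqrt (l2 M f * ?b n)" for n
    proof -
      have "l2ip M (F n) (G n) - l2ip M f g =
          l2ip M (\<lambda>z. F n z - f z) (G n) + l2ip M f (\<lambda>z. G n z - g z)"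
        using f g by (simp add: l2ip_diff_left l2ip_diff_right sqint_diff)
      then have "cmod (l2ip M (F n) (G n) - l2ip M f g) \<le>
          cmod (l2ip M (\<lambda>z. F n z - f z) (G n)) + cmod (l2ip M f (\<lambda>z. G n z - g z))"
        using norm_triangle_ineq by metis
      also have "cmod (l2ip M (\<lambda>z. F n z - f z) (G n)) \<le> sqrt (?a n * l2 M (G n))"
        using f g by (intro real_le_rsqrt l2ip_Cauchy_Schwarz sqint_diff)
      also have "\<dots> \<le> sqrt (?a n * (2 * ?b n + 2 * l2 M g))"
        using l2_add_le[OF sqint_diff[OF g(1)[of n] g(2)] g(2)]
        by (intro real_sqrt_le_mono mult_left_mono) auto
      also have "cmod (l2ip M f (\<lambda>z. G n z - g z)) \<le> sqrt (l2 M f * ?b n)"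
        using f g by (intro real_le_rsqrt l2ip_Cauchy_Schwarz sqint_diff)
      finally show ?thesis by simp
    qed
    then show "\<forall>\<^sub>F n in sequentially. norm (l2ip M (F n) (G n) - l2ip M f g) \<le>
        sqrt (?a n * (2 * ?b n + 2 * l2 M g)) + sqrt (l2 M f * ?b n)"
      by simp
  qed
  then show ?thesis by (simp add: LIM_zero_iff)
qed

lemma sqint_const: "finite_measure M \<Longrightarrow> sqint M (\<lambda>z. c)"
  by (simp add: sqint_def finite_measure.integrable_const)

lemma sqint_bounded:
  assumes "finite_measure M" "f \<in> borel_measurable M" "\<And>z. cmod (f z) \<le> B"
  shows "sqint M f"
proof -
  have "0 \<le> B" using assms(3) norm_ge_zero order_trans by blast
  then show ?thesis
    using sqint_bound[OF sqint_const[OF assms(1), of "complex_of_real B"] assms(2), of 1] assms(3) by simp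
qed

lemma l2_dominated_convergence:
  assumes g: "sqint M g" and f: "f \<in> borel_measurable M" "\<And>n. F n \<in> borel_measurable M"
    and lim: "\<And>z. z \<in> space M \<Longrightarrow> (\<lambda>n. F n z) \<longlonglongrightarrow> f z"
    and bound: "\<And>n z. z \<in> space M \<Longrightarrow> cmod (F n z - f z) \<le> cmod (g z)"
  shows "(\<lambda>n. l2 M (\<lambda>z. F n z - f z)) \<longlonglongrightarrow> 0"
proof -
  have "(\<lambda>n. \<integral>z. (cmod (F n z - f z))\<^sup>2 \<partial>M) \<longlonglongrightarrow> (\<integral>z. 0 \<partial>M)"
  proof (rule integral_dominated_convergence)
    show "integrable M (\<lambda>z. (cmod (g z))\<^sup>2)" using g by (simp add: sqint_def)
    show "AE z in M. (\<lambda>n. (cmod (F n z - f z))\<^sup>2) \<longlonglongrightarrow> 0"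
    proof (rule AE_I2)
      fix z assume "z \<in> space M"
      then have "(\<lambda>n. (cmod (F n z - f z))\<^sup>2) \<longlonglongrightarrow> (cmod (f z - f z))\<^sup>2"
        by (intro tendsto_intros lim)
      then show "(\<lambda>n. (cmod (F n z - f z))\<^sup>2) \<longlonglongrightarrow> 0" by simp
    qed
    show "AE z in M. norm ((cmod (F n z - f z))\<^sup>2) \<le> (cmod (g z))\<^sup>2" for n
      using bound by (intro AE_I2) (simp add: power_mono)
  qed (use f in auto)
  then show ?thesis by (simp add: l2_def)
qed

subsection \<open>Completeness\<close>

text \<open>Along a subsequence whose squared increments are below \<open>(1/4)^k\<close>, these
  remain summable after multiplication by \<open>2^k\<close>. This forces absolute convergence
  almost everywhere, and Fatou's lemma turns the pointwise limit into a limit in mean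
  square.\<close>

theorem Riesz_Fischer:
  assumes f: "\<And>n. sqint M (f n)"
    and C: "\<And>e. e > 0 \<Longrightarrow> \<exists>N. \<forall>m\<ge>N. \<forall>n\<ge>N. l2 M (\<lambda>z. f m z - f n z) < e"
  shows "\<exists>g. sqint M g \<and> (\<lambda>n. l2 M (\<lambda>z. f n z - g z)) \<longlonglongrightarrow> 0"
proof -
  have [measurable]: "f n \<in> borel_measurable M" for n using f by auto
  have "\<forall>k. \<exists>N. \<forall>m\<ge>N. \<forall>n\<ge>N. l2 M (\<lambda>z. f m z - f n z) < (1/4)^k"
    using C by simp
  from choice[OF this] obtain N where
    N: "\<And>k m n. m \<ge> N k \<Longrightarrow> n \<ge> N k \<Longrightarrow> l2 M (\<lambda>z. f m z - f n z) < (1/4)^k"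
    by blast
  \<comment> \<open>Summing all thresholds up to \<open>k\<close> puts both \<open>r k\<close> and
    \<open>r (Suc k)\<close> above \<open>N k\<close>; adding \<open>k\<close> makes
    \<open>r\<close> unbounded.\<close>
  define r where "r k = (\<Sum>j\<le>k. N j) + k" for k
  have rN: "r k \<ge> N k" for k
    unfolding r_def using member_le_sum[of k "{..k}" N] by auto
  have rk: "r k \<ge> k" for k by (simp add: r_def)
  have rSuc: "r (Suc k) \<ge> N k" for k
    unfolding r_def using member_le_sum[of k "{..k}" N] by auto
  define d where "d k z = f (r (Suc k)) z - f (r k) z" for k z
  have d: "sqint M (d k)" for k unfolding d_def using f by (intro sqint_diff)
  have [measurable]: "d k \<in> borel_measurable M" for k using d by auto
  have ld: "l2 M (d k) \<le> (1/4)^k" for k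
    using N[OF rSuc rN, of k] by (simp add: d_def[abs_def])
  have "(\<integral>\<^sup>+z. (\<Sum>k. ennreal (2^k * (cmod (d k z))\<^sup>2)) \<partial>M) = (\<Sum>k. \<integral>\<^sup>+z. ennreal (2^k * (cmod (d k z))\<^sup>2) \<partial>M)"
    by (rule nn_integral_suminf) simp
  also have "\<dots> \<le> (\<Sum>k. ennreal ((1/2)^k))"
  proof (intro suminf_le)
    fix k
    have "(\<integral>\<^sup>+z. ennreal (2^k * (cmod (d k z))\<^sup>2) \<partial>M) = ennreal (2^k) * ennreal (l2 M (d k))"
      by (simp add: ennreal_mult nn_integral_cmult nn_integral_sqint[OF d])
    also have "\<dots> = ennreal (2^k * l2 M (d k))" by (simp add: ennreal_mult)
    also have "\<dots> \<le> ennreal (2^k * (1/4)^k)" using ld by (intro ennreal_leI mult_left_mono) auto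
    also have "(2::real)^k * (1/4)^k = (1/2)^k" unfolding power_mult_distrib[symmetric] by simp
    finally show "(\<integral>\<^sup>+z. ennreal (2^k * (cmod (d k z))\<^sup>2) \<partial>M) \<le> ennreal ((1/2)^k)" .
  qed auto
  also have "\<dots> = ennreal (\<Sum>k. (1/2)^k)"
    by (intro suminf_ennreal2) (auto intro: summable_geometric)
  also have "\<dots> < \<infinity>" by simp
  finally have "(\<integral>\<^sup>+z. (\<Sum>k. ennreal (2^k * (cmod (d k z))\<^sup>2)) \<partial>M) \<noteq> \<infinity>"
    by (rule less_imp_neq)
  then have "AE z in M. (\<Sum>k. ennreal (2^k * (cmod (d k z))\<^sup>2)) \<noteq> \<infinity>"
    by (intro nn_integral_PInf_AE) auto
  then have conv: "AE z in M. convergent (\<lambda>k. f (r k) z)"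
  proof (eventually_elim)
    case (elim z)
    then have s: "summable (\<lambda>k. 2^k * (cmod (d k z))\<^sup>2)"
      by (intro summable_suminf_not_top) auto
    have "summable (\<lambda>k. d k z)"
    proof (rule summable_comparison_test')
      show "summable (\<lambda>k. (1/2)^k + 2^k * (cmod (d k z))\<^sup>2)"
        using s by (intro summable_add summable_geometric) auto
      fix k :: nat
      let ?x = "cmod (d k z)" and ?a = "(2::real)^k"
      \<comment> \<open>With \<open>b = 2^k * ?x\<close>, division by \<open>2^k\<close> bounds the
        increment by \<open>(1/2)^k\<close> plus a term of the convergent series.\<close>
      have "b \<le> 1 + b\<^sup>2" if "0 \<le> b" for b :: real
        using sum_squares_bound[of b 1] that by simp
      from this[of "?a * ?x"] have "?a * ?x \<le> 1 + ?a\<^sup>2 * ?x\<^sup>2"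
        by (simp add: power_mult_distrib)
      then have "?a * ?x / ?a \<le> (1 + ?a\<^sup>2 * ?x\<^sup>2) / ?a" by (intro divide_right_mono) auto
      also have "\<dots> = (1/2)^k + ?a * ?x\<^sup>2" by (simp add: power_divide field_simps power2_eq_square)
      finally show "cmod (d k z) \<le> (1/2)^k + ?a * ?x\<^sup>2" by simp
    qed
    then have "convergent (\<lambda>n. \<Sum>k<n. d k z)" by (simp add: summable_iff_convergent)
    then have "convergent (\<lambda>n. f (r n) z - f (r 0) z)"
      by (simp add: d_def sum_lessThan_telescope[of "\<lambda>k. f (r k) z"])
    then show ?case
      using convergent_add[OF _ convergent_const[of "f (r 0) z"]] by fastforce
  qed
  define g where "g z = lim (\<lambda>k. f (r k) z)" for z
  have [measurable]: "g \<in> borel_measurable M"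
    unfolding g_def by (rule borel_measurable_lim_metric) simp
  have fatou: "(\<integral>\<^sup>+z. ennreal ((cmod (f n z - g z))\<^sup>2) \<partial>M) \<le> ennreal e"
    if e: "\<And>m. m \<ge> K \<Longrightarrow> l2 M (\<lambda>z. f n z - f m z) \<le> e" for n K e
  proof -
    have "(\<integral>\<^sup>+z. ennreal ((cmod (f n z - g z))\<^sup>2) \<partial>M) =
        (\<integral>\<^sup>+z. liminf (\<lambda>k. ennreal ((cmod (f n z - f (r k) z))\<^sup>2)) \<partial>M)"
    proof (rule nn_integral_cong_AE, use conv in eventually_elim)
      fix z assume "convergent (\<lambda>k. f (r k) z)"
      then have "(\<lambda>k. f (r k) z) \<longlonglongrightarrow> g z" unfolding g_def by (simp add: convergent_LIMSEQ_iff)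
      then have "(\<lambda>k. ennreal ((cmod (f n z - f (r k) z))\<^sup>2)) \<longlonglongrightarrow> ennreal ((cmod (f n z - g z))\<^sup>2)"
        by (intro tendsto_intros)
      then show "ennreal ((cmod (f n z - g z))\<^sup>2) = liminf (\<lambda>k. ennreal ((cmod (f n z - f (r k) z))\<^sup>2))"
        by (intro lim_imp_Liminf[symmetric]) auto
    qed
    also have "\<dots> \<le> liminf (\<lambda>k. \<integral>\<^sup>+z. ennreal ((cmod (f n z - f (r k) z))\<^sup>2) \<partial>M)"
      by (rule nn_integral_liminf) simp
    also have "\<dots> = liminf (\<lambda>k. ennreal (l2 M (\<lambda>z. f n z - f (r k) z)))"
      by (simp add: nn_integral_sqint sqint_diff f)
    also have "\<dots> \<le> liminf (\<lambda>k. ennreal e)"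
    proof (rule Liminf_mono)
      show "\<forall>\<^sub>F k in sequentially. ennreal (l2 M (\<lambda>z. f n z - f (r k) z)) \<le> ennreal e"
        using e rk by (intro eventually_sequentiallyI[of K] ennreal_leI) (meson order_trans)
    qed
    also have "\<dots> = ennreal e" by (simp add: Liminf_const)
    finally show ?thesis .
  qed
  \<comment> \<open>The threshold for \<open>k = 0\<close> is 1, so the Fatou bound makes one
    difference square integrable, and with it \<open>g\<close>.\<close>
  have diff: "sqint M (\<lambda>z. f (N 0) z - g z)"
  proof -
    have "(\<integral>\<^sup>+z. ennreal ((cmod (f (N 0) z - g z))\<^sup>2) \<partial>M) \<le> ennreal 1"
      using N[of 0 "N 0"] by (intro fatou[of "N 0"]) (auto intro: less_imp_le)
    then show ?thesis
      unfolding sqint_iff_nn_integral by (simp add: le_less_trans[of _ 1])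
  qed
  have g: "sqint M g"
    using sqint_diff[OF f[of "N 0"] diff] by simp
  have "(\<lambda>n. l2 M (\<lambda>z. f n z - g z)) \<longlonglongrightarrow> 0"
  proof (rule LIMSEQ_I)
    fix e :: real assume e: "e > 0"
    then obtain K where K: "\<And>m n. m \<ge> K \<Longrightarrow> n \<ge> K \<Longrightarrow> l2 M (\<lambda>z. f m z - f n z) < e/2"
      using C[of "e/2"] by auto
    have "norm (l2 M (\<lambda>z. f n z - g z) - 0) < e" if "n \<ge> K" for n
    proof -
      have "ennreal (l2 M (\<lambda>z. f n z - g z)) \<le> ennreal (e/2)"
        unfolding nn_integral_sqint[OF sqint_diff[OF f g], symmetric]
        using K that by (intro fatou[of K]) (auto intro: less_imp_le)
      then show ?thesis using e by simp
    qed
    then show "\<exists>K. \<forall>n\<ge>K. norm (l2 M (\<lambda>z. f n z - g z) - 0) < e" by blast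
  qed
  then show ?thesis using g by blast
qed

section \<open>Isometric images of square integrable functions\<close>

text \<open>Linearity and independence of values on null sets are consequences: the squared norm of
  each defect expands into scalar products that cancel.\<close>

locale l2_isometry =
  fixes M :: "'a measure" and U :: "('a \<Rightarrow> complex) \<Rightarrow> 'h::chilbert_space"
  assumes isometry: "sqint M f \<Longrightarrow> sqint M g \<Longrightarrow> cinner (U f) (U g) = l2ip M f g"
begin

lemma norm_diff:
  assumes "sqint M f" "sqint M g"
  shows "(norm (U f - U g))\<^sup>2 = l2 M (\<lambda>z. f z - g z)"
proof -
  have "complex_of_real ((norm (U f - U g))\<^sup>2) = complex_of_real (l2 M (\<lambda>z. f z - g z))"
    using assms by (simp only: norm_diff_squared_cinner l2_diff_expand isometry)
  then show ?thesis by (simp only: of_real_eq_iff)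
qed

lemma eqI: "sqint M f \<Longrightarrow> sqint M g \<Longrightarrow> l2 M (\<lambda>z. f z - g z) = 0 \<Longrightarrow> U f = U g"
  using norm_diff[of f g] by simp

lemma scale:
  assumes "sqint M f" shows "U (\<lambda>z. c * f z) = c *\<^sub>C U f"
proof -
  have "complex_of_real ((norm (U (\<lambda>z. c * f z) - c *\<^sub>C U f))\<^sup>2) = 0"
    unfolding norm_diff_squared_cinner cinner_scaleC_left cinner_scaleC_right
    using assms by (simp add: isometry sqint_scale l2ip_scale_left l2ip_scale_right)
  then show ?thesis by simp
qed

lemma add:
  assumes "sqint M f" "sqint M g" shows "U (\<lambda>z. f z + g z) = U f + U g"
proof -
  have "complex_of_real ((norm (U (\<lambda>z. f z + g z) - (U f + U g)))\<^sup>2) = 0"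
    unfolding norm_diff_squared_cinner cinner_add_left cinner_add_right
    using assms by (simp add: isometry sqint_add l2ip_add_left l2ip_add_right)
  then show ?thesis by simp
qed

lemma zero: "U (\<lambda>z. 0) = 0"
  using scale[of "\<lambda>z. 0" 0] norm_scaleC[of 0 "U (\<lambda>z. 0)"] by simp

lemma diff:
  assumes "sqint M f" "sqint M g" shows "U (\<lambda>z. f z - g z) = U f - U g"
  using add[OF assms(1) sqint_scale[OF assms(2), of "-1"]] scale[OF assms(2), of "-1"]
  by (simp add: scaleC_minus1)

lemma sum:
  "(\<And>i. i \<in> S \<Longrightarrow> sqint M (f i)) \<Longrightarrow> U (\<lambda>z. \<Sum>i\<in>S. f i z) = (\<Sum>i\<in>S. U (f i))"
  by (induction S rule: infinite_finite_induct) (auto simp: zero add sqint_sum)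

lemma tendsto_iff:
  assumes "\<And>n. sqint M (F n)" "sqint M f"
  shows "(\<lambda>n. U (F n)) \<longlonglongrightarrow> U f \<longleftrightarrow> (\<lambda>n. l2 M (\<lambda>z. F n z - f z)) \<longlonglongrightarrow> 0"
proof -
  have eq: "norm (U (F n) - U f) = sqrt (l2 M (\<lambda>z. F n z - f z))" for n
    using norm_diff[OF assms(1)[of n] assms(2)]
    by (metis norm_ge_zero real_sqrt_unique)
  have "(\<lambda>n. U (F n)) \<longlonglongrightarrow> U f \<longleftrightarrow> (\<lambda>n. sqrt (l2 M (\<lambda>z. F n z - f z))) \<longlonglongrightarrow> 0"
    unfolding eq[symmetric] by (simp add: tendsto_norm_zero_iff LIM_zero_iff)
  also have "\<dots> \<longleftrightarrow> (\<lambda>n. l2 M (\<lambda>z. F n z - f z)) \<longlonglongrightarrow> 0"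
    using tendsto_real_sqrt[of "\<lambda>n. l2 M (\<lambda>z. F n z - f z)" 0 sequentially]
      tendsto_power[of "\<lambda>n. sqrt (l2 M (\<lambda>z. F n z - f z))" 0 sequentially 2] by auto
  finally show ?thesis .
qed

text \<open>An isometry reflects Cauchy sequences, so completeness of the square integrable
  functions supplies a preimage of the limit.\<close>

lemma closed_range:
  assumes F: "\<And>n. sqint M (F n)" and lim: "(\<lambda>n. U (F n)) \<longlonglongrightarrow> h"
  shows "\<exists>f. sqint M f \<and> U f = h \<and> (\<lambda>n. l2 M (\<lambda>z. F n z - f z)) \<longlonglongrightarrow> 0"
proof -
  have "\<exists>f. sqint M f \<and> (\<lambda>n. l2 M (\<lambda>z. F n z - f z)) \<longlonglongrightarrow> 0"
  proof (rule Riesz_Fischer[OF F])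
    fix e :: real assume "e > 0"
    then obtain N where N: "\<And>m n. m \<ge> N \<Longrightarrow> n \<ge> N \<Longrightarrow> norm (U (F m) - U (F n)) < sqrt e"
      using LIMSEQ_imp_Cauchy[OF lim] unfolding Cauchy_iff by (meson real_sqrt_gt_zero)
    have "l2 M (\<lambda>z. F m z - F n z) < e" if "m \<ge> N" "n \<ge> N" for m n
      using N[OF that] norm_diff[OF F[of m] F[of n]]
      by (metis norm_ge_zero real_sqrt_less_iff real_sqrt_unique)
    then show "\<exists>N. \<forall>m\<ge>N. \<forall>n\<ge>N. l2 M (\<lambda>z. F m z - F n z) < e" by blast
  qed
  then obtain f where f: "sqint M f" "(\<lambda>n. l2 M (\<lambda>z. F n z - f z)) \<longlonglongrightarrow> 0" by blast
  then have "(\<lambda>n. U (F n)) \<longlonglongrightarrow> U f" using tendsto_iff[OF F f(1)] by simp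
  from LIMSEQ_unique[OF this lim] have "U f = h" .
  then show ?thesis using f by blast
qed

lemma closure_span_subset_range:
  assumes y: "\<And>v. v \<in> Y \<Longrightarrow> \<exists>f. sqint M f \<and> U f = v"
    and h: "h \<in> closure (complex_vector.span Y)"
  shows "\<exists>f. sqint M f \<and> U f = h"
proof -
  have sub: "complex_vector.span Y \<subseteq> {U f | f. sqint M f}"
  proof (rule complex_vector.span_minimal)
    show "Y \<subseteq> {U f | f. sqint M f}" using y by blast
    show "complex_vector.subspace {U f | f. sqint M f}"
      unfolding complex_vector.subspace_def
    proof (intro conjI ballI allI)
      show "0 \<in> {U f |f. sqint M f}" using zero sqint_0 by force
      fix x assume "x \<in> {U f |f. sqint M f}"
      then obtain f where f: "x = U f" "sqint M f" by blast
      show "c *\<^sub>C x \<in> {U f |f. sqint M f}" for c using scale[of f c] sqint_scale[of M f c] f by force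
      fix y assume "y \<in> {U f |f. sqint M f}"
      then obtain g where g: "y = U g" "sqint M g" by blast
      show "x + y \<in> {U f |f. sqint M f}" using add[of f g] sqint_add[of M f g] f g by force
    qed
  qed
  obtain v where v: "\<And>n. v n \<in> complex_vector.span Y" "v \<longlonglongrightarrow> h"
    using h unfolding closure_sequential by blast
  have "\<exists>f. sqint M f \<and> U f = v n" for n
    using subsetD[OF sub v(1)[of n]] unfolding mem_Collect_eq by metis
  then obtain F where F: "\<And>n. sqint M (F n)" "\<And>n. U (F n) = v n" by metis
  show ?thesis using closed_range[of F h, OF F(1)] v(2) F(2) by auto
qed

end

text \<open>The index type is arbitrary because two dense families occur: moment functions, and
  indicators indexed by the Borel sets.\<close>

definition approximable ::
  "'a measure \<Rightarrow> 'i set \<Rightarrow> ('i \<Rightarrow> 'a \<Rightarrow> complex) \<Rightarrow> ('a \<Rightarrow> complex) \<Rightarrow> bool" where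
  "approximable M I F f \<longleftrightarrow>
     (\<forall>e>0. \<exists>S \<alpha>. finite S \<and> S \<subseteq> I \<and> l2 M (\<lambda>z. (\<Sum>i\<in>S. \<alpha> i * F i z) - f z) < e)"

lemma approximable_sequence:
  assumes "approximable M I F f"
  obtains S \<alpha> where "\<And>n::nat. finite (S n)" "\<And>n. S n \<subseteq> I"
    "(\<lambda>n. l2 M (\<lambda>z. (\<Sum>i\<in>S n. \<alpha> n i * F i z) - f z)) \<longlonglongrightarrow> 0"
proof -
  let ?P = "\<lambda>n p. finite (fst p) \<and> fst p \<subseteq> I \<and>
    l2 M (\<lambda>z. (\<Sum>i\<in>fst p. snd p i * F i z) - f z) < 1 / real (Suc n)"
  have "\<forall>n. \<exists>p. ?P n p"
  proof
    fix n
    have "1 / real (Suc n) > 0" by simp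
    then obtain S \<alpha> where "finite S" "S \<subseteq> I"
      "l2 M (\<lambda>z. (\<Sum>i\<in>S. \<alpha> i * F i z) - f z) < 1 / real (Suc n)"
      using assms unfolding approximable_def by blast
    then show "\<exists>p. ?P n p" by (intro exI[of _ "(S, \<alpha>)"]) simp
  qed
  from choice[OF this] obtain p where p: "\<And>n. ?P n (p n)" by blast
  have "(\<lambda>n. l2 M (\<lambda>z. (\<Sum>i\<in>fst (p n). snd (p n) i * F i z) - f z)) \<longlonglongrightarrow> 0"
  proof (rule Lim_null_comparison)
    show "(\<lambda>n. 1 / real (Suc n)) \<longlonglongrightarrow> 0" using LIMSEQ_inverse_real_of_nat by (simp add: field_simps)
    show "\<forall>\<^sub>F n in sequentially. norm (l2 M (\<lambda>z. (\<Sum>i\<in>fst (p n). snd (p n) i * F i z) - f z))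
        \<le> 1 / real (Suc n)"
      using p by (simp add: less_imp_le)
  qed
  then show thesis using p that[of "\<lambda>n. fst (p n)" "\<lambda>n. snd (p n)"] by blast
qed

text \<open>Equal Gram matrices make the passage from combinations of functions to combinations of
  vectors isometric, and density extends it by limits.\<close>

lemma l2_isometry_extension:
  fixes F :: "'i \<Rightarrow> 'a \<Rightarrow> complex" and y :: "'i \<Rightarrow> 'h::chilbert_space"
  assumes F: "\<And>i. i \<in> I \<Longrightarrow> sqint M (F i)"
    and gram: "\<And>i j. i \<in> I \<Longrightarrow> j \<in> I \<Longrightarrow> cinner (y i) (y j) = l2ip M (F i) (F j)"
    and dense: "\<And>f. sqint M f \<Longrightarrow> approximable M I F f"
  obtains U where "l2_isometry M U" "\<And>i. i \<in> I \<Longrightarrow> U (F i) = y i"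
    "\<And>f. sqint M f \<Longrightarrow> U f \<in> closure (complex_vector.span (y ` I))"
proof -
  define comb where "comb S \<alpha> = (\<lambda>z. \<Sum>i\<in>S. \<alpha> i * F i z)" for S and \<alpha> :: "'i \<Rightarrow> complex"
  define vec where "vec S \<alpha> = (\<Sum>i\<in>S. \<alpha> i *\<^sub>C y i)" for S and \<alpha> :: "'i \<Rightarrow> complex"
  have comb: "sqint M (comb S \<alpha>)" if "S \<subseteq> I" for S \<alpha>
    unfolding comb_def using that by (intro sqint_sum sqint_scale F) auto
  have l2ip_sum_left: "l2ip M (comb S \<alpha>) g = (\<Sum>i\<in>S. \<alpha> i * l2ip M (F i) g)"
    if "finite S" "S \<subseteq> I" "sqint M g" for S \<alpha> g
    using that
  proof (induction S rule: finite_induct)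
    case empty
    then show ?case by (simp add: comb_def l2ip_def)
  next
    case (insert i S)
    have "comb (insert i S) \<alpha> = (\<lambda>z. \<alpha> i * F i z + comb S \<alpha> z)"
      using insert by (simp add: comb_def)
    then show ?case
      using insert F[of i] comb[of S \<alpha>] by (simp add: l2ip_add_left sqint_scale l2ip_scale_left)
  qed
  have ip: "cinner (vec S \<alpha>) (vec T \<beta>) = l2ip M (comb S \<alpha>) (comb T \<beta>)"
    if "finite S" "S \<subseteq> I" "finite T" "T \<subseteq> I" for S \<alpha> T \<beta>
  proof -
    have "l2ip M (comb S \<alpha>) (comb T \<beta>) = (\<Sum>i\<in>S. \<alpha> i * cnj (l2ip M (comb T \<beta>) (F i)))"
      using that by (simp add: l2ip_sum_left comb l2ip_commute[symmetric])
    also have "\<dots> = (\<Sum>i\<in>S. \<alpha> i * (\<Sum>j\<in>T. cnj (\<beta> j) * cinner (y i) (y j)))"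
    proof (rule sum.cong[OF refl])
      fix i assume "i \<in> S"
      then have i: "i \<in> I" using that by auto
      have "l2ip M (comb T \<beta>) (F i) = (\<Sum>j\<in>T. \<beta> j * l2ip M (F j) (F i))"
        using that F[OF i] by (simp add: l2ip_sum_left)
      also have "cnj \<dots> = (\<Sum>j\<in>T. cnj (\<beta> j) * l2ip M (F i) (F j))"
        by (simp add: l2ip_commute[symmetric])
      also have "\<dots> = (\<Sum>j\<in>T. cnj (\<beta> j) * cinner (y i) (y j))"
        using that i by (intro sum.cong refl) (simp add: gram subset_iff)
      finally show "\<alpha> i * cnj (l2ip M (comb T \<beta>) (F i)) =
          \<alpha> i * (\<Sum>j\<in>T. cnj (\<beta> j) * cinner (y i) (y j))" by simp
    qed
    also have "\<dots> = cinner (vec S \<alpha>) (vec T \<beta>)"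
      unfolding vec_def cinner_sum_left cinner_sum_right cinner_scaleC_left cinner_scaleC_right
      by (simp add: sum_distrib_left) (subst sum.swap, simp add: ac_simps)
    finally show ?thesis ..
  qed
  define rel where "rel f h \<longleftrightarrow> (\<exists>S \<alpha>. (\<forall>n::nat. finite (S n) \<and> S n \<subseteq> I) \<and>
     (\<lambda>n. l2 M (\<lambda>z. comb (S n) (\<alpha> n) z - f z)) \<longlonglongrightarrow> 0 \<and> (\<lambda>n. vec (S n) (\<alpha> n)) \<longlonglongrightarrow> h)" for f h
  have rel_ip: "cinner h k = l2ip M f g" if fg: "sqint M f" "sqint M g" and rel: "rel f h" "rel g k" for f g h k
  proof -
    obtain S \<alpha> T \<beta> where S: "\<And>n::nat. finite (S n) \<and> S n \<subseteq> I"
       "(\<lambda>n. l2 M (\<lambda>z. comb (S n) (\<alpha> n) z - f z)) \<longlonglongrightarrow> 0" "(\<lambda>n. vec (S n) (\<alpha> n)) \<longlonglongrightarrow> h"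
      and T: "\<And>n::nat. finite (T n) \<and> T n \<subseteq> I"
       "(\<lambda>n. l2 M (\<lambda>z. comb (T n) (\<beta> n) z - g z)) \<longlonglongrightarrow> 0" "(\<lambda>n. vec (T n) (\<beta> n)) \<longlonglongrightarrow> k"
      using rel unfolding rel_def by auto
    have "(\<lambda>n. cinner (vec (S n) (\<alpha> n)) (vec (T n) (\<beta> n))) \<longlonglongrightarrow> l2ip M f g"
      using S T fg by (simp add: ip tendsto_l2ip comb)
    moreover have "(\<lambda>n. cinner (vec (S n) (\<alpha> n)) (vec (T n) (\<beta> n))) \<longlonglongrightarrow> cinner h k"
      using S T by (intro tendsto_cinner)
    ultimately show ?thesis using LIMSEQ_unique by blast
  qed
  have ex: "\<exists>h. rel f h" if f: "sqint M f" for f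
  proof -
    obtain S \<alpha> where S: "\<And>n::nat. finite (S n)" "\<And>n. S n \<subseteq> I"
      and "(\<lambda>n. l2 M (\<lambda>z. (\<Sum>i\<in>S n. \<alpha> n i * F i z) - f z)) \<longlonglongrightarrow> 0"
      by (rule approximable_sequence[OF dense[OF f]]) (rule that)
    then have l: "(\<lambda>n. l2 M (\<lambda>z. comb (S n) (\<alpha> n) z - f z)) \<longlonglongrightarrow> 0" by (simp only: comb_def)
    have "Cauchy (\<lambda>n. vec (S n) (\<alpha> n))"
      unfolding Cauchy_iff
    proof (intro allI impI)
      fix e :: real assume e: "e > 0"
      \<comment> \<open>Two squared distances below \<open>e\<^sup>2 / 4\<close>, each doubled by
        the triangle inequality for squares, stay below \<open>e\<^sup>2\<close> in total.\<close>
      then have "\<forall>\<^sub>F n in sequentially. l2 M (\<lambda>z. comb (S n) (\<alpha> n) z - f z) < e\<^sup>2 / 4"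
        using l by (intro order_tendstoD(2)) auto
      then obtain N where N: "\<And>n. n \<ge> N \<Longrightarrow> l2 M (\<lambda>z. comb (S n) (\<alpha> n) z - f z) < e\<^sup>2 / 4"
        unfolding eventually_sequentially by blast
      have "norm (vec (S m) (\<alpha> m) - vec (S n) (\<alpha> n)) < e" if mn: "m \<ge> N" "n \<ge> N" for m n
      proof -
        have "complex_of_real ((norm (vec (S m) (\<alpha> m) - vec (S n) (\<alpha> n)))\<^sup>2) =
            complex_of_real (l2 M (\<lambda>z. comb (S m) (\<alpha> m) z - comb (S n) (\<alpha> n) z))"
          using S by (simp only: norm_diff_squared_cinner l2_diff_expand comb ip)
        then have "(norm (vec (S m) (\<alpha> m) - vec (S n) (\<alpha> n)))\<^sup>2 =
            l2 M (\<lambda>z. comb (S m) (\<alpha> m) z - comb (S n) (\<alpha> n) z)"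
          by (simp only: of_real_eq_iff)
        also have "\<dots> \<le> 2 * l2 M (\<lambda>z. comb (S m) (\<alpha> m) z - f z) + 2 * l2 M (\<lambda>z. f z - comb (S n) (\<alpha> n) z)"
          using S f by (intro l2_diff_triangle comb)
        also have "\<dots> < e\<^sup>2"
          using N[OF mn(1)] N[OF mn(2)] by (subst (2) l2_diff_commute) simp
        finally show ?thesis using e by (simp add: power2_less_imp_less)
      qed
      then show "\<exists>N. \<forall>m\<ge>N. \<forall>n\<ge>N. norm (vec (S m) (\<alpha> m) - vec (S n) (\<alpha> n)) < e" by blast
    qed
    then obtain h where "(\<lambda>n. vec (S n) (\<alpha> n)) \<longlonglongrightarrow> h"
      using Cauchy_convergent_iff convergent_def by blast
    then show ?thesis unfolding rel_def using S(1,2) l by blast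
  qed
  define U where "U f = (SOME h. rel f h)" for f
  have U: "rel f (U f)" if "sqint M f" for f
    unfolding U_def using someI_ex[OF ex[OF that]] .
  have iso: "l2_isometry M U"
    by standard (use rel_ip U in blast)
  moreover have "U (F i) = y i" if i: "i \<in> I" for i
  proof -
    have rel: "rel (F i) (y i)"
      unfolding rel_def using i
      by (intro exI[of _ "\<lambda>_. {i}"] exI[of _ "\<lambda>_ _. 1"]) (auto simp: comb_def vec_def l2_def scaleC_one)
    have "complex_of_real ((norm (U (F i) - y i))\<^sup>2) = 0"
      unfolding norm_diff_squared_cinner
      using rel_ip[OF F[OF i] F[OF i]] rel U[OF F[OF i]] by simp
    then show ?thesis by simp
  qed
  moreover have "U f \<in> closure (complex_vector.span (y ` I))" if f: "sqint M f" for f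
  proof -
    obtain S \<alpha> where S: "\<And>n::nat. finite (S n) \<and> S n \<subseteq> I" "(\<lambda>n. vec (S n) (\<alpha> n)) \<longlonglongrightarrow> U f"
      using U[OF f] unfolding rel_def by auto
    have "vec (S n) (\<alpha> n) \<in> complex_vector.span (y ` I)" for n
      unfolding vec_def using S(1)[of n]
      by (intro complex_vector.span_sum complex_vector.span_scale complex_vector.span_base) auto
    then show ?thesis using S(2) by (rule limit_in_closure)
  qed
  ultimately show thesis by (rule that)
qed

section \<open>Approximation by finite linear combinations\<close>

lemma sum_union_coeffs:
  fixes F :: "'i \<Rightarrow> complex"
  assumes "finite S" "finite T"
  shows "(\<Sum>i\<in>S. \<alpha> i * F i) + (\<Sum>i\<in>T. \<beta> i * F i) =
    (\<Sum>i\<in>S \<union> T. ((if i \<in> S then \<alpha> i else 0) + (if i \<in> T then \<beta> i else 0)) * F i)"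
proof -
  have "(\<Sum>i\<in>S. \<alpha> i * F i) = (\<Sum>i\<in>S \<union> T. (if i \<in> S then \<alpha> i else 0) * F i)"
    using assms by (intro sum.mono_neutral_cong_left) auto
  moreover have "(\<Sum>i\<in>T. \<beta> i * F i) = (\<Sum>i\<in>S \<union> T. (if i \<in> T then \<beta> i else 0) * F i)"
    using assms by (intro sum.mono_neutral_cong_left) auto
  ultimately show ?thesis by (simp add: distrib_right sum.distrib)
qed

locale sqint_family =
  fixes M :: "'a measure" and I :: "'i set" and F :: "'i \<Rightarrow> 'a \<Rightarrow> complex"
  assumes sqint_family: "i \<in> I \<Longrightarrow> sqint M (F i)"
begin

lemma sqint_combination: "S \<subseteq> I \<Longrightarrow> sqint M (\<lambda>z. \<Sum>i\<in>S. \<alpha> i * F i z)"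
  by (intro sqint_sum sqint_scale sqint_family) auto

lemma approximable_combination:
  "finite S \<Longrightarrow> S \<subseteq> I \<Longrightarrow> approximable M I F (\<lambda>z. \<Sum>i\<in>S. \<alpha> i * F i z)"
  unfolding approximable_def by (intro allI impI exI[of _ S] exI[of _ \<alpha>]) (simp add: l2_def)

lemma approximable_limit:
  assumes G: "\<And>n. sqint M (G n)" "\<And>n. approximable M I F (G n)" and f: "sqint M f"
    and lim: "(\<lambda>n. l2 M (\<lambda>z. G n z - f z)) \<longlonglongrightarrow> 0"
  shows "approximable M I F f"
  unfolding approximable_def
proof (intro allI impI)
  fix e :: real assume e: "e > 0"
  have "\<forall>\<^sub>F n in sequentially. l2 M (\<lambda>z. G n z - f z) < e / 4"
    using lim e by (intro order_tendstoD(2)) auto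
  then obtain n where n: "l2 M (\<lambda>z. G n z - f z) < e / 4"
    unfolding eventually_sequentially by blast
  obtain S \<alpha> where S: "finite S" "S \<subseteq> I" "l2 M (\<lambda>z. (\<Sum>i\<in>S. \<alpha> i * F i z) - G n z) < e / 4"
    using G(2)[of n] e unfolding approximable_def by (meson zero_less_divide_iff zero_less_numeral)
  have "l2 M (\<lambda>z. (\<Sum>i\<in>S. \<alpha> i * F i z) - f z) < e"
    using l2_diff_triangle[OF sqint_combination[OF S(2), of \<alpha>] G(1)[of n] f] S(3) n by simp
  then show "\<exists>S \<alpha>. finite S \<and> S \<subseteq> I \<and> l2 M (\<lambda>z. (\<Sum>i\<in>S. \<alpha> i * F i z) - f z) < e"
    using S(1,2) by blast
qed

lemma approximable_scale:
  assumes f: "sqint M f" "approximable M I F f"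
  shows "approximable M I F (\<lambda>z. c * f z)"
  unfolding approximable_def
proof (intro allI impI)
  fix e :: real assume e: "e > 0"
  \<comment> \<open>The added 1 keeps the divisor positive when \<open>c = 0\<close>.\<close>
  let ?d = "(cmod c)\<^sup>2 + 1"
  have d: "0 < ?d" by (simp add: add_nonneg_pos)
  obtain S \<alpha> where S: "finite S" "S \<subseteq> I" "l2 M (\<lambda>z. (\<Sum>i\<in>S. \<alpha> i * F i z) - f z) < e / ?d"
    using f(2) e d unfolding approximable_def by (meson zero_less_divide_iff)
  let ?g = "\<lambda>z. (\<Sum>i\<in>S. \<alpha> i * F i z) - f z"
  have g: "sqint M ?g" using sqint_combination S f by (intro sqint_diff) auto
  have "l2 M (\<lambda>z. c * ?g z) \<le> (cmod c)\<^sup>2 * l2 M ?g"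
    by (rule l2_mono_bound[OF g sqint_measurable[OF sqint_scale[OF g]]]) (simp add: norm_mult)
  also have "\<dots> \<le> ?d * l2 M ?g" by (intro mult_right_mono) auto
  also have "\<dots> < e" using S(3) d by (simp add: field_simps)
  also have "(\<lambda>z. c * ?g z) = (\<lambda>z. (\<Sum>i\<in>S. (c * \<alpha> i) * F i z) - c * f z)"
    by (simp add: sum_distrib_left right_diff_distrib mult.assoc)
  finally show "\<exists>S \<alpha>. finite S \<and> S \<subseteq> I \<and> l2 M (\<lambda>z. (\<Sum>i\<in>S. \<alpha> i * F i z) - c * f z) < e"
    using S(1,2) by (intro exI[of _ S] exI[of _ "\<lambda>i. c * \<alpha> i"]) simp
qed

lemma approximable_add:
  assumes f: "sqint M f" "approximable M I F f" and g: "sqint M g" "approximable M I F g"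
  shows "approximable M I F (\<lambda>z. f z + g z)"
  unfolding approximable_def
proof (intro allI impI)
  fix e :: real assume e: "e > 0"
  obtain S \<alpha> where S: "finite S" "S \<subseteq> I" "l2 M (\<lambda>z. (\<Sum>i\<in>S. \<alpha> i * F i z) - f z) < e / 4"
    using f(2) e unfolding approximable_def by (meson zero_less_divide_iff zero_less_numeral)
  obtain T \<beta> where T: "finite T" "T \<subseteq> I" "l2 M (\<lambda>z. (\<Sum>i\<in>T. \<beta> i * F i z) - g z) < e / 4"
    using g(2) e unfolding approximable_def by (meson zero_less_divide_iff zero_less_numeral)
  let ?\<gamma> = "\<lambda>i. (if i \<in> S then \<alpha> i else 0) + (if i \<in> T then \<beta> i else 0)"
  have "l2 M (\<lambda>z. ((\<Sum>i\<in>S. \<alpha> i * F i z) - f z) + ((\<Sum>i\<in>T. \<beta> i * F i z) - g z)) < e"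
    using l2_add_le[OF sqint_diff[OF sqint_combination[OF S(2), of \<alpha>] f(1)]
        sqint_diff[OF sqint_combination[OF T(2), of \<beta>] g(1)]] S(3) T(3) by simp
  also have "(\<lambda>z. ((\<Sum>i\<in>S. \<alpha> i * F i z) - f z) + ((\<Sum>i\<in>T. \<beta> i * F i z) - g z)) =
      (\<lambda>z. (\<Sum>i\<in>S \<union> T. ?\<gamma> i * F i z) - (f z + g z))"
    using sum_union_coeffs[OF S(1) T(1), of \<alpha> "\<lambda>i. F i _" \<beta>] by (auto simp: algebra_simps)
  finally show "\<exists>S \<alpha>. finite S \<and> S \<subseteq> I \<and> l2 M (\<lambda>z. (\<Sum>i\<in>S. \<alpha> i * F i z) - (f z + g z)) < e"
    using S(1,2) T(1,2) by (intro exI[of _ "S \<union> T"] exI[of _ ?\<gamma>]) simp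
qed

lemma approximable_0: "approximable M I F (\<lambda>z. 0)"
  using approximable_combination[of "{}"] by simp

lemma approximable_sum:
  assumes "\<And>j. j \<in> J \<Longrightarrow> sqint M (f j)" "\<And>j. j \<in> J \<Longrightarrow> approximable M I F (f j)"
  shows "approximable M I F (\<lambda>z. \<Sum>j\<in>J. f j z)"
  using assms
  by (induction J rule: infinite_finite_induct)
    (auto simp: approximable_0 intro!: approximable_add sqint_sum)

end

lemma sum_range_indicator:
  assumes "finite (range s)"
  shows "(\<Sum>y\<in>range s. y * indicator (s -` {y}) z) = (s z :: 'b::semiring_1)"
proof -
  have "(\<Sum>y\<in>range s. y * indicator (s -` {y}) z) = (\<Sum>y\<in>range s. if y = s z then y else 0)"
    by (intro sum.cong) (auto simp: indicator_def)
  also have "\<dots> = s z" using assms by simp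
  finally show ?thesis .
qed

lemma sum_indicator_disjoint:
  assumes "disjoint_family A"
  shows "(\<Sum>i<n. indicator (A i) z) = (indicator (\<Union>i<n::nat. A i) z :: complex)"
  by (rule indicator_UN_disjoint[symmetric]) (use assms in \<open>auto simp: disjoint_family_on_def\<close>)

text \<open>Simple functions bounded by twice the modulus of \<open>f\<close> converge to
  \<open>f\<close> pointwise, and \<open>3 * f\<close> dominates the difference.\<close>

lemma (in sqint_family) approximable_of_indicators:
  assumes fin: "finite_measure M" and sp: "space M = UNIV"
    and ind: "\<And>A. A \<in> sets M \<Longrightarrow> approximable M I F (indicator A)"
    and f: "sqint M f"
  shows "approximable M I F f"
proof -
  have [measurable]: "f \<in> borel_measurable M" using f by auto
  obtain G where G: "\<And>i. simple_function M (G i)" "\<And>z. z \<in> space M \<Longrightarrow> (\<lambda>i. G i z) \<longlonglongrightarrow> f z"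
    "\<And>i z. z \<in> space M \<Longrightarrow> dist (G i z) 0 \<le> 2 * dist (f z) 0"
    using borel_measurable_implies_sequence_metric[OF \<open>f \<in> borel_measurable M\<close>, of 0] by blast
  have [measurable]: "G i \<in> borel_measurable M" for i
    by (rule borel_measurable_simple_function[OF G(1)])
  have fr: "finite (range (G i))" for i
    using simple_functionD(1)[OF G(1)[of i]] sp by simp
  have vm: "G i -` {y} \<in> sets M" for i y
    using simple_functionD(2)[OF G(1)[of i], of "{y}"] sp by simp
  have sqi: "sqint M (indicator A)" if "A \<in> sets M" for A
    using that by (intro sqint_bounded[OF fin, of _ 1]) (auto simp: indicator_def)
  have Geq: "G i = (\<lambda>z. \<Sum>y\<in>range (G i). y * indicator (G i -` {y}) z)" for i
    using sum_range_indicator[OF fr[of i]] by simp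
  show ?thesis
  proof (rule approximable_limit[OF _ _ f])
    fix n
    show "sqint M (G n)"
      by (rule sqint_bound[OF f, of _ 2]) (use G(3) sp in auto)
    show "approximable M I F (G n)"
      by (subst Geq) (intro approximable_sum approximable_scale sqint_scale sqi ind vm)
  next
    show "(\<lambda>n. l2 M (\<lambda>z. G n z - f z)) \<longlonglongrightarrow> 0"
    proof (rule l2_dominated_convergence[where g = "\<lambda>z. 3 * f z"])
      fix n z
      have "cmod (G n z - f z) \<le> cmod (G n z) + cmod (f z)" by (rule norm_triangle_ineq4)
      also have "\<dots> \<le> 3 * cmod (f z)" using G(3)[of z n] sp by simp
      finally show "cmod (G n z - f z) \<le> cmod (3 * f z)" by (simp add: norm_mult)
    qed (use f G sqint_scale in auto)
  qed
qed

section \<open>Spectral integrals in a functional model\<close>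

text \<open>The projections act as multiplication by indicators on the range of \<open>U\<close>,
  which may be a proper part of \<open>H\<close>. This freedom is used when \<open>E\<close> is
  given and only the cyclic subspace of one vector is modelled.\<close>

locale functional_model = l2_isometry M U
  for M :: "(real \<times> real) measure" and U :: "(real \<times> real \<Rightarrow> complex) \<Rightarrow> 'h::chilbert_space" +
  fixes H :: "'h set" and E :: "(real \<times> real) set \<Rightarrow> 'h \<Rightarrow> 'h"
  assumes sets_M [measurable_cong]: "sets M = sets borel"
    and U_in_H: "sqint M f \<Longrightarrow> U f \<in> H"
    and E_U: "sqint M f \<Longrightarrow> \<Delta> \<in> sets borel \<Longrightarrow> E \<Delta> (U f) = U (\<lambda>z. indicator \<Delta> z * f z)"
begin

lemma space_M [simp]: "space M = UNIV"
  using sets_eq_imp_space_eq[OF sets_M] by simp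

lemma sqint_indicator:
  assumes f: "sqint M f" and \<Delta>: "\<Delta> \<in> sets borel"
  shows "sqint M (\<lambda>z. indicator \<Delta> z * f z)"
  using sqint_indicator_times[OF f] \<Delta> sets_M by simp

lemma scalar_spectral_measure_U:
  assumes f: "sqint M f"
  shows "scalar_spectral_measure E (U f) = density M (\<lambda>z. ennreal ((cmod (f z))\<^sup>2))"
    (is "_ = ?D")
proof -
  have [measurable]: "f \<in> borel_measurable M" using f by auto
  have em: "ennreal (Re (cinner (E \<Delta> (U f)) (U f))) = emeasure ?D \<Delta>" if \<Delta>: "\<Delta> \<in> sets borel" for \<Delta>
  proof -
    have [measurable]: "\<Delta> \<in> sets borel" by fact
    let ?g = "\<lambda>z. indicator \<Delta> z * f z"
    have g: "sqint M ?g" by (rule sqint_indicator[OF f \<Delta>])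
    have "cinner (E \<Delta> (U f)) (U f) = l2ip M ?g f"
      by (simp add: E_U f \<Delta> isometry g)
    also have "\<dots> = l2ip M ?g ?g"
      unfolding l2ip_def by (intro Bochner_Integration.integral_cong) (auto simp: indicator_def)
    also have "\<dots> = complex_of_real (l2 M ?g)" by (rule l2ip_self)
    finally have "ennreal (Re (cinner (E \<Delta> (U f)) (U f))) = (\<integral>\<^sup>+z. ennreal ((cmod (?g z))\<^sup>2) \<partial>M)"
      by (simp add: nn_integral_sqint[OF g])
    also have "\<dots> = (\<integral>\<^sup>+z. ennreal ((cmod (f z))\<^sup>2) * indicator \<Delta> z \<partial>M)"
      by (intro nn_integral_cong) (auto simp: indicator_def)
    also have "\<dots> = emeasure ?D \<Delta>" by (intro emeasure_density[symmetric]) auto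
    finally show ?thesis .
  qed
  have "scalar_spectral_measure E (U f) = measure_of UNIV (sets borel) (emeasure ?D)"
    unfolding scalar_spectral_measure_def
    by (rule measure_of_eq) (use em sets.sigma_sets_eq[of "borel :: (real \<times> real) measure"] in auto)
  also have "\<dots> = measure_of (space ?D) (sets ?D) (emeasure ?D)"
    by (simp add: sets_M)
  also have "\<dots> = ?D" by (rule measure_of_of_measure)
  finally show ?thesis .
qed

lemma sum_simple_E_U:
  fixes s :: "real \<times> real \<Rightarrow> real"
  assumes f: "sqint M f" and s: "simple_function borel s"
  shows "sqint M (\<lambda>z. complex_of_real (s z) * f z)"
    and "(\<Sum>y\<in>range s. y *\<^sub>R E (s -` {y}) (U f)) = U (\<lambda>z. complex_of_real (s z) * f z)"
proof -
  have fr: "finite (range s)" using simple_functionD(1)[OF s] by simp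
  have vm: "s -` {y} \<in> sets borel" for y using simple_functionD(2)[OF s, of "{y}"] by simp
  have eq: "(\<lambda>z. complex_of_real (s z) * f z) =
      (\<lambda>z. \<Sum>y\<in>range s. complex_of_real y * (indicator (s -` {y}) z * f z))"
  proof
    fix z
    have "complex_of_real (s z) = complex_of_real (\<Sum>y\<in>range s. y * indicator (s -` {y}) z)"
      by (simp only: sum_range_indicator[OF fr])
    also have "\<dots> = (\<Sum>y\<in>range s. complex_of_real y * indicator (s -` {y}) z)"
      unfolding of_real_sum by (intro sum.cong) (auto simp: indicator_def)
    finally show "complex_of_real (s z) * f z =
        (\<Sum>y\<in>range s. complex_of_real y * (indicator (s -` {y}) z * f z))"
      by (simp add: sum_distrib_right mult.assoc)
  qed
  show "sqint M (\<lambda>z. complex_of_real (s z) * f z)"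
    unfolding eq by (intro sqint_sum sqint_scale sqint_indicator f vm)
  show "(\<Sum>y\<in>range s. y *\<^sub>R E (s -` {y}) (U f)) = U (\<lambda>z. complex_of_real (s z) * f z)"
    unfolding eq using f vm
    by (subst sum) (auto simp: scale E_U scaleR_eq_scaleC sqint_scale sqint_indicator)
qed

text \<open>Simple functions act by multiplication in the model, so the defining approximation says
  that \<open>s n * f\<close> tends to \<open>\<phi> * f\<close> in mean square. On the range of
  \<open>U\<close> the operator is thus multiplication by \<open>\<phi>\<close> with its maximal
  domain.\<close>

lemma spectral_integral_U_iff:
  fixes \<phi> :: "real \<times> real \<Rightarrow> real"
  assumes f: "sqint M f" and \<phi> [measurable]: "\<phi> \<in> borel_measurable borel"
  shows "(U f, g) \<in> spectral_integral H E \<phi> \<longleftrightarrow>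
    sqint M (\<lambda>z. complex_of_real (\<phi> z) * f z) \<and> g = U (\<lambda>z. complex_of_real (\<phi> z) * f z)"
    (is "_ \<longleftrightarrow> sqint M ?p \<and> _")
proof -
  have [measurable]: "f \<in> borel_measurable M" using f by auto
  have nn: "(\<integral>\<^sup>+z. ennreal ((\<phi> z - s z)\<^sup>2) \<partial>scalar_spectral_measure E (U f)) =
      (\<integral>\<^sup>+z. ennreal ((cmod (complex_of_real (s z) * f z - ?p z))\<^sup>2) \<partial>M)"
    if [measurable]: "s \<in> borel_measurable borel" for s
  proof -
    have "(\<integral>\<^sup>+z. ennreal ((\<phi> z - s z)\<^sup>2) \<partial>scalar_spectral_measure E (U f)) =
        (\<integral>\<^sup>+z. ennreal ((cmod (f z))\<^sup>2) * ennreal ((\<phi> z - s z)\<^sup>2) \<partial>M)"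
      unfolding scalar_spectral_measure_U[OF f] by (intro nn_integral_density) auto
    also have "\<dots> = (\<integral>\<^sup>+z. ennreal ((cmod (complex_of_real (s z) * f z - ?p z))\<^sup>2) \<partial>M)"
    proof (rule nn_integral_cong)
      fix z
      have "complex_of_real (s z) * f z - ?p z = complex_of_real (s z - \<phi> z) * f z"
        by (simp add: left_diff_distrib)
      then have "(cmod (complex_of_real (s z) * f z - ?p z))\<^sup>2 = (cmod (f z))\<^sup>2 * (\<phi> z - s z)\<^sup>2"
        by (simp only: norm_mult power_mult_distrib norm_of_real power2_abs)
          (simp add: power2_commute)
      then show "ennreal ((cmod (f z))\<^sup>2) * ennreal ((\<phi> z - s z)\<^sup>2) =
          ennreal ((cmod (complex_of_real (s z) * f z - ?p z))\<^sup>2)"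
        by (simp add: ennreal_mult)
    qed
    finally show ?thesis .
  qed
  show ?thesis
  proof
    assume "(U f, g) \<in> spectral_integral H E \<phi>"
    then obtain s :: "nat \<Rightarrow> real \<times> real \<Rightarrow> real" where s: "\<And>n. simple_function borel (s n)"
      and lim: "(\<lambda>n. \<integral>\<^sup>+z. ennreal ((\<phi> z - s n z)\<^sup>2) \<partial>scalar_spectral_measure E (U f)) \<longlonglongrightarrow> 0"
      and g: "(\<lambda>n. \<Sum>y\<in>range (s n). y *\<^sub>R E (s n -` {y}) (U f)) \<longlonglongrightarrow> g"
      unfolding spectral_integral_def by auto
    have sm [measurable]: "s n \<in> borel_measurable borel" for n
      by (rule borel_measurable_simple_function[OF s])
    let ?q = "\<lambda>n z. complex_of_real (s n z) * f z"
    note q = sum_simple_E_U[OF f s]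
    have lim': "(\<lambda>n. \<integral>\<^sup>+z. ennreal ((cmod (?q n z - ?p z))\<^sup>2) \<partial>M) \<longlonglongrightarrow> 0"
      using lim unfolding nn[OF sm] .
    then have "\<forall>\<^sub>F n in sequentially. (\<integral>\<^sup>+z. ennreal ((cmod (?q n z - ?p z))\<^sup>2) \<partial>M) < 1"
      by (rule order_tendstoD(2)) simp
    \<comment> \<open>One simple function at finite distance suffices: \<open>?p\<close> is then a
      difference of two square integrable functions.\<close>
    then obtain n where "(\<integral>\<^sup>+z. ennreal ((cmod (?q n z - ?p z))\<^sup>2) \<partial>M) < 1"
      unfolding eventually_sequentially by blast
    then have "sqint M (\<lambda>z. ?q n z - ?p z)"
      unfolding sqint_iff_nn_integral by (auto intro: less_trans)
    from sqint_diff[OF q(1)[of n] this] have p: "sqint M ?p" by simp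
    have "(\<lambda>n. ennreal (l2 M (\<lambda>z. ?q n z - ?p z))) \<longlonglongrightarrow> ennreal 0"
      using lim' by (simp add: nn_integral_sqint[OF sqint_diff[OF q(1) p]])
    then have "(\<lambda>n. l2 M (\<lambda>z. ?q n z - ?p z)) \<longlonglongrightarrow> 0"
      by (rule tendsto_ennrealD) auto
    then have "(\<lambda>n. U (?q n)) \<longlonglongrightarrow> U ?p" using tendsto_iff[OF q(1) p] by simp
    then have "g = U ?p" using g unfolding q(2) using LIMSEQ_unique by blast
    then show "sqint M ?p \<and> g = U ?p" using p by simp
  next
    assume p: "sqint M ?p \<and> g = U ?p"
    obtain s where s: "\<And>i. simple_function borel (s i)" "\<And>z. (\<lambda>i. s i z) \<longlonglongrightarrow> \<phi> z"
      "\<And>i z. dist (s i z) 0 \<le> 2 * dist (\<phi> z) 0"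
      using borel_measurable_implies_sequence_metric[of \<phi> borel 0] by auto
    have sm [measurable]: "s n \<in> borel_measurable borel" for n
      by (rule borel_measurable_simple_function[OF s(1)])
    let ?q = "\<lambda>n z. complex_of_real (s n z) * f z"
    note q = sum_simple_E_U[OF f s(1)]
    have l: "(\<lambda>n. l2 M (\<lambda>z. ?q n z - ?p z)) \<longlonglongrightarrow> 0"
    proof (rule l2_dominated_convergence[where g = "\<lambda>z. 3 * ?p z"])
      show "sqint M (\<lambda>z. 3 * ?p z)" using p sqint_scale by blast
      show "(\<lambda>n. ?q n z) \<longlonglongrightarrow> ?p z" for z by (intro tendsto_intros s)
      fix n z
      have "cmod (?q n z - ?p z) \<le> cmod (?q n z) + cmod (?p z)" by (rule norm_triangle_ineq4)
      also have "\<dots> = \<bar>s n z\<bar> * cmod (f z) + cmod (?p z)" by (simp add: norm_mult)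
      also have "\<dots> \<le> 2 * \<bar>\<phi> z\<bar> * cmod (f z) + cmod (?p z)"
        using s(3)[of n z] by (intro add_mono mult_right_mono) auto
      also have "\<dots> = cmod (3 * ?p z)" by (simp add: norm_mult)
      finally show "cmod (?q n z - ?p z) \<le> cmod (3 * ?p z)" .
    qed auto
    have "(\<lambda>n. ennreal (l2 M (\<lambda>z. ?q n z - ?p z))) \<longlonglongrightarrow> ennreal 0"
      using l by (intro tendsto_ennrealI)
    then have "(\<lambda>n. \<integral>\<^sup>+z. ennreal ((\<phi> z - s n z)\<^sup>2) \<partial>scalar_spectral_measure E (U f)) \<longlonglongrightarrow> 0"
      using p unfolding nn[OF sm] by (simp add: nn_integral_sqint[OF sqint_diff[OF q(1)]])
    moreover have "(\<lambda>n. U (?q n)) \<longlonglongrightarrow> U ?p" using tendsto_iff[OF q(1)] p l by simp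
    ultimately show "(U f, g) \<in> spectral_integral H E \<phi>"
      unfolding spectral_integral_def mem_Collect_eq case_prod_conv
      using f p s(1) U_in_H by (intro conjI exI[of _ s]) (auto simp: q(2))
  qed
qed

end

section \<open>The moment functions\<close>

lemma moment_fun_apply:
  "moment_fun (m, k, l, n, r, t) z =
     complex_of_real (fst z) ^ m * (complex_of_real (fst z) + \<i>) powi k *
     (complex_of_real (fst z) - \<i>) powi l *
     complex_of_real (snd z) ^ n * (complex_of_real (snd z) + \<i>) powi r *
     (complex_of_real (snd z) - \<i>) powi t"
  by (cases z) simp

lemma moment_fun_measurable [measurable]: "moment_fun \<omega> \<in> borel_measurable borel"
proof -
  obtain m k l n r t where \<omega>: "\<omega> = (m, k, l, n, r, t)" by (cases \<omega>) auto
  have "continuous_on UNIV (moment_fun \<omega>)"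
    unfolding \<omega> moment_fun_apply[abs_def] by (intro continuous_intros) auto
  then show ?thesis by (rule borel_measurable_continuous_onI)
qed

lemma moment_fun_0: "moment_fun (0, 0, 0, 0, 0, 0) = (\<lambda>z. 1)"
  by (rule ext) (simp add: moment_fun_apply)

lemma moment_fun_gram_index:
  "moment_fun (gram_index \<omega> \<omega>') z = moment_fun \<omega> z * cnj (moment_fun \<omega>' z)"
  by (cases \<omega>; cases \<omega>') (simp add: moment_fun_apply power_add power_int_add)

text \<open>Opposite exponents turn the two linear factors into their quotient, so every
  trigonometric monomial is itself a moment function. Density and uniqueness rest on this.\<close>

lemma moment_fun_cayley:
  "moment_fun (0, j, - j, 0, k, - k) z = cayley (fst z) powi j * cayley (snd z) powi k"
  by (simp add: moment_fun_apply cayley_def power_int_minus power_int_divide_distrib field_simps)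

lemma moment_fun_bump:
  "moment_fun (m + 1, k, l, n, r, t) z = complex_of_real (fst z) * moment_fun (m, k, l, n, r, t) z"
  "moment_fun (m, k + 1, l, n, r, t) z = (complex_of_real (fst z) + \<i>) * moment_fun (m, k, l, n, r, t) z"
  "moment_fun (m, k, l + 1, n, r, t) z = (complex_of_real (fst z) - \<i>) * moment_fun (m, k, l, n, r, t) z"
  "moment_fun (m, k, l, n + 1, r, t) z = complex_of_real (snd z) * moment_fun (m, k, l, n, r, t) z"
  "moment_fun (m, k, l, n, r + 1, t) z = (complex_of_real (snd z) + \<i>) * moment_fun (m, k, l, n, r, t) z"
  "moment_fun (m, k, l, n, r, t + 1) z = (complex_of_real (snd z) - \<i>) * moment_fun (m, k, l, n, r, t) z"
  by (simp_all add: moment_fun_apply power_int_add)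

lemma moment_fun_shift:
  "moment_fun (shift1 \<omega>) z = complex_of_real (fst z) * moment_fun \<omega> z"
  "moment_fun (shift2 \<omega>) z = complex_of_real (snd z) * moment_fun \<omega> z"
  by (cases \<omega>; simp add: moment_fun_apply)+

text \<open>Condition (ii) read as a linear relation between rows of the Gram matrix, which will
  become a relation between the vectors. The form \<open>+ (- \<i>)\<close> gives all four cases one
  shape.\<close>

lemma moment_relations_gram:
  assumes "moment_relations u"
  shows "u (gram_index (m, k + 1, l, n, r, t) \<omega>) =
      u (gram_index (shift1 (m, k, l, n, r, t)) \<omega>) + \<i> * u (gram_index (m, k, l, n, r, t) \<omega>)"
    "u (gram_index (m, k, l + 1, n, r, t) \<omega>) =
      u (gram_index (shift1 (m, k, l, n, r, t)) \<omega>) + (- \<i>) * u (gram_index (m, k, l, n, r, t) \<omega>)"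
    "u (gram_index (m, k, l, n, r + 1, t) \<omega>) =
      u (gram_index (shift2 (m, k, l, n, r, t)) \<omega>) + \<i> * u (gram_index (m, k, l, n, r, t) \<omega>)"
    "u (gram_index (m, k, l, n, r, t + 1) \<omega>) =
      u (gram_index (shift2 (m, k, l, n, r, t)) \<omega>) + (- \<i>) * u (gram_index (m, k, l, n, r, t) \<omega>)"
proof -
  obtain a b c d e f where \<omega>: "\<omega> = (a, b, c, d, e, f)" by (cases \<omega>) auto
  note R = assms[unfolded moment_relations_def, rule_format, of m a k c l b n d r f t e]
  show "u (gram_index (m, k + 1, l, n, r, t) \<omega>) =
      u (gram_index (shift1 (m, k, l, n, r, t)) \<omega>) + \<i> * u (gram_index (m, k, l, n, r, t) \<omega>)"
    "u (gram_index (m, k, l + 1, n, r, t) \<omega>) =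
      u (gram_index (shift1 (m, k, l, n, r, t)) \<omega>) + (- \<i>) * u (gram_index (m, k, l, n, r, t) \<omega>)"
    "u (gram_index (m, k, l, n, r + 1, t) \<omega>) =
      u (gram_index (shift2 (m, k, l, n, r, t)) \<omega>) + \<i> * u (gram_index (m, k, l, n, r, t) \<omega>)"
    "u (gram_index (m, k, l, n, r, t + 1) \<omega>) =
      u (gram_index (shift2 (m, k, l, n, r, t)) \<omega>) + (- \<i>) * u (gram_index (m, k, l, n, r, t) \<omega>)"
    using R unfolding \<omega> by simp_all
qed

lemma moment_relationsD:
  assumes "moment_relations u"
  shows "u (m, k + 1, l, n, r, t) = u (m + 1, k, l, n, r, t) + \<i> * u (m, k, l, n, r, t)"
    "u (m, k, l + 1, n, r, t) = u (m + 1, k, l, n, r, t) - \<i> * u (m, k, l, n, r, t)"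
    "u (m, k, l, n, r + 1, t) = u (m, k, l, n + 1, r, t) + \<i> * u (m, k, l, n, r, t)"
    "u (m, k, l, n, r, t + 1) = u (m, k, l, n + 1, r, t) - \<i> * u (m, k, l, n, r, t)"
  using assms[unfolded moment_relations_def, rule_format, of m 0 k 0 l 0 n 0 r 0 t 0] by auto

lemma moment_solutionD:
  assumes "moment_solution u \<mu>"
  shows "sets \<mu> = sets borel" "integrable \<mu> (moment_fun \<omega>)" "(\<integral>z. moment_fun \<omega> z \<partial>\<mu>) = u \<omega>"
  using assms unfolding moment_solution_def by blast+

lemma finite_measure_moment_solution:
  assumes "moment_solution u \<mu>" shows "finite_measure \<mu>"
proof
  have "integrable \<mu> (\<lambda>z. 1 :: complex)"
    using moment_solutionD(2)[OF assms, of "(0, 0, 0, 0, 0, 0)"] unfolding moment_fun_0 .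
  then show "emeasure \<mu> (space \<mu>) \<noteq> \<infinity>" by (simp add: integrable_iff_bounded less_top)
qed

lemma sqint_moment_fun:
  assumes "moment_solution u \<mu>" shows "sqint \<mu> (moment_fun \<omega>)"
proof -
  note [measurable_cong] = moment_solutionD(1)[OF assms]
  have "integrable \<mu> (moment_fun (gram_index \<omega> \<omega>))"
    by (rule moment_solutionD(2)[OF assms])
  from integrable_norm[OF this] show ?thesis
    by (simp add: sqint_def moment_fun_gram_index norm_mult power2_eq_square)
qed

lemma l2ip_moment_fun:
  assumes "moment_solution u \<mu>"
  shows "l2ip \<mu> (moment_fun \<omega>) (moment_fun \<omega>') = u (gram_index \<omega> \<omega>')"
  unfolding l2ip_def moment_fun_gram_index[symmetric] by (rule moment_solutionD(3)[OF assms])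

text \<open>Bounded limits of trigonometric monomials give the indicators of open sets.
  Approximability of indicators survives complements and countable disjoint unions, hence reaches
  all Borel sets, and simple functions do the rest.\<close>

lemma approximable_moment_fun:
  assumes \<mu>: "moment_solution u \<mu>" and f: "sqint \<mu> f"
  shows "approximable \<mu> UNIV moment_fun f"
proof -
  have fin: "finite_measure \<mu>" by (rule finite_measure_moment_solution[OF \<mu>])
  have sets: "sets \<mu> = sets borel" by (rule moment_solutionD(1)[OF \<mu>])
  note [measurable_cong] = sets
  have sp: "space \<mu> = UNIV" using sets_eq_imp_space_eq[OF sets] by simp
  interpret sqint_family \<mu> UNIV moment_fun
    by standard (rule sqint_moment_fun[OF \<mu>])
  have sqb: "sqint \<mu> g" if "g \<in> borel_measurable borel" "\<And>z. cmod (g z) \<le> B" for g B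
    using that by (intro sqint_bounded[OF fin]) auto
  have sqi: "sqint \<mu> (indicator A)" if "A \<in> sets borel" for A
    using that by (intro sqb[where B = 1]) (auto simp: indicator_def)
  have mono: "approximable \<mu> UNIV moment_fun (\<lambda>z. c * moment_fun \<omega> z)" for c \<omega>
    using approximable_combination[of "{\<omega>}" "\<lambda>_. c"] by simp
  have sqt: "sqint \<mu> (\<lambda>z. F (cayley2 z))" if "trig_poly F" for F
    using trig_poly_bounded[OF that] trig_poly_measurable[OF that] sqb by blast
  have trig: "approximable \<mu> UNIV moment_fun (\<lambda>z. F (cayley2 z))" if "trig_poly F" for F
    using that
  proof (induction rule: trig_poly.induct)
    case (trig_poly_monom c j k)
    show ?case using mono[of c "(0, j, - j, 0, k, - k)"] by (simp only: moment_fun_cayley cayley2_def fst_conv snd_conv)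
  next
    case (trig_poly_add F G)
    then show ?case by (intro approximable_add sqt)
  qed
  have ind: "approximable \<mu> UNIV moment_fun (indicator A)" if "A \<in> sigma_sets UNIV {U. open U}" for A
  proof -
    have "Int_stable {U :: (real \<times> real) set. open U}" "{U :: (real \<times> real) set. open U} \<subseteq> Pow UNIV"
      by (auto simp: Int_stable_def)
    from this that show ?thesis
    proof (induction rule: sigma_sets_induct_disjoint)
      case (basic A)
      then have [measurable]: "A \<in> sets borel" by simp
      obtain F :: "nat \<Rightarrow> _" where F: "\<And>n. trig_poly (F n)" "\<And>n z. cmod (F n (cayley2 z)) \<le> 2"
        "\<And>z. (\<lambda>n. F n (cayley2 z)) \<longlonglongrightarrow> indicator A z"
        using indicator_open_limit_trig_poly[of A] basic by auto
      show ?case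
      proof (rule approximable_limit[OF sqt[OF F(1)] trig[OF F(1)] sqi])
        show "(\<lambda>n. l2 \<mu> (\<lambda>z. F n (cayley2 z) - indicator A z)) \<longlonglongrightarrow> 0"
        proof (rule l2_dominated_convergence[where g = "\<lambda>_. 3"])
          show "cmod (F n (cayley2 z) - indicator A z) \<le> cmod 3" for n z
            using norm_triangle_ineq4[of "F n (cayley2 z)" "indicator A z"] F(2)[of n z]
            by (cases "z \<in> A") simp_all
        qed (use F trig_poly_measurable[OF F(1)] sqint_const[OF fin] in auto)
      qed simp
    next
      case empty
      show ?case using approximable_0 by (simp add: indicator_def[abs_def])
    next
      case (compl A)
      then have A: "A \<in> sets borel" by (simp add: borel_def)
      have "approximable \<mu> UNIV moment_fun (\<lambda>z. 1 * moment_fun (0, 0, 0, 0, 0, 0) z + (-1) * indicator A z)"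
        by (intro approximable_add mono approximable_scale compl sqi A sqint_scale sqint_moment_fun[OF \<mu>])
      also have "(\<lambda>z. 1 * moment_fun (0, 0, 0, 0, 0, 0) z + (-1) * indicator A z) = indicator (UNIV - A)"
        by (rule ext) (simp add: moment_fun_0 indicator_def)
      finally show ?case .
    next
      case (union A)
      then have [measurable]: "A i \<in> sets borel" for i by (auto simp: borel_def)
      show ?case
      proof (rule approximable_limit[where G = "\<lambda>n z. \<Sum>i<n. indicator (A i) z"])
        show "sqint \<mu> (\<lambda>z. \<Sum>i<n. indicator (A i) z)" for n by (intro sqint_sum sqi) simp
        show "approximable \<mu> UNIV moment_fun (\<lambda>z. \<Sum>i<n. indicator (A i) z)" for n
          by (intro approximable_sum sqi union) simp
        show "sqint \<mu> (indicator (\<Union> (range A)))" by (intro sqi) simp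
        have eq: "(\<Sum>i<n. indicator (A i) z) = (indicator (\<Union>i<n. A i) z :: complex)" for n z
          by (rule sum_indicator_disjoint[OF union(1)])
        show "(\<lambda>n. l2 \<mu> (\<lambda>z. (\<Sum>i<n. indicator (A i) z) - indicator (\<Union> (range A)) z)) \<longlonglongrightarrow> 0"
        proof (rule l2_dominated_convergence[where g = "\<lambda>_. 1"])
          show "(\<lambda>n. \<Sum>i<n. indicator (A i) z) \<longlonglongrightarrow> (indicator (\<Union> (range A)) z :: complex)" for z
            unfolding eq by (rule LIMSEQ_indicator_UN)
          show "cmod ((\<Sum>i<n. indicator (A i) z) - indicator (\<Union> (range A)) z) \<le> cmod 1" for n z
            unfolding eq by (auto simp: indicator_def)
        qed (use sqint_const[OF fin] in auto)
      qed
    qed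
  qed
  show ?thesis
    by (rule approximable_of_indicators[OF fin sp _ f]) (use ind sets in \<open>simp add: borel_def\<close>)
qed

section \<open>Existence of the joint spectral measure\<close>

text \<open>The model of a solution: unlike in a bare \<open>functional_model\<close>,
  \<open>U\<close> is onto and the moment functions are dense.\<close>

locale moment_model = functional_model M U "closed_span x" E
  for M U x E +
  assumes sqint_mf: "sqint M (moment_fun \<omega>)"
    and U_mf: "U (moment_fun \<omega>) = x \<omega>"
    and U_surj: "h \<in> closed_span x \<Longrightarrow> \<exists>f. sqint M f \<and> U f = h"
    and dense_mf: "sqint M f \<Longrightarrow> approximable M UNIV moment_fun f"
begin

text \<open>The span of the moment functions is invariant under division by \<open>\<phi> + i\<close>, and this turns
  approximations of \<open>(\<phi> + i) f\<close> in \<open>L\<^sup>2\<close> into approximations of \<open>f\<close> in the graph norm.\<close>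

lemma closure_index_operator:
  assumes \<phi> [measurable]: "\<phi> \<in> borel_measurable borel" and \<tau>: "inj \<tau>"
    and mf_\<sigma>: "\<And>\<omega> z. moment_fun (\<sigma> \<omega>) z = complex_of_real (\<phi> z) * moment_fun \<omega> z"
    and mf_\<tau>: "\<And>\<omega> z. moment_fun \<omega> z = (complex_of_real (\<phi> z) + \<i>) * moment_fun (\<tau> \<omega>) z"
  shows "closure (index_operator x \<sigma>) = spectral_integral (closed_span x) E \<phi>" (is "_ = ?SI")
proof
  interpret sqint_family M UNIV moment_fun by standard (rule sqint_mf)
  have sum_U: "(\<Sum>\<omega>\<in>S. \<alpha> \<omega> *\<^sub>C x (\<rho> \<omega>)) = U (\<lambda>z. \<Sum>\<omega>\<in>S. \<alpha> \<omega> * moment_fun (\<rho> \<omega>) z)" for S \<alpha> \<rho>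
    by (subst sum) (auto simp: scale sqint_mf sqint_scale U_mf)
  have index_subset: "index_operator x \<sigma> \<subseteq> ?SI"
  proof
    fix p assume "p \<in> index_operator x \<sigma>"
    then obtain S \<alpha> where S: "finite S"
      "p = (\<Sum>\<omega>\<in>S. \<alpha> \<omega> *\<^sub>C x \<omega>, \<Sum>\<omega>\<in>S. \<alpha> \<omega> *\<^sub>C x (\<sigma> \<omega>))"
      unfolding index_operator_def by blast
    let ?f = "\<lambda>z. \<Sum>\<omega>\<in>S. \<alpha> \<omega> * moment_fun \<omega> z"
    have eq: "(\<lambda>z. complex_of_real (\<phi> z) * ?f z) = (\<lambda>z. \<Sum>\<omega>\<in>S. \<alpha> \<omega> * moment_fun (\<sigma> \<omega>) z)"
      by (simp add: sum_distrib_left mf_\<sigma> ac_simps)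
    have "sqint M ?f" by (rule sqint_combination) simp
    moreover have "sqint M (\<lambda>z. \<Sum>\<omega>\<in>S. \<alpha> \<omega> * moment_fun (\<sigma> \<omega>) z)"
      by (intro sqint_sum sqint_scale sqint_mf)
    ultimately show "p \<in> ?SI"
      unfolding S(2) sum_U[of \<alpha> "\<lambda>\<omega>. \<omega>"] sum_U[of \<alpha> \<sigma>]
      by (subst spectral_integral_U_iff) (simp_all add: eq)
  qed
  have norm_i: "1 \<le> cmod (complex_of_real (\<phi> z) + \<i>)" "\<bar>\<phi> z\<bar> \<le> cmod (complex_of_real (\<phi> z) + \<i>)" for z
    unfolding norm_of_real_plus_i by (auto intro: real_le_rsqrt)
  have "closed ?SI"
    unfolding closed_sequential_limits
  proof (intro allI impI)
    fix X p assume X: "(\<forall>n. X n \<in> ?SI) \<and> X \<longlonglongrightarrow> p"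
    obtain h g where p: "p = (h, g)" by (cases p)
    have "\<exists>f. sqint M f \<and> sqint M (\<lambda>z. complex_of_real (\<phi> z) * f z) \<and>
        X n = (U f, U (\<lambda>z. complex_of_real (\<phi> z) * f z))" for n
    proof -
      obtain a b where ab: "X n = (a, b)" by (cases "X n")
      then have "(a, b) \<in> ?SI" using X by metis
      moreover have "a \<in> closed_span x" using calculation unfolding spectral_integral_def by blast
      then obtain f where f: "sqint M f" "U f = a" using U_surj by blast
      ultimately show ?thesis using ab spectral_integral_U_iff[OF f(1) \<phi>, of b] by auto
    qed
    then obtain f where f: "\<And>n. sqint M (f n)" "\<And>n. sqint M (\<lambda>z. complex_of_real (\<phi> z) * f n z)"
      "\<And>n. X n = (U (f n), U (\<lambda>z. complex_of_real (\<phi> z) * f n z))" by metis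
    have lim: "(\<lambda>n. U (f n)) \<longlonglongrightarrow> h" "(\<lambda>n. U (\<lambda>z. complex_of_real (\<phi> z) * f n z)) \<longlonglongrightarrow> g"
      using tendsto_fst[of X p sequentially] tendsto_snd[of X p sequentially] X by (simp_all add: f(3) p)
    \<comment> \<open>Both components of the limit are recovered from the single sequence
      \<open>(\<phi> + i) f n\<close>: its limit is divided by \<open>\<phi> + i\<close>, whose
      modulus is at least 1 and at least that of \<open>\<phi>\<close>.\<close>
    let ?F = "\<lambda>n z. complex_of_real (\<phi> z) * f n z + \<i> * f n z"
    have F: "sqint M (?F n)" for n by (intro sqint_add sqint_scale f)
    have "(\<lambda>n. U (?F n)) \<longlonglongrightarrow> g + \<i> *\<^sub>C h"
      using lim by (simp add: add scale f sqint_scale tendsto_add tendsto_scaleC)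
    then obtain q where q: "sqint M q" "U q = g + \<i> *\<^sub>C h" "(\<lambda>n. l2 M (\<lambda>z. ?F n z - q z)) \<longlonglongrightarrow> 0"
      using closed_range[of ?F, OF F] by blast
    have [measurable]: "q \<in> borel_measurable M" using q by auto
    have [measurable]: "f n \<in> borel_measurable M" for n using f(1) by auto
    define k where "k z = q z / (complex_of_real (\<phi> z) + \<i>)" for z
    have [measurable]: "k \<in> borel_measurable M" unfolding k_def[abs_def] by measurable
    have k: "sqint M k"
    proof (rule sqint_bound[OF q(1), of _ 1])
      fix z
      have "cmod (q z) / cmod (complex_of_real (\<phi> z) + \<i>) \<le> cmod (q z) / 1"
        using norm_i(1)[of z] by (intro divide_left_mono) auto
      then show "cmod (k z) \<le> 1 * cmod (q z)" by (simp add: k_def norm_divide)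
    qed simp
    have \<phi>k: "sqint M (\<lambda>z. complex_of_real (\<phi> z) * k z)"
    proof (rule sqint_bound[OF q(1), of _ 1])
      fix z
      have "\<bar>\<phi> z\<bar> / cmod (complex_of_real (\<phi> z) + \<i>) \<le> 1"
        using norm_i[of z] by (simp add: divide_le_eq_1)
      from mult_right_mono[OF this norm_ge_zero[of "q z"]]
      show "cmod (complex_of_real (\<phi> z) * k z) \<le> 1 * cmod (q z)"
        by (simp add: k_def norm_mult norm_divide)
    qed simp
    have q_k: "q z = complex_of_real (\<phi> z) * k z + \<i> * k z" for z
    proof -
      have "(complex_of_real (\<phi> z) + \<i>) * k z = q z" by (simp add: k_def)
      then show ?thesis by (simp add: distrib_right)
    qed
    have "(\<lambda>n. l2 M (\<lambda>z. f n z - k z)) \<longlonglongrightarrow> 0"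
    proof (rule Lim_null_comparison[OF _ q(3)])
      have "l2 M (\<lambda>z. f n z - k z) \<le> 1\<^sup>2 * l2 M (\<lambda>z. ?F n z - q z)" for n
      proof (rule l2_mono_bound[OF sqint_diff[OF F q(1)]])
        fix z
        have "?F n z - q z = (complex_of_real (\<phi> z) + \<i>) * (f n z - k z)"
          unfolding q_k by (simp add: algebra_simps)
        then show "cmod (f n z - k z) \<le> 1 * cmod (?F n z - q z)"
          using mult_right_mono[OF norm_i(1)[of z] norm_ge_zero[of "f n z - k z"]]
          by (simp add: norm_mult)
      qed (use k in auto)
      then show "\<forall>\<^sub>F n in sequentially. norm (l2 M (\<lambda>z. f n z - k z)) \<le> l2 M (\<lambda>z. ?F n z - q z)"
        by simp
    qed
    then have "(\<lambda>n. U (f n)) \<longlonglongrightarrow> U k" using tendsto_iff[OF f(1) k] by simp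
    then have h: "U k = h" using lim(1) LIMSEQ_unique by blast
    have "U q = U (\<lambda>z. complex_of_real (\<phi> z) * k z) + \<i> *\<^sub>C h"
      unfolding q_k h[symmetric] using k \<phi>k by (simp add: add scale sqint_scale)
    then have "g = U (\<lambda>z. complex_of_real (\<phi> z) * k z)" using q(2) by simp
    then show "p \<in> ?SI"
      unfolding p h[symmetric] using spectral_integral_U_iff[OF k \<phi>] \<phi>k by simp
  qed
  with index_subset show "closure (index_operator x \<sigma>) \<subseteq> ?SI"
    by (rule closure_minimal)
  show "?SI \<subseteq> closure (index_operator x \<sigma>)"
  proof
    fix p assume p: "p \<in> ?SI"
    obtain h g where hg: "p = (h, g)" by (cases p)
    then have "h \<in> closed_span x" using p unfolding spectral_integral_def by blast
    then obtain f where f: "sqint M f" "U f = h" using U_surj by blast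
    have \<phi>f: "sqint M (\<lambda>z. complex_of_real (\<phi> z) * f z)" and g: "g = U (\<lambda>z. complex_of_real (\<phi> z) * f z)"
      using p spectral_integral_U_iff[OF f(1) \<phi>, of g] by (auto simp: hg f(2))
    let ?q = "\<lambda>z. complex_of_real (\<phi> z) * f z + \<i> * f z"
    have q: "sqint M ?q" by (intro sqint_add sqint_scale f \<phi>f)
    obtain S \<alpha> where S: "\<And>n::nat. finite (S n)" and "\<And>n. S n \<subseteq> UNIV"
      and lim: "(\<lambda>n. l2 M (\<lambda>z. (\<Sum>\<omega>\<in>S n. \<alpha> n \<omega> * moment_fun \<omega> z) - ?q z)) \<longlonglongrightarrow> 0"
      by (rule approximable_sequence[OF dense_mf[OF q]]) (rule that)
    let ?c = "\<lambda>n z. \<Sum>\<omega>\<in>S n. \<alpha> n \<omega> * moment_fun \<omega> z"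
    \<comment> \<open>Replacing each index by its image under \<open>\<tau>\<close> divides the
      approximant of \<open>(\<phi> + i) f\<close> by \<open>\<phi> + i\<close> without leaving the
      moment functions.\<close>
    let ?k = "\<lambda>n z. \<Sum>\<omega>\<in>S n. \<alpha> n \<omega> * moment_fun (\<tau> \<omega>) z"
    have c: "sqint M (?c n)" for n by (rule sqint_combination) simp
    have k: "sqint M (?k n)" for n by (intro sqint_sum sqint_scale sqint_mf)
    have \<phi>k_eq: "complex_of_real (\<phi> z) * ?k n z = (\<Sum>\<omega>\<in>S n. \<alpha> n \<omega> * moment_fun (\<sigma> (\<tau> \<omega>)) z)" for n z
      by (simp add: sum_distrib_left mf_\<sigma> ac_simps)
    have \<phi>k: "sqint M (\<lambda>z. complex_of_real (\<phi> z) * ?k n z)" for n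
      unfolding \<phi>k_eq by (intro sqint_sum sqint_scale sqint_mf)
    have c_k: "?c n z = (complex_of_real (\<phi> z) + \<i>) * ?k n z" for n z
      by (subst mf_\<tau>) (simp add: sum_distrib_left ac_simps)
    have diff: "?c n z - ?q z = (complex_of_real (\<phi> z) + \<i>) * (?k n z - f z)" for n z
      unfolding c_k by (simp add: algebra_simps)
    have "(\<lambda>n. l2 M (\<lambda>z. ?k n z - f z)) \<longlonglongrightarrow> 0"
    proof (rule Lim_null_comparison[OF _ lim])
      have "l2 M (\<lambda>z. ?k n z - f z) \<le> 1\<^sup>2 * l2 M (\<lambda>z. ?c n z - ?q z)" for n
      proof (rule l2_mono_bound[OF sqint_diff[OF c q] sqint_measurable[OF sqint_diff[OF k f(1)]]])
        show "cmod (?k n z - f z) \<le> 1 * cmod (?c n z - ?q z)" for z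
          unfolding diff
          using mult_right_mono[OF norm_i(1)[of z] norm_ge_zero[of "?k n z - f z"]]
          by (simp add: norm_mult)
      qed
      then show "\<forall>\<^sub>F n in sequentially. norm (l2 M (\<lambda>z. ?k n z - f z)) \<le> l2 M (\<lambda>z. ?c n z - ?q z)"
        by simp
    qed
    then have 1: "(\<lambda>n. U (?k n)) \<longlonglongrightarrow> h" using tendsto_iff[OF k f(1)] f(2) by simp
    have "(\<lambda>n. l2 M (\<lambda>z. complex_of_real (\<phi> z) * ?k n z - complex_of_real (\<phi> z) * f z)) \<longlonglongrightarrow> 0"
    proof (rule Lim_null_comparison[OF _ lim])
      have "l2 M (\<lambda>z. complex_of_real (\<phi> z) * ?k n z - complex_of_real (\<phi> z) * f z) \<le>
          1\<^sup>2 * l2 M (\<lambda>z. ?c n z - ?q z)" for n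
      proof (rule l2_mono_bound[OF sqint_diff[OF c q] sqint_measurable[OF sqint_diff[OF \<phi>k \<phi>f]]])
        fix z
        have "cmod (complex_of_real (\<phi> z) * ?k n z - complex_of_real (\<phi> z) * f z) =
            \<bar>\<phi> z\<bar> * cmod (?k n z - f z)"
          by (simp only: right_diff_distrib[symmetric] norm_mult norm_of_real)
        then show "cmod (complex_of_real (\<phi> z) * ?k n z - complex_of_real (\<phi> z) * f z) \<le>
            1 * cmod (?c n z - ?q z)"
          unfolding diff using mult_right_mono[OF norm_i(2)[of z] norm_ge_zero[of "?k n z - f z"]]
          by (simp add: norm_mult)
      qed
      then show "\<forall>\<^sub>F n in sequentially. norm (l2 M (\<lambda>z. complex_of_real (\<phi> z) * ?k n z -
          complex_of_real (\<phi> z) * f z)) \<le> l2 M (\<lambda>z. ?c n z - ?q z)"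
        by simp
    qed
    then have 2: "(\<lambda>n. U (\<lambda>z. complex_of_real (\<phi> z) * ?k n z)) \<longlonglongrightarrow> g"
      using tendsto_iff[OF \<phi>k \<phi>f] g by simp
    have "(U (?k n), U (\<lambda>z. complex_of_real (\<phi> z) * ?k n z)) \<in> index_operator x \<sigma>" for n
    proof -
      \<comment> \<open>Lets the combination be rewritten over the image of \<open>S n\<close> under
        \<open>\<tau>\<close>, the form required by \<open>index_operator\<close>.\<close>
      have inj: "inj_on \<tau> (S n)" using \<tau> by (rule inj_on_subset) simp
      have "U (?k n) = (\<Sum>\<omega>\<in>\<tau> ` S n. \<alpha> n (inv \<tau> \<omega>) *\<^sub>C x \<omega>)"
        by (simp add: sum_U[symmetric] sum.reindex[OF inj] inv_f_f[OF \<tau>])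
      moreover have "U (\<lambda>z. complex_of_real (\<phi> z) * ?k n z) =
          (\<Sum>\<omega>\<in>\<tau> ` S n. \<alpha> n (inv \<tau> \<omega>) *\<^sub>C x (\<sigma> \<omega>))"
        unfolding \<phi>k_eq sum_U[of _ "\<lambda>\<omega>. \<sigma> (\<tau> \<omega>)", symmetric]
        by (simp add: sum.reindex[OF inj] inv_f_f[OF \<tau>])
      ultimately show ?thesis
        unfolding index_operator_def mem_Collect_eq using S
        by (intro exI[of _ "\<tau> ` S n"] exI[of _ "\<lambda>\<omega>. \<alpha> n (inv \<tau> \<omega>)"]) simp
    qed
    moreover have "(\<lambda>n. (U (?k n), U (\<lambda>z. complex_of_real (\<phi> z) * ?k n z))) \<longlonglongrightarrow> p"
      unfolding hg by (intro tendsto_Pair 1 2)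
    ultimately show "p \<in> closure (index_operator x \<sigma>)"
      by (rule limit_in_closure)
  qed
qed

end

text \<open>The vectors \<open>x \<omega>\<close> have the Gram matrix of the moment functions in
  the \<open>L^2\<close> space of the solution. The closed span is therefore a copy of that space,
  and multiplication by indicators can be transported to it.\<close>

lemma joint_spectral_measure_exists:
  fixes x :: "mindex \<Rightarrow> 'h::chilbert_space"
  assumes \<mu>: "moment_solution u \<mu>" and x: "gram_family u x"
  shows "\<exists>E. joint_spectral_measure x E"
proof -
  note sq = sqint_moment_fun[OF \<mu>]
  note [measurable_cong] = moment_solutionD(1)[OF \<mu>]
  have gram: "cinner (x \<omega>) (x \<omega>') = l2ip \<mu> (moment_fun \<omega>) (moment_fun \<omega>')" for \<omega> \<omega>'
    unfolding l2ip_moment_fun[OF \<mu>] using x unfolding gram_family_def by blast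
  obtain U where iso: "l2_isometry \<mu> U" and U_mf: "\<And>\<omega>. U (moment_fun \<omega>) = x \<omega>"
    and U_span: "\<And>f. sqint \<mu> f \<Longrightarrow> U f \<in> closure (complex_vector.span (range x))"
    using l2_isometry_extension[of UNIV \<mu> moment_fun x, OF sq gram approximable_moment_fun[OF \<mu>]] by auto
  interpret l2_isometry \<mu> U by (rule iso)
  have surj: "\<exists>f. sqint \<mu> f \<and> U f = h" if "h \<in> closed_span x" for h
  proof (rule closure_span_subset_range)
    show "h \<in> closure (complex_vector.span (range x))" using that by (simp add: closed_span_def)
    show "\<exists>f. sqint \<mu> f \<and> U f = v" if "v \<in> range x" for v
      using that sq U_mf by blast
  qed
  \<comment> \<open>A preimage is determined only up to a null function; \<open>E_U\<close> shows
    that the choice does not affect \<open>E\<close>.\<close>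
  define rep where "rep h = (SOME f. sqint \<mu> f \<and> U f = h)" for h
  have rep: "sqint \<mu> (rep h)" "U (rep h) = h" if "h \<in> closed_span x" for h
    unfolding rep_def using someI_ex[OF surj[OF that]] by blast+
  define E where "E \<Delta> h = U (\<lambda>z. indicator \<Delta> z * rep h z)" for \<Delta> h
  have U_in: "U f \<in> closed_span x" if "sqint \<mu> f" for f
    using U_span[OF that] by (simp add: closed_span_def)
  have ind: "sqint \<mu> (\<lambda>z. indicator \<Delta> z * f z)" if "sqint \<mu> f" "\<Delta> \<in> sets borel" for f \<Delta>
    using that moment_solutionD(1)[OF \<mu>] by (intro sqint_indicator_times) simp_all
  have E_U: "E \<Delta> (U f) = U (\<lambda>z. indicator \<Delta> z * f z)" if f: "sqint \<mu> f" and \<Delta>: "\<Delta> \<in> sets borel" for f \<Delta>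
    unfolding E_def
  proof (rule eqI[OF ind[OF rep(1)[OF U_in[OF f]] \<Delta>] ind[OF f \<Delta>]])
    let ?r = "rep (U f)"
    have r: "sqint \<mu> ?r" "U ?r = U f" using rep[OF U_in[OF f]] by auto
    have "l2 \<mu> (\<lambda>z. indicator \<Delta> z * ?r z - indicator \<Delta> z * f z) \<le> 1\<^sup>2 * l2 \<mu> (\<lambda>z. ?r z - f z)"
      by (rule l2_mono_bound[OF sqint_diff[OF r(1) f]
            sqint_measurable[OF sqint_diff[OF ind[OF r(1) \<Delta>] ind[OF f \<Delta>]]]])
        (auto simp: indicator_def)
    also have "l2 \<mu> (\<lambda>z. ?r z - f z) = 0" using norm_diff[OF r(1) f] r(2) by simp
    finally show "l2 \<mu> (\<lambda>z. indicator \<Delta> z * ?r z - indicator \<Delta> z * f z) = 0"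
      using l2_nonneg[of \<mu> "\<lambda>z. indicator \<Delta> z * ?r z - indicator \<Delta> z * f z"] by simp
  qed
  interpret moment_model \<mu> U x E
    by standard (use moment_solutionD(1)[OF \<mu>] U_in E_U sq U_mf surj approximable_moment_fun[OF \<mu>] in auto)
  have proj: "orth_projection_on (closed_span x) (E \<Delta>)" if \<Delta>: "\<Delta> \<in> sets borel" for \<Delta>
    unfolding orth_projection_on_def
  proof (intro conjI ballI allI)
    fix h assume "h \<in> closed_span x"
    then obtain f where f: "sqint \<mu> f" "U f = h" using surj by blast
    show "E \<Delta> h \<in> closed_span x"
      unfolding f(2)[symmetric] by (simp add: E_U f(1) \<Delta> U_in ind)
    have "(\<lambda>z. indicator \<Delta> z * (indicator \<Delta> z * f z)) = (\<lambda>z. indicator \<Delta> z * f z)"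
      by (auto simp: indicator_def)
    then show "E \<Delta> (E \<Delta> h) = E \<Delta> h"
      unfolding f(2)[symmetric] by (simp add: E_U f(1) \<Delta> ind)
    show "E \<Delta> (c *\<^sub>C h) = c *\<^sub>C E \<Delta> h" for c
    proof -
      have "E \<Delta> (c *\<^sub>C h) = U (\<lambda>z. indicator \<Delta> z * (c * f z))"
        unfolding f(2)[symmetric] by (simp add: scale[symmetric] E_U f(1) \<Delta> sqint_scale)
      also have "(\<lambda>z. indicator \<Delta> z * (c * f z)) = (\<lambda>z. c * (indicator \<Delta> z * f z))"
        by (simp add: ac_simps)
      also have "U \<dots> = c *\<^sub>C E \<Delta> h"
        unfolding f(2)[symmetric] by (simp add: scale ind E_U f(1) \<Delta>)
      finally show ?thesis .
    qed
    fix g assume "g \<in> closed_span x"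
    then obtain k where k: "sqint \<mu> k" "U k = g" using surj by blast
    show "E \<Delta> (h + g) = E \<Delta> h + E \<Delta> g"
    proof -
      have "E \<Delta> (h + g) = U (\<lambda>z. indicator \<Delta> z * (f z + k z))"
        unfolding f(2)[symmetric] k(2)[symmetric] by (simp add: add[symmetric] E_U f(1) k(1) \<Delta> sqint_add)
      also have "\<dots> = E \<Delta> h + E \<Delta> g"
        unfolding f(2)[symmetric] k(2)[symmetric] by (simp add: distrib_left add ind E_U f(1) k(1) \<Delta>)
      finally show ?thesis .
    qed
    have "l2ip \<mu> (\<lambda>z. indicator \<Delta> z * f z) k = l2ip \<mu> f (\<lambda>z. indicator \<Delta> z * k z)"
      unfolding l2ip_def by (intro Bochner_Integration.integral_cong) (auto simp: indicator_def)
    then show "cinner (E \<Delta> h) g = cinner h (E \<Delta> g)"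
      unfolding f(2)[symmetric] k(2)[symmetric] by (simp add: E_U f(1) k(1) \<Delta> isometry ind)
  qed
  have "spectral_measure_on (closed_span x) E"
    unfolding spectral_measure_on_def
  proof (intro conjI ballI allI impI proj)
    fix h assume "h \<in> closed_span x"
    then obtain f where f: "sqint \<mu> f" "U f = h" using surj by blast
    show "E UNIV h = h" unfolding f(2)[symmetric] by (simp add: E_U f(1))
    fix D :: "nat \<Rightarrow> (real \<times> real) set"
    assume D: "range D \<subseteq> sets borel" "disjoint_family D"
    have Dm [measurable]: "D n \<in> sets borel" for n using D(1) by auto
    have eq: "(\<Sum>i<n. indicator (D i) z) = (indicator (\<Union>i<n. D i) z :: complex)" for n z
      by (rule sum_indicator_disjoint[OF D(2)])
    have sum_eq: "(\<Sum>i<n. E (D i) h) = U (\<lambda>z. indicator (\<Union>i<n. D i) z * f z)" for n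
    proof -
      have "(\<Sum>i<n. E (D i) h) = U (\<lambda>z. \<Sum>i<n. indicator (D i) z * f z)"
        unfolding f(2)[symmetric] by (subst sum) (auto simp: E_U f(1) ind)
      also have "(\<lambda>z. \<Sum>i<n. indicator (D i) z * f z) = (\<lambda>z. indicator (\<Union>i<n. D i) z * f z)"
        by (simp add: eq[symmetric] sum_distrib_right)
      finally show ?thesis .
    qed
    have [measurable]: "f \<in> borel_measurable \<mu>" using f by auto
    have "(\<lambda>n. l2 \<mu> (\<lambda>z. indicator (\<Union>i<n. D i) z * f z - indicator (\<Union>n. D n) z * f z)) \<longlonglongrightarrow> 0"
    proof (rule l2_dominated_convergence[OF f(1)])
      show "(\<lambda>n. indicator (\<Union>i<n. D i) z * f z) \<longlonglongrightarrow> indicator (\<Union>n. D n) z * f z" for z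
        by (intro tendsto_intros LIMSEQ_indicator_UN)
    qed (auto simp: indicator_def)
    then have "(\<lambda>n. U (\<lambda>z. indicator (\<Union>i<n. D i) z * f z)) \<longlonglongrightarrow> U (\<lambda>z. indicator (\<Union>n. D n) z * f z)"
      by (subst tendsto_iff) (auto intro!: ind f(1))
    moreover have "E (\<Union>n. D n) h = U (\<lambda>z. indicator (\<Union>n. D n) z * f z)"
      unfolding f(2)[symmetric] by (intro E_U f(1)) simp
    ultimately show "(\<lambda>n. E (D n) h) sums E (\<Union>n. D n) h"
      unfolding sums_def sum_eq by simp
  qed
  moreover have "operator_A x = spectral_integral (closed_span x) E fst"
    unfolding operator_A_def
  proof (rule closure_index_operator)
    \<comment> \<open>Lowering the integer exponent \<open>k\<close> is division by
      \<open>x\<^sub>1 + i\<close>.\<close>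
    let ?\<tau> = "(\<lambda>(m, k, l, n, r, t). (m, k - 1, l, n, r, t)) :: mindex \<Rightarrow> mindex"
    show "inj ?\<tau>" by (auto simp: inj_def)
    show "moment_fun (shift1 \<omega>) z = complex_of_real (fst z) * moment_fun \<omega> z" for \<omega> z
      by (rule moment_fun_shift)
    show "moment_fun \<omega> z = (complex_of_real (fst z) + \<i>) * moment_fun (?\<tau> \<omega>) z" for \<omega> z
      by (cases \<omega>) (simp flip: moment_fun_bump(2))
  qed (intro borel_measurable_continuous_onI continuous_intros)
  moreover have "operator_B x = spectral_integral (closed_span x) E snd"
    unfolding operator_B_def
  proof (rule closure_index_operator)
    let ?\<tau> = "(\<lambda>(m, k, l, n, r, t). (m, k, l, n, r - 1, t)) :: mindex \<Rightarrow> mindex"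
    show "inj ?\<tau>" by (auto simp: inj_def)
    show "moment_fun (shift2 \<omega>) z = complex_of_real (snd z) * moment_fun \<omega> z" for \<omega> z
      by (rule moment_fun_shift)
    show "moment_fun \<omega> z = (complex_of_real (snd z) + \<i>) * moment_fun (?\<tau> \<omega>) z" for \<omega> z
      by (cases \<omega>) (simp flip: moment_fun_bump(5))
  qed (intro borel_measurable_continuous_onI continuous_intros)
  ultimately show ?thesis unfolding joint_spectral_measure_def by blast
qed

section \<open>Recovering the solution from a joint spectral measure\<close>

context
  fixes H :: "'h::chilbert_space set" and E :: "(real \<times> real) set \<Rightarrow> 'h \<Rightarrow> 'h"
  assumes E: "spectral_measure_on H E"
begin

lemma projD:
  assumes "\<Delta> \<in> sets borel" "h \<in> H"
  shows "E \<Delta> h \<in> H" "E \<Delta> (c *\<^sub>C h) = c *\<^sub>C E \<Delta> h" "E \<Delta> (E \<Delta> h) = E \<Delta> h"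
    "g \<in> H \<Longrightarrow> E \<Delta> (h + g) = E \<Delta> h + E \<Delta> g"
    "g \<in> H \<Longrightarrow> cinner (E \<Delta> h) g = cinner h (E \<Delta> g)"
proof -
  have P: "orth_projection_on H (E \<Delta>)" using E assms(1) unfolding spectral_measure_on_def by blast
  show "E \<Delta> h \<in> H" "E \<Delta> (c *\<^sub>C h) = c *\<^sub>C E \<Delta> h" "E \<Delta> (E \<Delta> h) = E \<Delta> h"
    "g \<in> H \<Longrightarrow> E \<Delta> (h + g) = E \<Delta> h + E \<Delta> g"
    "g \<in> H \<Longrightarrow> cinner (E \<Delta> h) g = cinner h (E \<Delta> g)"
    using P assms(2) unfolding orth_projection_on_def by simp_all
qed

lemma cinner_E_self:
  assumes "\<Delta> \<in> sets borel" "h \<in> H"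
  shows "cinner (E \<Delta> h) h = complex_of_real ((norm (E \<Delta> h))\<^sup>2)"
  using projD(5)[OF assms(1) projD(1)[OF assms] assms(2)] projD(3)[OF assms]
  by (simp add: cinner_self)

lemma E_sums:
  assumes "range D \<subseteq> sets borel" "disjoint_family D" "h \<in> H"
  shows "(\<lambda>n::nat. E (D n) h) sums E (\<Union>n. D n) h"
  using E assms unfolding spectral_measure_on_def by blast

lemma E_UNIV: "h \<in> H \<Longrightarrow> E UNIV h = h"
  using E unfolding spectral_measure_on_def by blast

lemma E_empty: assumes h: "h \<in> H" shows "E {} h = 0"
proof -
  have "(\<lambda>n::nat. E {} h) sums E (\<Union>n::nat. {}) h"
    using E_sums[of "\<lambda>_. {}" h] h by (simp add: disjoint_family_on_def)
  then have "summable (\<lambda>n::nat. E {} h)" by (rule sums_summable)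
  then show ?thesis using summable_LIMSEQ_zero LIMSEQ_const_iff by blast
qed

lemma E_Un:
  assumes "A \<in> sets borel" "B \<in> sets borel" "A \<inter> B = {}" and h: "h \<in> H"
  shows "E (A \<union> B) h = E A h + E B h"
proof -
  have "(\<lambda>n. E (binaryset A B n) h) sums E (\<Union>n. binaryset A B n) h"
    using assms disjoint_family_on_def
    by (intro E_sums) (auto simp: binaryset_def disjoint_family_on_def)
  then have "E (\<Union>n. binaryset A B n) h = (\<Sum>n. E (binaryset A B n) h)"
    by (simp add: sums_iff)
  also have "\<dots> = (\<Sum>n<2. E (binaryset A B n) h)"
    using E_empty[OF h] by (intro suminf_finite) (auto simp: binaryset_def)
  finally show ?thesis
    by (simp add: UN_binaryset_eq) (simp add: binaryset_def numeral_2_eq_2)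
qed

lemma norm_E_le:
  assumes "\<Delta> \<in> sets borel" "h \<in> H" shows "norm (E \<Delta> h) \<le> norm h"
proof -
  have "(norm (E \<Delta> h))\<^sup>2 = inner (E \<Delta> h) h"
    using cinner_E_self[OF assms] by (simp add: inner_eq_Re_cinner)
  also have "\<dots> \<le> norm (E \<Delta> h) * norm h" by (rule norm_cauchy_schwarz)
  finally have "norm (E \<Delta> h) * norm (E \<Delta> h) \<le> norm (E \<Delta> h) * norm h" by (simp add: power2_eq_square)
  then show ?thesis by (cases "norm (E \<Delta> h) = 0") (auto simp: mult_le_cancel_left)
qed

text \<open>The range of \<open>E B\<close> is fixed by \<open>E (A \<union> B)\<close>, a contraction; hence it is killed by \<open>E A\<close>.\<close>

lemma E_disjoint:
  assumes AB: "A \<in> sets borel" "B \<in> sets borel" "A \<inter> B = {}" and h: "h \<in> H"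
  shows "E A (E B h) = 0"
proof -
  let ?k = "E B h"
  have k: "?k \<in> H" "E B ?k = ?k" using projD(1,3)[OF AB(2) h] by auto
  have un: "A \<union> B \<in> sets borel" using AB by auto
  have R: "E (A \<union> B) ?k = E A ?k + ?k" using E_Un[OF AB k(1)] k(2) by simp
  have "complex_of_real ((norm (E (A \<union> B) ?k))\<^sup>2) = cinner (E (A \<union> B) ?k) ?k"
    by (rule cinner_E_self[OF un k(1), symmetric])
  also have "\<dots> = cinner (E A ?k) ?k + cinner ?k ?k"
    unfolding R by (rule cinner_add_left)
  also have "\<dots> = complex_of_real ((norm (E A ?k))\<^sup>2 + (norm ?k)\<^sup>2)"
    unfolding cinner_E_self[OF AB(1) k(1)] cinner_self of_real_add ..
  finally have "complex_of_real ((norm (E (A \<union> B) ?k))\<^sup>2) =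
      complex_of_real ((norm (E A ?k))\<^sup>2 + (norm ?k)\<^sup>2)" .
  then have "(norm (E (A \<union> B) ?k))\<^sup>2 = (norm (E A ?k))\<^sup>2 + (norm ?k)\<^sup>2" by (simp only: of_real_eq_iff)
  moreover have "(norm (E (A \<union> B) ?k))\<^sup>2 \<le> (norm ?k)\<^sup>2"
    by (intro power_mono norm_E_le[OF un k(1)]) simp
  ultimately show ?thesis by simp
qed

text \<open>Splitting \<open>B\<close>, then \<open>A\<close>, along the intersection leaves
  products over disjoint sets, which vanish, and one idempotent.\<close>

lemma E_Int:
  assumes AB: "A \<in> sets borel" "B \<in> sets borel" and h: "h \<in> H"
  shows "E A (E B h) = E (A \<inter> B) h"
proof -
  have [measurable]: "A \<in> sets borel" "B \<in> sets borel" by fact+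
  have 1: "E B h = E (A \<inter> B) h + E (B - A) h"
  proof -
    have "B = (A \<inter> B) \<union> (B - A)" by blast
    then show ?thesis using E_Un[of "A \<inter> B" "B - A" h] h by auto
  qed
  have inH: "E (A \<inter> B) h \<in> H" "E (B - A) h \<in> H" by (intro projD(1) h; measurable)+
  have 2: "E A g = E (A \<inter> B) g + E (A - B) g" if "g \<in> H" for g
  proof -
    have "A = (A \<inter> B) \<union> (A - B)" by blast
    then show ?thesis using E_Un[of "A \<inter> B" "A - B" g] that by auto
  qed
  have "E A (E B h) = E A (E (A \<inter> B) h) + E A (E (B - A) h)"
    unfolding 1 by (intro projD(4) inH AB)
  also have "E A (E (B - A) h) = 0" by (rule E_disjoint) (use h in auto)
  also have "E A (E (A \<inter> B) h) = E (A \<inter> B) (E (A \<inter> B) h) + E (A - B) (E (A \<inter> B) h)"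
    by (rule 2[OF inH(1)])
  also have "E (A - B) (E (A \<inter> B) h) = 0" by (rule E_disjoint) (use h in auto)
  also have "E (A \<inter> B) (E (A \<inter> B) h) = E (A \<inter> B) h" by (rule projD(3)) (use h in auto)
  finally show ?thesis by simp
qed

lemma scalar_spectral_measure:
  assumes h: "h \<in> H"
  shows "sets (scalar_spectral_measure E h) = sets borel"
    and "\<Delta> \<in> sets borel \<Longrightarrow>
      emeasure (scalar_spectral_measure E h) \<Delta> = ennreal (Re (cinner (E \<Delta> h) h))"
proof -
  show "sets (scalar_spectral_measure E h) = sets borel"
    unfolding scalar_spectral_measure_def
    using sets.sigma_sets_eq[of "borel :: (real \<times> real) measure"] by simp
  have nonneg: "0 \<le> Re (cinner (E \<Delta> h) h)" if "\<Delta> \<in> sets borel" for \<Delta>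
    by (simp add: cinner_E_self[OF that h])
  show "emeasure (scalar_spectral_measure E h) \<Delta> = ennreal (Re (cinner (E \<Delta> h) h))"
    if "\<Delta> \<in> sets borel" for \<Delta>
    unfolding scalar_spectral_measure_def
  proof (rule emeasure_measure_of_sigma[OF _ _ _ that])
    show "sigma_algebra UNIV (sets (borel :: (real \<times> real) measure))"
      using sets.sigma_algebra_axioms[of "borel :: (real \<times> real) measure"] by simp
    show "positive (sets borel) (\<lambda>\<Delta>. ennreal (Re (cinner (E \<Delta> h) h)))"
      using E_empty[OF h] by (simp add: positive_def)
    show "countably_additive (sets borel) (\<lambda>\<Delta>. ennreal (Re (cinner (E \<Delta> h) h)))"
      unfolding countably_additive_def
    proof (intro allI impI)
      fix D :: "nat \<Rightarrow> (real \<times> real) set"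
      assume D: "range D \<subseteq> sets borel" "disjoint_family D"
      have "(\<lambda>n. Re (cinner (\<Sum>i<n. E (D i) h) h)) \<longlonglongrightarrow> Re (cinner (E (\<Union>n. D n) h) h)"
        using E_sums[OF D h] unfolding sums_def by (intro tendsto_intros)
      then have "(\<lambda>n. Re (cinner (E (D n) h) h)) sums Re (cinner (E (\<Union>n. D n) h) h)"
        unfolding sums_def by (simp add: cinner_sum_left)
      then show "(\<Sum>n. ennreal (Re (cinner (E (D n) h) h))) = ennreal (Re (cinner (E (\<Union>n. D n) h) h))"
        using D(1) nonneg by (intro suminf_ennreal_eq) auto
    qed
  qed
qed

lemma measure_scalar_spectral_measure:
  assumes h: "h \<in> H" and \<Delta>: "\<Delta> \<in> sets borel"
  shows "complex_of_real (measure (scalar_spectral_measure E h) \<Delta>) = cinner (E \<Delta> h) h"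
  unfolding measure_def scalar_spectral_measure(2)[OF assms] cinner_E_self[OF \<Delta> h] by simp

end

section \<open>Closed spans and the cyclic subspace of a vector\<close>

lemma closure_span_add:
  fixes Y :: "'h::complex_inner set"
  assumes "a \<in> closure (complex_vector.span Y)" "b \<in> closure (complex_vector.span Y)"
  shows "a + b \<in> closure (complex_vector.span Y)"
proof -
  obtain v w where v: "\<And>n. v n \<in> complex_vector.span Y" "v \<longlonglongrightarrow> a"
    and w: "\<And>n. w n \<in> complex_vector.span Y" "w \<longlonglongrightarrow> b"
    using assms unfolding closure_sequential by metis
  have "v n + w n \<in> complex_vector.span Y" for n by (intro complex_vector.span_add v w)
  moreover have "(\<lambda>n. v n + w n) \<longlonglongrightarrow> a + b" by (intro tendsto_add v w)
  ultimately show ?thesis by (rule limit_in_closure)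
qed

lemma closure_span_scale:
  fixes Y :: "'h::complex_inner set"
  assumes "a \<in> closure (complex_vector.span Y)"
  shows "c *\<^sub>C a \<in> closure (complex_vector.span Y)"
proof -
  obtain v where v: "\<And>n. v n \<in> complex_vector.span Y" "v \<longlonglongrightarrow> a"
    using assms unfolding closure_sequential by metis
  have "c *\<^sub>C v n \<in> complex_vector.span Y" for n by (intro complex_vector.span_scale v)
  moreover have "(\<lambda>n. c *\<^sub>C v n) \<longlonglongrightarrow> c *\<^sub>C a" by (intro tendsto_scaleC v)
  ultimately show ?thesis by (rule limit_in_closure)
qed

lemma closure_span_closure:
  fixes Y Z :: "'h::complex_inner set"
  assumes "Z \<subseteq> closure (complex_vector.span Y)"
  shows "closure (complex_vector.span Z) \<subseteq> closure (complex_vector.span Y)"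
proof (rule closure_minimal[OF _ closed_closure])
  show "complex_vector.span Z \<subseteq> closure (complex_vector.span Y)"
  proof (rule complex_vector.span_minimal[OF assms])
    have "0 \<in> closure (complex_vector.span Y)"
      using complex_vector.span_zero closure_subset by blast
    then show "complex_vector.subspace (closure (complex_vector.span Y))"
      unfolding complex_vector.subspace_def
      using closure_span_add closure_span_scale by blast
  qed
qed

text \<open>Multiplicativity gives \<open>(E A h, E B h)\<close> as the scalar measure of
  \<open>A \<inter> B\<close>, which is the Gram matrix of the indicators; hence the isometry. That
  \<open>E\<close> acts by multiplication is checked on combinations of indicators and passes to
  limits because projections are contractions.\<close>

lemma functional_model_of_spectral_measure:
  fixes Y :: "'h::chilbert_space set"
  defines "H \<equiv> closure (complex_vector.span Y)"
  assumes E: "spectral_measure_on H E" and h: "h \<in> H"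
  obtains U where "functional_model (scalar_spectral_measure E h) U H E"
    "\<And>\<Delta>. \<Delta> \<in> sets borel \<Longrightarrow> U (indicator \<Delta>) = E \<Delta> h"
    "finite_measure (scalar_spectral_measure E h)"
proof -
  define M where "M = scalar_spectral_measure E h"
  have sets: "sets M = sets borel" unfolding M_def by (rule scalar_spectral_measure(1)[OF E h])
  note [measurable_cong] = sets
  have sp: "space M = UNIV" using sets_eq_imp_space_eq[OF sets] by simp
  note proj = projD[OF E]
  have fin: "finite_measure M"
    by standard (simp add: sp, simp add: M_def scalar_spectral_measure(2)[OF E h])
  have sqi: "sqint M (indicator \<Delta>)" if "\<Delta> \<in> sets borel" for \<Delta>
    using that by (intro sqint_bounded[OF fin, of _ 1]) (auto simp: indicator_def)
  have gram: "cinner (E A h) (E B h) = l2ip M (indicator A) (indicator B)"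
    if AB: "A \<in> sets borel" "B \<in> sets borel" for A B
  proof -
    have AB': "A \<inter> B \<in> sets borel" using AB by auto
    have "cinner (E A h) (E B h) = cinner (E B (E A h)) h"
      using proj(5)[OF AB(2) proj(1)[OF AB(1) h] h] by simp
    also have "\<dots> = cinner (E (A \<inter> B) h) h"
      by (simp add: E_Int[OF E AB(2) AB(1) h] Int_commute)
    also have "\<dots> = complex_of_real (measure M (A \<inter> B))"
      unfolding M_def by (rule measure_scalar_spectral_measure[OF E h AB', symmetric])
    also have "\<dots> = complex_of_real (\<integral>z. indicator (A \<inter> B) z \<partial>M)"
      using sp by simp
    also have "\<dots> = (\<integral>z. complex_of_real (indicator (A \<inter> B) z) \<partial>M)"
      by (rule integral_complex_of_real[symmetric])
    also have "\<dots> = l2ip M (indicator A) (indicator B)"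
      unfolding l2ip_def by (intro Bochner_Integration.integral_cong) (auto simp: indicator_def)
    finally show ?thesis .
  qed
  interpret sqint_family M "sets borel" indicator
    by standard (rule sqi)
  have approx: "approximable M (sets borel) indicator f" if "sqint M f" for f
  proof (rule approximable_of_indicators[OF fin sp _ that])
    show "approximable M (sets borel) indicator (indicator A)" if "A \<in> sets M" for A
      using approximable_combination[of "{A}" "\<lambda>_. 1"] that sets by simp
  qed
  obtain U where iso: "l2_isometry M U" and U_ind: "\<And>\<Delta>. \<Delta> \<in> sets borel \<Longrightarrow> U (indicator \<Delta>) = E \<Delta> h"
    and U_span: "\<And>f. sqint M f \<Longrightarrow> U f \<in> closure (complex_vector.span ((\<lambda>\<Delta>. E \<Delta> h) ` sets borel))"
  proof (rule l2_isometry_extension[of "sets borel" M indicator "\<lambda>\<Delta>. E \<Delta> h"])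
  qed (use sqi gram approx in auto)
  interpret l2_isometry M U by (rule iso)
  have U_in: "U f \<in> H" if "sqint M f" for f
  proof -
    have "(\<lambda>\<Delta>. E \<Delta> h) ` sets borel \<subseteq> closure (complex_vector.span Y)"
      using proj(1) h unfolding H_def by blast
    from closure_span_closure[OF this] U_span[OF that] show ?thesis unfolding H_def by blast
  qed
  have H_add: "a + b \<in> H" if "a \<in> H" "b \<in> H" for a b
    using that closure_span_add unfolding H_def by blast
  have H_scale: "c *\<^sub>C a \<in> H" if "a \<in> H" for a c
    using that closure_span_scale unfolding H_def by blast
  have ind: "sqint M (\<lambda>z. indicator \<Delta> z * f z)" if "sqint M f" "\<Delta> \<in> sets borel" for f \<Delta>
    using that sets by (intro sqint_indicator_times) simp_all
  have E_comb: "E \<Delta> (U (\<lambda>z. \<Sum>A\<in>S. \<alpha> A * indicator A z)) = U (\<lambda>z. indicator \<Delta> z * (\<Sum>A\<in>S. \<alpha> A * indicator A z))"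
    if \<Delta>: "\<Delta> \<in> sets borel" and S: "finite S" "S \<subseteq> sets borel" for \<Delta> S \<alpha>
    using S
  proof (induction S rule: finite_induct)
    case empty
    have "E \<Delta> (0 *\<^sub>C h) = 0 *\<^sub>C E \<Delta> h" by (rule proj(2)[OF \<Delta> h])
    then have "E \<Delta> 0 = 0"
      using norm_scaleC[of 0 h] norm_scaleC[of 0 "E \<Delta> h"] by simp
    then show ?case by (simp add: zero)
  next
    case (insert A S)
    then have A: "A \<in> sets borel" and A\<Delta>: "\<Delta> \<inter> A \<in> sets borel" using \<Delta> by auto
    define d where "d = (\<lambda>z. \<Sum>A\<in>S. \<alpha> A * indicator A z)"
    have d: "sqint M d" unfolding d_def using insert by (intro sqint_combination) auto
    have IH: "E \<Delta> (U d) = U (\<lambda>z. indicator \<Delta> z * d z)" unfolding d_def using insert by auto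
    have eq: "(\<Sum>A\<in>insert A S. \<alpha> A * indicator A z) = \<alpha> A * indicator A z + d z" for z
      unfolding d_def by (rule sum.insert[OF insert(1,2)])
    have "E \<Delta> (U (\<lambda>z. \<Sum>A\<in>insert A S. \<alpha> A * indicator A z)) = E \<Delta> (\<alpha> A *\<^sub>C E A h + U d)"
      unfolding eq by (simp add: add scale d sqint_scale sqi A U_ind)
    also have "\<dots> = \<alpha> A *\<^sub>C E (\<Delta> \<inter> A) h + U (\<lambda>z. indicator \<Delta> z * d z)"
      using proj(1)[OF A h] by (simp add: proj(2,4)[OF \<Delta>] H_scale U_in d E_Int[OF E \<Delta> A h] IH)
    also have "\<dots> = U (\<lambda>z. \<alpha> A * indicator (\<Delta> \<inter> A) z + indicator \<Delta> z * d z)"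
      by (simp add: add scale d sqint_scale sqi A\<Delta> U_ind ind \<Delta>)
    also have "(\<lambda>z. \<alpha> A * indicator (\<Delta> \<inter> A) z + indicator \<Delta> z * d z) =
        (\<lambda>z. indicator \<Delta> z * (\<Sum>A\<in>insert A S. \<alpha> A * indicator A z))"
      unfolding eq by (auto simp: indicator_def)
    finally show ?case .
  qed
  have E_U: "E \<Delta> (U f) = U (\<lambda>z. indicator \<Delta> z * f z)" if f: "sqint M f" and \<Delta>: "\<Delta> \<in> sets borel" for f \<Delta>
  proof -
    obtain S \<alpha> where S: "\<And>n::nat. finite (S n)" "\<And>n. S n \<subseteq> sets borel"
      and lim: "(\<lambda>n. l2 M (\<lambda>z. (\<Sum>A\<in>S n. \<alpha> n A * indicator A z) - f z)) \<longlonglongrightarrow> 0"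
      by (rule approximable_sequence[OF approx[OF f]]) (rule that)
    define c where "c n = (\<lambda>z. \<Sum>A\<in>S n. \<alpha> n A * indicator A z)" for n
    have c: "sqint M (c n)" for n unfolding c_def by (rule sqint_combination[OF S(2)])
    have E_c: "E \<Delta> (U (c n)) = U (\<lambda>z. indicator \<Delta> z * c n z)" for n
      unfolding c_def by (rule E_comb[OF \<Delta> S])
    have lim: "(\<lambda>n. l2 M (\<lambda>z. c n z - f z)) \<longlonglongrightarrow> 0" unfolding c_def by (rule lim)
    have "(\<lambda>n. U (c n)) \<longlonglongrightarrow> U f" using tendsto_iff[OF c f] lim by simp
    then have norm_lim: "(\<lambda>n. norm (U (c n) - U f)) \<longlonglongrightarrow> 0" by (intro tendsto_norm_zero LIM_zero)
    have norm_le: "norm (E \<Delta> (U (c n)) - E \<Delta> (U f)) \<le> norm (U (c n) - U f)" for n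
    proof -
      have "U (c n) - U f \<in> H" using U_in[OF sqint_diff[OF c f]] by (simp add: diff[OF c f])
      from proj(4)[OF \<Delta> this U_in[OF f]] norm_E_le[OF E \<Delta> this] show ?thesis by simp
    qed
    have "(\<lambda>n. E \<Delta> (U (c n)) - E \<Delta> (U f)) \<longlonglongrightarrow> 0"
      by (rule Lim_null_comparison[OF always_eventually norm_lim]) (intro allI norm_le)
    then have 1: "(\<lambda>n. E \<Delta> (U (c n))) \<longlonglongrightarrow> E \<Delta> (U f)" by (rule LIM_zero_cancel)
    have "(\<lambda>n. l2 M (\<lambda>z. indicator \<Delta> z * c n z - indicator \<Delta> z * f z)) \<longlonglongrightarrow> 0"
    proof (rule Lim_null_comparison[OF _ lim])
      have "l2 M (\<lambda>z. indicator \<Delta> z * c n z - indicator \<Delta> z * f z) \<le> 1\<^sup>2 * l2 M (\<lambda>z. c n z - f z)" for n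
        by (rule l2_mono_bound[OF sqint_diff[OF c f]
              sqint_measurable[OF sqint_diff[OF ind[OF c \<Delta>] ind[OF f \<Delta>]]]])
          (auto simp: indicator_def)
      then show "\<forall>\<^sub>F n in sequentially. norm (l2 M (\<lambda>z. indicator \<Delta> z * c n z - indicator \<Delta> z * f z))
          \<le> l2 M (\<lambda>z. c n z - f z)" by simp
    qed
    then have "(\<lambda>n. U (\<lambda>z. indicator \<Delta> z * c n z)) \<longlonglongrightarrow> U (\<lambda>z. indicator \<Delta> z * f z)"
      using tendsto_iff[OF ind[OF c \<Delta>] ind[OF f \<Delta>]] by simp
    then show ?thesis
      using LIMSEQ_unique[OF 1] unfolding E_c by blast
  qed
  have "functional_model M U H E"
    by standard (use sets U_in E_U in auto)
  then show thesis using that U_ind fin unfolding M_def by blast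
qed

section \<open>Symmetric index operators and recovery of the vectors\<close>

lemma index_operator_closure_symmetric:
  fixes x :: "mindex \<Rightarrow> 'h::chilbert_space"
  assumes sym: "\<And>\<omega> \<omega>'. cinner (x (\<sigma> \<omega>)) (x \<omega>') = cinner (x \<omega>) (x (\<sigma> \<omega>'))"
    and p: "(a, b) \<in> closure (index_operator x \<sigma>)" and q: "(a', b') \<in> closure (index_operator x \<sigma>)"
  shows "cinner b a' = cinner a b'"
proof -
  have base: "cinner (snd v) (fst w) = cinner (fst v) (snd w)"
    if vw: "v \<in> index_operator x \<sigma>" "w \<in> index_operator x \<sigma>" for v w
  proof -
    obtain S \<alpha> where v: "v = (\<Sum>\<omega>\<in>S. \<alpha> \<omega> *\<^sub>C x \<omega>, \<Sum>\<omega>\<in>S. \<alpha> \<omega> *\<^sub>C x (\<sigma> \<omega>))"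
      using vw(1) unfolding index_operator_def by blast
    obtain T \<beta> where w: "w = (\<Sum>\<omega>\<in>T. \<beta> \<omega> *\<^sub>C x \<omega>, \<Sum>\<omega>\<in>T. \<beta> \<omega> *\<^sub>C x (\<sigma> \<omega>))"
      using vw(2) unfolding index_operator_def by blast
    show ?thesis
      unfolding v w fst_conv snd_conv cinner_sum_left cinner_sum_right cinner_scaleC_left
        cinner_scaleC_right sym ..
  qed
  obtain v w where v: "\<And>n. v n \<in> index_operator x \<sigma>" "v \<longlonglongrightarrow> (a, b)"
    and w: "\<And>n. w n \<in> index_operator x \<sigma>" "w \<longlonglongrightarrow> (a', b')"
    using p q unfolding closure_sequential by metis
  have "(\<lambda>n. cinner (snd (v n)) (fst (w n))) \<longlonglongrightarrow> cinner b a'"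
    using tendsto_snd[OF v(2)] tendsto_fst[OF w(2)] by (auto intro: tendsto_cinner)
  moreover have "(\<lambda>n. cinner (fst (v n)) (snd (w n))) \<longlonglongrightarrow> cinner a b'"
    using tendsto_fst[OF v(2)] tendsto_snd[OF w(2)] by (auto intro: tendsto_cinner)
  ultimately show ?thesis
    unfolding base[OF v(1) w(1)] using LIMSEQ_unique by blast
qed

text \<open>The operator maps the difference \<open>d\<close> of two solutions to
  \<open>- c d\<close>. Symmetry makes \<open>- c\<close> times the squared norm of \<open>d\<close>
  real, so \<open>d = 0\<close> for imaginary \<open>c\<close>.\<close>

lemma index_operator_closure_injective:
  fixes x :: "mindex \<Rightarrow> 'h::chilbert_space"
  assumes sym: "\<And>\<omega> \<omega>'. cinner (x (\<sigma> \<omega>)) (x \<omega>') = cinner (x \<omega>) (x (\<sigma> \<omega>'))"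
    and p: "(a, b) \<in> closure (index_operator x \<sigma>)" and q: "(a', b') \<in> closure (index_operator x \<sigma>)"
    and c: "c = \<i> \<or> c = - \<i>" and eq: "b + c *\<^sub>C a = b' + c *\<^sub>C a'"
  shows "a = a'"
proof -
  note s = index_operator_closure_symmetric[of x \<sigma>, OF sym]
  let ?d = "a - a'"
  have "b - b' = (- c) *\<^sub>C ?d"
    using eq by (simp add: scaleC_diff_right algebra_simps complex_vector.scale_minus_left)
  moreover have "cinner (b - b') ?d = cinner ?d (b - b')"
    using s[OF p p] s[OF p q] s[OF q p] s[OF q q] by (simp add: cinner_diff_left cinner_diff_right)
  ultimately have "- c * cinner ?d ?d = - cnj c * cinner ?d ?d"
    by (simp only: cinner_scaleC_left cinner_scaleC_right complex_cnj_minus)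
  then have "cinner ?d ?d = 0" using c by auto
  then show ?thesis by (simp add: cinner_self)
qed

text \<open>Everything happens in the function model of the cyclic subspace of the zero-index
  vector, which corresponds to the constant 1. Each elementary change of index preserves the
  property \<open>P\<close>, so every \<open>x \<omega>\<close> corresponds to its moment function,
  and the moments are Gram entries against the starting vector.\<close>

lemma moment_solution_of_joint_spectral_measure:
  fixes x :: "mindex \<Rightarrow> 'h::chilbert_space"
  assumes gram: "gram_family u x" and rel: "moment_relations u" and J: "joint_spectral_measure x E"
  shows "moment_solution u (scalar_spectral_measure E (x (0, 0, 0, 0, 0, 0)))"
proof -
  define M where "M = scalar_spectral_measure E (x (0, 0, 0, 0, 0, 0))"
  have g: "cinner (x \<omega>) (x \<omega>') = u (gram_index \<omega> \<omega>')" for \<omega> \<omega>'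
    using gram unfolding gram_family_def by blast
  have E: "spectral_measure_on (closed_span x) E"
    and A: "closure (index_operator x shift1) = spectral_integral (closed_span x) E fst"
    and B: "closure (index_operator x shift2) = spectral_integral (closed_span x) E snd"
    using J unfolding joint_spectral_measure_def operator_A_def operator_B_def by blast+
  have x_in: "x \<omega> \<in> closed_span x" for \<omega>
    unfolding closed_span_def by (intro subsetD[OF closure_subset] complex_vector.span_base) simp
  obtain U where "functional_model (scalar_spectral_measure E (x (0, 0, 0, 0, 0, 0))) U (closed_span x) E"
    and U_ind: "\<And>\<Delta>. \<Delta> \<in> sets borel \<Longrightarrow> U (indicator \<Delta>) = E \<Delta> (x (0, 0, 0, 0, 0, 0))"
    and "finite_measure (scalar_spectral_measure E (x (0, 0, 0, 0, 0, 0)))"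
    by (rule functional_model_of_spectral_measure[of "range x" E "x (0, 0, 0, 0, 0, 0)",
          folded closed_span_def, OF E x_in]) (rule that)
  then interpret functional_model M U "closed_span x" E by (simp add: M_def)
  have fin: "finite_measure M" unfolding M_def by fact
  define P where "P \<omega> \<longleftrightarrow> sqint M (moment_fun \<omega>) \<and> x \<omega> = U (moment_fun \<omega>)" for \<omega>
  have idx: "(x \<omega>, x (\<sigma> \<omega>)) \<in> closure (index_operator x \<sigma>)" for \<sigma> \<omega>
  proof -
    have "(\<Sum>\<omega>\<in>{\<omega>}. 1 *\<^sub>C x \<omega>, \<Sum>\<omega>\<in>{\<omega>}. 1 *\<^sub>C x (\<sigma> \<omega>)) \<in> index_operator x \<sigma>"
      unfolding index_operator_def mem_Collect_eq
      by (intro exI[of _ "{\<omega>}"] exI[of _ "\<lambda>_. 1"]) simp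
    then show ?thesis by (intro subsetD[OF closure_subset]) (simp add: scaleC_one)
  qed
  \<comment> \<open>Raising \<open>m\<close> or \<open>n\<close>: the pair of
    \<open>x \<omega>\<close> and \<open>x (\<sigma> \<omega>)\<close> lies in the graph, and the
    model describes the graph as multiplication.\<close>
  have up: "P (\<sigma> \<omega>)"
    if \<phi>: "\<phi> \<in> borel_measurable borel" and op: "closure (index_operator x \<sigma>) = spectral_integral (closed_span x) E \<phi>"
      and mf: "\<And>z. moment_fun (\<sigma> \<omega>) z = complex_of_real (\<phi> z) * moment_fun \<omega> z" and P: "P \<omega>" for \<sigma> \<phi> \<omega>
  proof -
    have f: "sqint M (moment_fun \<omega>)" "x \<omega> = U (moment_fun \<omega>)" using P by (auto simp: P_def)
    have "(U (moment_fun \<omega>), x (\<sigma> \<omega>)) \<in> spectral_integral (closed_span x) E \<phi>"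
      using idx[of \<omega> \<sigma>] op f(2) by simp
    then show ?thesis
      unfolding spectral_integral_U_iff[OF f(1) \<phi>] P_def by (simp flip: mf)
  qed
  have bump_up: "P (\<rho> \<omega>)"
    if P: "P \<omega>" "P (\<sigma> \<omega>)" and x\<rho>: "x (\<rho> \<omega>) = x (\<sigma> \<omega>) + c *\<^sub>C x \<omega>"
      and mf: "\<And>z. moment_fun (\<rho> \<omega>) z = moment_fun (\<sigma> \<omega>) z + c * moment_fun \<omega> z" for \<rho> \<sigma> c \<omega>
  proof -
    have "moment_fun (\<rho> \<omega>) = (\<lambda>z. moment_fun (\<sigma> \<omega>) z + c * moment_fun \<omega> z)" using mf by auto
    then show ?thesis using P unfolding P_def x\<rho> by (simp add: add scale sqint_add sqint_scale)
  qed
  \<comment> \<open>Lowering an integer exponent: division by \<open>\<phi> + c\<close> keeps square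
    integrability, and the vector so obtained solves the same equation as \<open>x \<omega>\<close>,
    so injectivity identifies the two.\<close>
  have bump_down: "P \<omega>"
    if \<phi>: "\<phi> \<in> borel_measurable borel" and op: "closure (index_operator x \<sigma>) = spectral_integral (closed_span x) E \<phi>"
      and sym: "\<And>\<omega> \<omega>'. cinner (x (\<sigma> \<omega>)) (x \<omega>') = cinner (x \<omega>) (x (\<sigma> \<omega>'))"
      and c: "c = \<i> \<or> c = - \<i>"
      and P: "P (\<rho> \<omega>)" and x\<rho>: "x (\<rho> \<omega>) = x (\<sigma> \<omega>) + c *\<^sub>C x \<omega>"
      and mf: "\<And>z. moment_fun (\<rho> \<omega>) z = (complex_of_real (\<phi> z) + c) * moment_fun \<omega> z" for \<rho> \<sigma> \<phi> c \<omega>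
  proof -
    have f: "sqint M (moment_fun (\<rho> \<omega>))" "x (\<rho> \<omega>) = U (moment_fun (\<rho> \<omega>))" using P by (auto simp: P_def)
    have "cmod (complex_of_real (\<phi> z) + c) = sqrt (1 + (\<phi> z)\<^sup>2)" for z
      using c by (auto simp: norm_of_real_plus_i)
    then have n: "1 \<le> cmod (complex_of_real (\<phi> z) + c)" "\<bar>\<phi> z\<bar> \<le> cmod (complex_of_real (\<phi> z) + c)" for z
      by (auto intro: real_le_rsqrt)
    have mm [measurable]: "moment_fun \<omega> \<in> borel_measurable M" by measurable
    have [measurable]: "\<phi> \<in> borel_measurable borel" by fact
    have s: "sqint M (moment_fun \<omega>)"
    proof (rule sqint_bound[OF f(1) mm, of 1])
      show "cmod (moment_fun \<omega> z) \<le> 1 * cmod (moment_fun (\<rho> \<omega>) z)" for z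
        unfolding mf using mult_right_mono[OF n(1)[of z] norm_ge_zero[of "moment_fun \<omega> z"]]
        by (simp add: norm_mult)
    qed
    have s\<phi>: "sqint M (\<lambda>z. complex_of_real (\<phi> z) * moment_fun \<omega> z)"
    proof (rule sqint_bound[OF f(1), of _ 1])
      show "cmod (complex_of_real (\<phi> z) * moment_fun \<omega> z) \<le> 1 * cmod (moment_fun (\<rho> \<omega>) z)" for z
        unfolding mf using mult_right_mono[OF n(2)[of z] norm_ge_zero[of "moment_fun \<omega> z"]]
        by (simp add: norm_mult)
    qed simp
    have "(U (moment_fun \<omega>), U (\<lambda>z. complex_of_real (\<phi> z) * moment_fun \<omega> z)) \<in> closure (index_operator x \<sigma>)"
      unfolding op spectral_integral_U_iff[OF s \<phi>] using s\<phi> by simp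
    moreover have "U (\<lambda>z. complex_of_real (\<phi> z) * moment_fun \<omega> z) + c *\<^sub>C U (moment_fun \<omega>) = x (\<rho> \<omega>)"
    proof -
      have "moment_fun (\<rho> \<omega>) = (\<lambda>z. complex_of_real (\<phi> z) * moment_fun \<omega> z + c * moment_fun \<omega> z)"
        using mf by (auto simp: distrib_right)
      then show ?thesis unfolding f(2) using s s\<phi> by (simp add: add scale sqint_scale)
    qed
    ultimately have "x \<omega> = U (moment_fun \<omega>)"
      using index_operator_closure_injective[of x \<sigma>, OF sym idx _ c] x\<rho> by metis
    then show ?thesis using s by (simp add: P_def)
  qed
  \<comment> \<open>The defect is a combination of members of the family, so orthogonality to all
    members makes it orthogonal to itself.\<close>
  have x_eq: "x \<omega>1 = x \<omega>2 + c *\<^sub>C x \<omega>3"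
    if eq: "\<And>\<omega>'. u (gram_index \<omega>1 \<omega>') = u (gram_index \<omega>2 \<omega>') + c * u (gram_index \<omega>3 \<omega>')" for \<omega>1 \<omega>2 \<omega>3 c
  proof -
    let ?d = "x \<omega>1 - (x \<omega>2 + c *\<^sub>C x \<omega>3)"
    have orth: "cinner ?d (x \<omega>') = 0" for \<omega>'
      by (simp add: cinner_diff_left cinner_add_left cinner_scaleC_left g eq)
    have "cinner ?d ?d = cinner ?d (x \<omega>1) - (cinner ?d (x \<omega>2) + cnj c * cinner ?d (x \<omega>3))"
      by (simp only: cinner_diff_right cinner_add_right cinner_scaleC_right)
    then have "cinner ?d ?d = 0" by (simp only: orth) simp
    then show ?thesis by (simp add: cinner_self)
  qed
  note x_rel = x_eq[OF moment_relations_gram(1)[OF rel]] x_eq[OF moment_relations_gram(2)[OF rel]]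
    x_eq[OF moment_relations_gram(3)[OF rel]] x_eq[OF moment_relations_gram(4)[OF rel]]
  have fst_m: "(fst :: real \<times> real \<Rightarrow> real) \<in> borel_measurable borel"
    and snd_m: "(snd :: real \<times> real \<Rightarrow> real) \<in> borel_measurable borel"
    by (intro borel_measurable_continuous_onI continuous_intros)+
  have sym1: "cinner (x (shift1 \<omega>)) (x \<omega>') = cinner (x \<omega>) (x (shift1 \<omega>'))"
    and sym2: "cinner (x (shift2 \<omega>)) (x \<omega>') = cinner (x \<omega>) (x (shift2 \<omega>'))" for \<omega> \<omega>'
    by (cases \<omega>; cases \<omega>'; simp add: g)+
  have up1: "P (shift1 (m, k, l, n, r, t))" if "P (m, k, l, n, r, t)" for m k l n r t
    by (rule up[OF fst_m A moment_fun_shift(1) that])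
  have up2: "P (shift2 (m, k, l, n, r, t))" if "P (m, k, l, n, r, t)" for m k l n r t
    by (rule up[OF snd_m B moment_fun_shift(2) that])
  \<comment> \<open>The index map \<open>\<rho>\<close> is evaluated at one index only, so a
    constant map serves as its instance.\<close>
  have k_iff: "P (m, k + 1, l, n, r, t) \<longleftrightarrow> P (m, k, l, n, r, t)" for m k l n r t
    using bump_up[of "(m, k, l, n, r, t)" shift1 "\<lambda>_. (m, k + 1, l, n, r, t)" \<i>]
      bump_down[OF fst_m A sym1, of \<i> "\<lambda>_. (m, k + 1, l, n, r, t)" "(m, k, l, n, r, t)"] up1
    by (auto simp: x_rel moment_fun_bump moment_fun_shift distrib_right simp del: moment_fun.simps shift1.simps shift2.simps)
  have l_iff: "P (m, k, l + 1, n, r, t) \<longleftrightarrow> P (m, k, l, n, r, t)" for m k l n r t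
    using bump_up[of "(m, k, l, n, r, t)" shift1 "\<lambda>_. (m, k, l + 1, n, r, t)" "- \<i>"]
      bump_down[OF fst_m A sym1, of "- \<i>" "\<lambda>_. (m, k, l + 1, n, r, t)" "(m, k, l, n, r, t)"] up1
    by (auto simp: x_rel moment_fun_bump moment_fun_shift left_diff_distrib simp del: moment_fun.simps shift1.simps shift2.simps)
  have r_iff: "P (m, k, l, n, r + 1, t) \<longleftrightarrow> P (m, k, l, n, r, t)" for m k l n r t
    using bump_up[of "(m, k, l, n, r, t)" shift2 "\<lambda>_. (m, k, l, n, r + 1, t)" \<i>]
      bump_down[OF snd_m B sym2, of \<i> "\<lambda>_. (m, k, l, n, r + 1, t)" "(m, k, l, n, r, t)"] up2
    by (auto simp: x_rel moment_fun_bump moment_fun_shift distrib_right simp del: moment_fun.simps shift1.simps shift2.simps)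
  have t_iff: "P (m, k, l, n, r, t + 1) \<longleftrightarrow> P (m, k, l, n, r, t)" for m k l n r t
    using bump_up[of "(m, k, l, n, r, t)" shift2 "\<lambda>_. (m, k, l, n, r, t + 1)" "- \<i>"]
      bump_down[OF snd_m B sym2, of "- \<i>" "\<lambda>_. (m, k, l, n, r, t + 1)" "(m, k, l, n, r, t)"] up2
    by (auto simp: x_rel moment_fun_bump moment_fun_shift left_diff_distrib simp del: moment_fun.simps shift1.simps shift2.simps)
  have all_int: "Q k" if "\<And>k. Q (k + 1) \<longleftrightarrow> Q k" "Q 0" for Q and k :: int
  proof (induction k rule: int_induct[where k = 0])
    case base
    then show ?case by (rule that(2))
  next
    case (step1 i)
    then show ?case using that(1) by simp
  next
    case (step2 i)
    then show ?case using that(1)[of "i - 1"] by simp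
  qed
  have P0: "P (0, 0, 0, 0, 0, 0)"
  proof -
    have "(\<lambda>z. 1) = (indicator UNIV :: real \<times> real \<Rightarrow> complex)" by auto
    then show ?thesis
      unfolding P_def moment_fun_0 using U_ind[of UNIV] E_UNIV[OF E x_in] sqint_const[OF fin, of 1] by simp
  qed
  have "P (0, k, 0, 0, 0, 0)" for k using all_int[of "\<lambda>k. P (0, k, 0, 0, 0, 0)"] k_iff P0 by blast
  then have "P (0, k, l, 0, 0, 0)" for k l using all_int[of "\<lambda>l. P (0, k, l, 0, 0, 0)"] l_iff by blast
  then have "P (0, k, l, 0, r, 0)" for k l r using all_int[of "\<lambda>r. P (0, k, l, 0, r, 0)"] r_iff by blast
  then have "P (0, k, l, 0, r, t)" for k l r t using all_int[of "\<lambda>t. P (0, k, l, 0, r, t)"] t_iff by blast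
  then have "P (m, k, l, 0, r, t)" for m k l r t using up1 by (induction m) (auto simp del: moment_fun.simps)
  then have P: "P (m, k, l, n, r, t)" for m k l n r t using up2 by (induction n) (auto simp del: moment_fun.simps)
  then have sq: "sqint M (moment_fun \<omega>)" "x \<omega> = U (moment_fun \<omega>)" for \<omega>
    by (cases \<omega>; simp add: P_def)+
  have "integrable M (moment_fun \<omega>) \<and> (\<integral>z. moment_fun \<omega> z \<partial>M) = u \<omega>" for \<omega>
  proof
    have z: "gram_index \<omega> (0, 0, 0, 0, 0, 0) = \<omega>" by (cases \<omega>) simp
    have "moment_fun \<omega> z * cnj (moment_fun (0, 0, 0, 0, 0, 0) z) = moment_fun \<omega> z" for z
      by (simp only: moment_fun_0) simp
    note eq = this
    show "integrable M (moment_fun \<omega>)"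
      using integrable_l2ip[OF sq(1)[of \<omega>] sq(1)[of "(0, 0, 0, 0, 0, 0)"]] unfolding eq .
    have "(\<integral>z. moment_fun \<omega> z \<partial>M) = l2ip M (moment_fun \<omega>) (moment_fun (0, 0, 0, 0, 0, 0))"
      unfolding l2ip_def eq ..
    also have "\<dots> = cinner (x \<omega>) (x (0, 0, 0, 0, 0, 0))"
      unfolding sq(2) by (rule isometry[OF sq(1) sq(1), symmetric])
    also have "\<dots> = u \<omega>" unfolding g z ..
    finally show "(\<integral>z. moment_fun \<omega> z \<partial>M) = u \<omega>" .
  qed
  then show ?thesis using sets_M unfolding moment_solution_def M_def by blast
qed

section \<open>Positive semidefinite kernels\<close>

text \<open>Quantified over finite sets with arbitrary coefficients, unlike
  \<open>moment_positive\<close> with its finitely supported ones; this makes reindexing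
  direct.\<close>

definition psd :: "('i \<Rightarrow> 'i \<Rightarrow> complex) \<Rightarrow> bool" where
  "psd K \<longleftrightarrow> (\<forall>S \<alpha>. finite S \<longrightarrow> (\<Sum>i\<in>S. \<Sum>j\<in>S. \<alpha> i * cnj (\<alpha> j) * K i j) \<in> \<real>\<^sub>\<ge>\<^sub>0)"

lemma psdD: "psd K \<Longrightarrow> finite S \<Longrightarrow> (\<Sum>i\<in>S. \<Sum>j\<in>S. \<alpha> i * cnj (\<alpha> j) * K i j) \<in> \<real>\<^sub>\<ge>\<^sub>0"
  unfolding psd_def by blast

lemma psd_diag: assumes "psd K" shows "K i i \<in> \<real>\<^sub>\<ge>\<^sub>0"
  using psdD[OF assms, of "{i}" "\<lambda>_. 1"] by simp

lemma psd_two: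
  assumes "psd K" "i \<noteq> j"
  shows "K i i + cnj c * K i j + c * K j i + (c * cnj c) * K j j \<in> \<real>\<^sub>\<ge>\<^sub>0"
  using psdD[OF assms(1), of "{i, j}" "\<lambda>k. if k = j then c else 1"] assms(2)
  by (simp add: algebra_simps)

text \<open>Nonnegative values are real. Testing with the coefficients 1 and \<open>\<i>\<close>
  yields the imaginary and the real part of the claim.\<close>

lemma psd_hermitian: assumes "psd K" shows "K j i = cnj (K i j)"
proof (cases "i = j")
  case True
  then show ?thesis using psd_diag[OF assms, of i] by (simp add: complex_nonneg_Reals_iff complex_eq_iff)
next
  case False
  have d: "Im (K i i) = 0" "Im (K j j) = 0"
    using psd_diag[OF assms] by (simp_all add: complex_nonneg_Reals_iff)
  from psd_two[OF assms False, of 1] psd_two[OF assms False, of \<i>] d show ?thesis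
    by (simp add: complex_nonneg_Reals_iff complex_eq_iff)
qed

text \<open>With a vanishing diagonal entry the form is affine in the real parameter
  \<open>t\<close>, with slope proportional to the squared modulus of \<open>K i n\<close>. An
  affine function that is nonnegative everywhere has slope 0.\<close>

lemma psd_zero: assumes "psd K" "K n n = 0" shows "K i n = 0"
proof (cases "i = n")
  case False
  let ?a = "(cmod (K i n))\<^sup>2"
  have herm: "K n i = cnj (K i n)" by (rule psd_hermitian[OF assms(1)])
  have "0 \<le> Re (K i i) + 2 * t * ?a" for t :: real
  proof -
    have "K i n * cnj (K i n) = complex_of_real ?a" by (simp only: complex_norm_square)
    then have "K i i + cnj (complex_of_real t * K i n) * K i n + complex_of_real t * K i n * K n i
        = K i i + complex_of_real (2 * t * ?a)"
      by (simp add: herm algebra_simps)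
    moreover have "K i i + cnj (complex_of_real t * K i n) * K i n + complex_of_real t * K i n * K n i \<in> \<real>\<^sub>\<ge>\<^sub>0"
      using psd_two[OF assms(1) False, of "complex_of_real t * K i n"] assms(2) by simp
    ultimately show ?thesis by (simp only: complex_nonneg_Reals_iff plus_complex.sel Re_complex_of_real)
  qed
  from this[of "- (Re (K i i) + 1) / (2 * ?a)"] show ?thesis
    by (cases "K i n = 0") (auto simp: field_simps)
qed (use assms in simp)

text \<open>One elimination step at the pivot \<open>n\<close>. For a zero pivot the division by
  zero leaves \<open>K\<close> unchanged, which is right because row and column \<open>n\<close> of
  a positive kernel then vanish already.\<close>

definition schur_complement :: "('i \<Rightarrow> 'i \<Rightarrow> complex) \<Rightarrow> 'i \<Rightarrow> 'i \<Rightarrow> 'i \<Rightarrow> complex" where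
  "schur_complement K n i j = K i j - K i n * K n j / K n n"

text \<open>Completing the square: the form of the complement at \<open>\<alpha>\<close> is the form
  of \<open>K\<close> at \<open>\<alpha>\<close> minus \<open>lam\<close> times the unit vector at
  \<open>n\<close>, where \<open>lam\<close> makes the result orthogonal to that unit vector with
  respect to \<open>K\<close>.\<close>

lemma psd_schur_complement:
  fixes K :: "'i \<Rightarrow> 'i \<Rightarrow> complex"
  assumes K: "psd K" shows "psd (schur_complement K n)"
proof (cases "K n n = 0")
  case True
  then have "schur_complement K n = K" by (simp add: schur_complement_def fun_eq_iff)
  then show ?thesis using K by simp
next
  case False
  show ?thesis
    unfolding psd_def
  proof (intro allI impI)
    fix S :: "'i set" and \<alpha> :: "'i \<Rightarrow> complex" assume S: "finite S"
    let ?T = "insert n S"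
    \<comment> \<open>Extension by zero, since the pivot may lie inside or outside
      \<open>S\<close>.\<close>
    define a where "a i = (if i \<in> S then \<alpha> i else 0)" for i
    define b where "b = (\<Sum>i\<in>S. \<alpha> i * K i n)"
    define lam where "lam = b / K n n"
    define e where "e i = (if i = n then 1 else 0 :: complex)" for i
    have herm: "K j i = cnj (K i j)" for i j by (rule psd_hermitian[OF K])
    have cnn: "cnj (K n n) = K n n" using herm[of n n] by simp
    have restrict: "(\<Sum>i\<in>?T. a i * f i) = (\<Sum>i\<in>S. \<alpha> i * f i)" for f
      using S by (intro sum.mono_neutral_cong_right) (auto simp: a_def)
    have restrict': "(\<Sum>i\<in>?T. cnj (a i) * f i) = (\<Sum>i\<in>S. cnj (\<alpha> i) * f i)" for f
      using S by (intro sum.mono_neutral_cong_right) (auto simp: a_def)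
    have delta: "(\<Sum>i\<in>?T. e i * f i) = f n" "(\<Sum>i\<in>?T. cnj (e i) * f i) = f n" for f
      using S by (simp_all add: e_def if_distrib[of "\<lambda>c. c * _"] if_distrib[of cnj] sum.delta cong: if_cong)
    have cb: "(\<Sum>j\<in>S. cnj (\<alpha> j) * K n j) = cnj b"
      unfolding b_def cnj_sum by (intro sum.cong refl) (subst herm, simp)
    have inner: "(\<Sum>j\<in>?T. cnj (a j - lam * e j) * K i j) = (\<Sum>j\<in>S. cnj (\<alpha> j) * K i j) - cnj lam * K i n" for i
    proof -
      have "(\<Sum>j\<in>?T. cnj (a j - lam * e j) * K i j) =
          (\<Sum>j\<in>?T. cnj (a j) * K i j) - cnj lam * (\<Sum>j\<in>?T. cnj (e j) * K i j)"
        unfolding sum_distrib_left sum_subtractf[symmetric]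
        by (intro sum.cong refl) (simp add: algebra_simps)
      then show ?thesis by (simp only: restrict' delta)
    qed
    have outer: "(\<Sum>i\<in>?T. (a i - lam * e i) * f i) = (\<Sum>i\<in>S. \<alpha> i * f i) - lam * f n" for f
    proof -
      have "(\<Sum>i\<in>?T. (a i - lam * e i) * f i) = (\<Sum>i\<in>?T. a i * f i) - lam * (\<Sum>i\<in>?T. e i * f i)"
        unfolding sum_distrib_left sum_subtractf[symmetric]
        by (intro sum.cong refl) (simp add: algebra_simps)
      then show ?thesis by (simp only: restrict delta)
    qed
    have "(\<Sum>i\<in>?T. \<Sum>j\<in>?T. (a i - lam * e i) * cnj (a j - lam * e j) * K i j) =
        (\<Sum>i\<in>?T. (a i - lam * e i) * (\<Sum>j\<in>?T. cnj (a j - lam * e j) * K i j))"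
      by (simp only: sum_distrib_left mult.assoc)
    also have "\<dots> = (\<Sum>i\<in>S. \<alpha> i * ((\<Sum>j\<in>S. cnj (\<alpha> j) * K i j) - cnj lam * K i n))
        - lam * (cnj b - cnj lam * K n n)"
      unfolding inner outer cb ..
    also have "cnj b - cnj lam * K n n = 0" using False by (simp add: lam_def cnn)
    also have "(\<Sum>i\<in>S. \<alpha> i * ((\<Sum>j\<in>S. cnj (\<alpha> j) * K i j) - cnj lam * K i n)) - lam * 0 =
        (\<Sum>i\<in>S. \<Sum>j\<in>S. \<alpha> i * cnj (\<alpha> j) * schur_complement K n i j)"
    proof -
      have "cnj lam = (\<Sum>j\<in>S. cnj (\<alpha> j) * K n j) / K n n" by (simp add: lam_def cnn cb)
      then have "(\<Sum>j\<in>S. cnj (\<alpha> j) * K i j) - cnj lam * K i n =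
          (\<Sum>j\<in>S. cnj (\<alpha> j) * schur_complement K n i j)" for i
        by (simp add: schur_complement_def right_diff_distrib sum_subtractf sum_distrib_right
            sum_distrib_left sum_divide_distrib ac_simps)
      then show ?thesis by (simp add: sum_distrib_left mult.assoc)
    qed
    finally show "(\<Sum>i\<in>S. \<Sum>j\<in>S. \<alpha> i * cnj (\<alpha> j) * schur_complement K n i j) \<in> \<real>\<^sub>\<ge>\<^sub>0"
      using psdD[OF K, of ?T "\<lambda>i. a i - lam * e i"] S by simp
  qed
qed

text \<open>Cholesky decomposition; the vector with index \<open>i\<close> is supported on \<open>{0..i}\<close>.\<close>

lemma psd_gram_ell2:
  fixes K :: "nat \<Rightarrow> nat \<Rightarrow> complex"
  assumes "psd K"
  shows "\<exists>v :: nat \<Rightarrow> ell2. \<forall>i j. cinner (v i) (v j) = K i j"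
proof -
  \<comment> \<open>What remains of \<open>K\<close> after eliminating the pivots below
    \<open>n\<close>.\<close>
  define R where "R n = rec_nat K (\<lambda>n K'. schur_complement K' n) n" for n
  have R_0: "R 0 = K" and R_Suc: "R (Suc n) = schur_complement (R n) n" for n
    by (simp_all add: R_def)
  have psd: "psd (R n)" for n
    by (induction n) (simp_all add: R_0 R_Suc assms psd_schur_complement)
  have herm: "R n j i = cnj (R n i j)" for n i j by (rule psd_hermitian[OF psd])
  \<comment> \<open>An eliminated row vanishes and stays zero later; this makes the expansion of
    \<open>K i j\<close> end after finitely many terms.\<close>
  have zero: "R n i j = 0" if "i < n" for n i j
    using that
  proof (induction n arbitrary: j)
    case (Suc n)
    show ?case
    proof (cases "i = n")
      case True
      have "R n n j = 0" if "R n n n = 0"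
        using psd_zero[OF psd that, of j] herm[of n n j] by simp
      then show ?thesis unfolding True R_Suc schur_complement_def by (cases "R n n n = 0") auto
    next
      case False
      then show ?thesis using Suc by (simp add: R_Suc schur_complement_def)
    qed
  qed simp
  \<comment> \<open>The \<open>n\<close>-th Cholesky column; for a zero pivot the division makes it
    zero.\<close>
  define c where "c i n = R n i n / complex_of_real (sqrt (Re (R n n n)))" for i n
  have diag: "R n n n = complex_of_real (Re (R n n n))" "0 \<le> Re (R n n n)" for n
    using psd_diag[OF psd, of n n] by (simp_all add: complex_nonneg_Reals_iff complex_eq_iff)
  have prod: "c i n * cnj (c j n) = R n i n * R n n j / R n n n" for i j n
  proof -
    have "c i n * cnj (c j n) = R n i n * cnj (R n j n) / (complex_of_real (sqrt (Re (R n n n)) * sqrt (Re (R n n n))))"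
      unfolding c_def complex_cnj_divide complex_cnj_complex_of_real times_divide_times_eq of_real_mult ..
    also have "sqrt (Re (R n n n)) * sqrt (Re (R n n n)) = Re (R n n n)" using diag(2) by simp
    also have "cnj (R n j n) = R n n j" by (rule herm[symmetric])
    also have "complex_of_real (Re (R n n n)) = R n n n" by (rule diag(1)[symmetric])
    finally show ?thesis .
  qed
  have expand: "K i j = (\<Sum>n<N. c i n * cnj (c j n)) + R N i j" for i j N
  proof (induction N)
    case 0
    then show ?case by (simp add: R_0)
  next
    case (Suc N)
    then show ?case by (simp add: R_Suc schur_complement_def prod)
  qed
  have supp: "c i n = 0" if "n \<notin> {..<Suc i}" for i n
    using zero[of i n n] that by (simp add: c_def)
  have "summable (\<lambda>n. (cmod (c i n))\<^sup>2)" for i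
    using supp by (intro summable_finite[of "{..<Suc i}"]) auto
  then have nth: "ell2_nth (Abs_ell2 (c i)) = c i" for i
    by (intro Abs_ell2_inverse) simp
  have "cinner (Abs_ell2 (c i)) (Abs_ell2 (c j)) = K i j" for i j
  proof -
    have "(\<lambda>n. c i n * cnj (c j n)) sums (\<Sum>n<Suc i. c i n * cnj (c j n))"
      using supp by (intro sums_finite) auto
    moreover have "(\<lambda>n. c i n * cnj (c j n)) sums cinner (Abs_ell2 (c i)) (Abs_ell2 (c j))"
      using cinner_ell2_sums[of "Abs_ell2 (c i)" "Abs_ell2 (c j)"] by (simp add: nth)
    moreover have "(\<Sum>n<Suc i. c i n * cnj (c j n)) = K i j"
      using expand[of i j "Suc i"] zero[of i "Suc i" j] by simp
    ultimately show ?thesis using sums_unique2 by metis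
  qed
  then show ?thesis by (intro exI[of _ "\<lambda>i. Abs_ell2 (c i)"]) simp
qed

section \<open>Gram families obtained from positivity\<close>

lemma psd_moment_kernel:
  assumes "moment_positive u"
  shows "psd (\<lambda>\<omega> \<omega>'. u (gram_index \<omega> \<omega>'))"
  unfolding psd_def
proof (intro allI impI)
  fix S :: "mindex set" and \<alpha> :: "mindex \<Rightarrow> complex"
  assume S: "finite S"
  define \<beta> where "\<beta> \<omega> = (if \<omega> \<in> S then \<alpha> \<omega> else 0)" for \<omega>
  have sub: "{\<omega>. \<beta> \<omega> \<noteq> 0} \<subseteq> S" by (auto simp: \<beta>_def)
  have "(\<Sum>\<omega>\<in>S. \<Sum>\<omega>'\<in>S. \<alpha> \<omega> * cnj (\<alpha> \<omega>') * u (gram_index \<omega> \<omega>')) =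
      (\<Sum>\<omega>\<in>S. \<Sum>\<omega>'\<in>S. \<beta> \<omega> * cnj (\<beta> \<omega>') * u (gram_index \<omega> \<omega>'))"
    by (intro sum.cong refl) (simp add: \<beta>_def)
  also have "\<dots> = (\<Sum>\<omega>\<in>{\<omega>. \<beta> \<omega> \<noteq> 0}. \<Sum>\<omega>'\<in>S. \<beta> \<omega> * cnj (\<beta> \<omega>') * u (gram_index \<omega> \<omega>'))"
    using S sub by (intro sum.mono_neutral_right) auto
  also have "\<dots> = (\<Sum>\<omega>\<in>{\<omega>. \<beta> \<omega> \<noteq> 0}. \<Sum>\<omega>'\<in>{\<omega>. \<beta> \<omega> \<noteq> 0}. \<beta> \<omega> * cnj (\<beta> \<omega>') * u (gram_index \<omega> \<omega>'))"
    using S sub by (intro sum.cong refl sum.mono_neutral_right) auto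
  also have "\<dots> \<in> \<real>\<^sub>\<ge>\<^sub>0"
    using assms finite_subset[OF sub S] unfolding moment_positive_def by blast
  finally show "(\<Sum>\<omega>\<in>S. \<Sum>\<omega>'\<in>S. \<alpha> \<omega> * cnj (\<alpha> \<omega>') * u (gram_index \<omega> \<omega>')) \<in> \<real>\<^sub>\<ge>\<^sub>0" .
qed

lemma psd_reindex:
  fixes f :: "'j \<Rightarrow> 'i"
  assumes "psd K" "inj f"
  shows "psd (\<lambda>i j. K (f i) (f j))"
  unfolding psd_def
proof (intro allI impI)
  fix S :: "'j set" and \<alpha> :: "'j \<Rightarrow> complex" assume S: "finite S"
  have inj: "inj_on f S" using assms(2) by (rule inj_on_subset) simp
  show "(\<Sum>i\<in>S. \<Sum>j\<in>S. \<alpha> i * cnj (\<alpha> j) * K (f i) (f j)) \<in> \<real>\<^sub>\<ge>\<^sub>0"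
    using psdD[OF assms(1), of "f ` S" "\<lambda>i. \<alpha> (inv f i)"] S assms(2)
    by (simp add: sum.reindex[OF inj])
qed

text \<open>The index set is countably infinite, so the Cholesky construction applies along an
  enumeration of it.\<close>

lemma gram_family_ell2_exists:
  assumes "moment_positive u"
  shows "\<exists>x :: mindex \<Rightarrow> ell2. gram_family u x"
proof -
  have "infinite (UNIV :: mindex set)" by (simp add: finite_prod)
  then have "bij_betw (to_nat_on (UNIV :: mindex set)) UNIV UNIV"
    by (intro to_nat_on_infinite) auto
  then obtain f :: "nat \<Rightarrow> mindex" where f: "bij f"
    using bij_betw_inv_into by blast
  obtain v :: "nat \<Rightarrow> ell2" where v: "\<And>i j. cinner (v i) (v j) = u (gram_index (f i) (f j))"
    using psd_gram_ell2[OF psd_reindex[OF psd_moment_kernel[OF assms] bij_is_inj[OF f]]] by blast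
  have "gram_family u (\<lambda>\<omega>. v (inv f \<omega>))"
    unfolding gram_family_def by (simp add: v surj_f_inv_f[OF bij_is_surj[OF f]])
  then show ?thesis by blast
qed

section \<open>A continuous curve through all points of the unit square\<close>

text \<open>A point of the square is coded by the number whose base-8 digits combine the binary digits
  of its two coordinates; since only the digits 0 to 3 occur, the code determines the point
  uniformly continuously.\<close>

definition unit_square :: "(real \<times> real) set" where
  "unit_square = {0..<1} \<times> {0..<1}"

text \<open>The shift of the binary expansions of both coordinates.\<close>

definition doubling :: "real \<times> real \<Rightarrow> real \<times> real" where
  "doubling p = (frac (2 * fst p), frac (2 * snd p))"

definition digit :: "real \<times> real \<Rightarrow> int" where
  "digit p = \<lfloor>2 * fst p\<rfloor> + 2 * \<lfloor>2 * snd p\<rfloor>"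

definition square_code :: "real \<times> real \<Rightarrow> real" where
  "square_code p = (\<Sum>n. real_of_int (digit ((doubling ^^ n) p)) / 8 ^ Suc n)"

lemma doubling_in_square: "doubling p \<in> unit_square"
  by (simp add: doubling_def unit_square_def frac_lt_1)

lemma doubling_pow_in_square: "p \<in> unit_square \<Longrightarrow> (doubling ^^ n) p \<in> unit_square"
  by (cases n) (simp_all add: doubling_in_square)

lemma floor_double: "0 \<le> x \<Longrightarrow> x < 1 \<Longrightarrow> \<lfloor>2 * x\<rfloor> \<in> {0, 1}" for x :: real
  by (auto simp: floor_eq_iff)

lemma digit_range: "p \<in> unit_square \<Longrightarrow> 0 \<le> digit p \<and> digit p \<le> 3"
  using floor_double[of "fst p"] floor_double[of "snd p"]
  by (auto simp: unit_square_def digit_def)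

lemma square_code_summable:
  assumes "p \<in> unit_square"
  shows "summable (\<lambda>n. real_of_int (digit ((doubling ^^ n) p)) / 8 ^ Suc n)"
proof (rule summable_comparison_test')
  show "summable (\<lambda>n. 3 / 8 * (1 / 8 :: real) ^ n)" by (intro summable_mult summable_geometric) simp
  fix n
  have "0 \<le> digit ((doubling ^^ n) p)" "digit ((doubling ^^ n) p) \<le> 3"
    using digit_range[OF doubling_pow_in_square[OF assms]] by auto
  then show "norm (real_of_int (digit ((doubling ^^ n) p)) / 8 ^ Suc n) \<le> 3 / 8 * (1 / 8) ^ n"
    by (simp add: power_one_over divide_simps)
qed

lemma square_code_bounds:
  assumes p: "p \<in> unit_square" shows "0 \<le> square_code p" "square_code p \<le> 3 / 7"
proof -
  have d: "0 \<le> digit ((doubling ^^ n) p)" "digit ((doubling ^^ n) p) \<le> 3" for n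
    using digit_range[OF doubling_pow_in_square[OF p]] by auto
  show "0 \<le> square_code p"
    unfolding square_code_def by (intro suminf_nonneg square_code_summable[OF p]) (simp add: d)
  have "square_code p \<le> (\<Sum>n. 3 / 8 * (1 / 8) ^ n)"
    unfolding square_code_def
  proof (rule suminf_le[OF _ square_code_summable[OF p]])
    show "summable (\<lambda>n. 3 / 8 * (1 / 8 :: real) ^ n)" by (intro summable_mult summable_geometric) simp
    show "real_of_int (digit ((doubling ^^ n) p)) / 8 ^ Suc n \<le> 3 / 8 * (1 / 8) ^ n" for n
      using d(2)[of n] by (simp add: power_one_over divide_simps)
  qed
  also have "\<dots> = 3 / 7"
    by (subst suminf_mult[OF summable_geometric]) (simp_all add: suminf_geometric)
  finally show "square_code p \<le> 3 / 7" .
qed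

lemma square_code_rec:
  assumes p: "p \<in> unit_square"
  shows "square_code p = (digit p + square_code (doubling p)) / 8"
proof -
  let ?f = "\<lambda>n. real_of_int (digit ((doubling ^^ n) p)) / 8 ^ Suc n"
  have "(\<Sum>n. ?f (Suc n)) = (\<Sum>n. 1 / 8 * (real_of_int (digit ((doubling ^^ n) (doubling p))) / 8 ^ Suc n))"
    by (simp add: funpow_swap1)
  also have "\<dots> = 1 / 8 * square_code (doubling p)"
    unfolding square_code_def by (rule suminf_mult[OF square_code_summable[OF doubling_in_square]])
  finally show ?thesis
    using suminf_split_head[OF square_code_summable[OF p]] by (simp add: square_code_def)
qed

text \<open>Codes fill at most \<open>[0, 3 / 7]\<close>, the upper end being that of digits all
  equal to 3. Unequal leading digits thus separate codes by at least \<open>(1 - 3 / 7) / 8\<close>,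
  whence the constant \<open>4 / 7\<close>. Closer codes share the leading digit, and the comparison
  passes to the doubled points at scale 8.\<close>

lemma square_code_separates:
  assumes "p \<in> unit_square" "q \<in> unit_square" "\<bar>square_code p - square_code q\<bar> < 4 / 7 / 8 ^ n"
  shows "\<bar>fst p - fst q\<bar> \<le> 1 / 2 ^ n \<and> \<bar>snd p - snd q\<bar> \<le> 1 / 2 ^ n"
  using assms
proof (induction n arbitrary: p q)
  case 0
  then show ?case by (auto simp: unit_square_def)
next
  case (Suc n)
  let ?p = "doubling p" and ?q = "doubling q"
  have sq: "?p \<in> unit_square" "?q \<in> unit_square" by (rule doubling_in_square)+
  have rec: "square_code p - square_code q =
      (real_of_int (digit p - digit q) + (square_code ?p - square_code ?q)) / 8"
    using Suc.prems by (simp add: square_code_rec diff_divide_distrib add_divide_distrib)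
  have small: "\<bar>real_of_int (digit p - digit q) + (square_code ?p - square_code ?q)\<bar> < 4 / 7 / 8 ^ n"
    using Suc.prems(3) unfolding rec by (simp add: field_simps)
  have "4 / 7 / 8 ^ n \<le> (4 / 7 :: real)" by (simp add: divide_le_eq)
  with small have "\<bar>real_of_int (digit p - digit q) + (square_code ?p - square_code ?q)\<bar> < 4 / 7"
    by linarith
  then have "\<bar>real_of_int (digit p - digit q)\<bar> < 1"
    using square_code_bounds[OF sq(1)] square_code_bounds[OF sq(2)] by linarith
  then have d: "digit p = digit q" by linarith
  then have "\<bar>square_code ?p - square_code ?q\<bar> < 4 / 7 / 8 ^ n" using small by simp
  from Suc.IH[OF sq this] have IH: "\<bar>fst ?p - fst ?q\<bar> \<le> 1 / 2 ^ n" "\<bar>snd ?p - snd ?q\<bar> \<le> 1 / 2 ^ n" by auto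
  have "\<lfloor>2 * fst p\<rfloor> = \<lfloor>2 * fst q\<rfloor>" "\<lfloor>2 * snd p\<rfloor> = \<lfloor>2 * snd q\<rfloor>"
  proof -
    have unique: "a = a' \<and> b = b'" if "a \<in> {0, 1}" "b \<in> {0, 1}" "a' \<in> {0, 1}" "b' \<in> {0, 1}"
      "a + 2 * b = a' + 2 * b'" for a b a' b' :: int
      using that by auto
    have "\<lfloor>2 * fst p\<rfloor> = \<lfloor>2 * fst q\<rfloor> \<and> \<lfloor>2 * snd p\<rfloor> = \<lfloor>2 * snd q\<rfloor>"
      using Suc.prems(1,2) d unfolding digit_def unit_square_def
      by (intro unique floor_double) auto
    then show "\<lfloor>2 * fst p\<rfloor> = \<lfloor>2 * fst q\<rfloor>" "\<lfloor>2 * snd p\<rfloor> = \<lfloor>2 * snd q\<rfloor>" by auto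
  qed
  then have eq: "fst ?p - fst ?q = 2 * (fst p - fst q)" "snd ?p - snd ?q = 2 * (snd p - snd q)"
    by (simp_all add: doubling_def frac_def)
  show ?case using IH unfolding eq abs_mult by (simp add: field_simps)
qed

text \<open>The code itself jumps, but by the separation estimate its inverse is uniformly
  continuous on the set of codes. The inverse extends to the closure of this set and from there to
  the whole line.\<close>

lemma continuous_curve_through_square:
  "\<exists>g. continuous_on UNIV g \<and> (\<forall>p\<in>unit_square. g (square_code p) = p)"
proof -
  let ?D = "square_code ` unit_square"
  have small: "\<exists>n. 1 / 2 ^ n < e" if "e > 0" for e :: real
    using real_arch_pow_inv[of e "1 / 2"] that by (simp add: power_one_over)
  have inj: "inj_on square_code unit_square"
  proof (rule inj_onI)
    fix p q assume pq: "p \<in> unit_square" "q \<in> unit_square" "square_code p = square_code q"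
    then have le: "\<bar>fst p - fst q\<bar> \<le> 1 / 2 ^ n \<and> \<bar>snd p - snd q\<bar> \<le> 1 / 2 ^ n" for n
      by (intro square_code_separates) auto
    have "\<bar>a\<bar> \<le> 0" if "\<And>n. \<bar>a\<bar> \<le> 1 / 2 ^ n" for a :: real
      using small[of "\<bar>a\<bar>"] that by (meson linorder_not_le)
    from this[of "fst p - fst q"] this[of "snd p - snd q"] show "p = q"
      using le by (simp add: prod_eq_iff)
  qed
  define r where "r = inv_into unit_square square_code"
  have r: "r (square_code p) = p" if "p \<in> unit_square" for p
    unfolding r_def by (rule inv_into_f_f[OF inj that])
  have "uniformly_continuous_on ?D r"
    unfolding uniformly_continuous_on_def
  proof (intro allI impI)
    fix e :: real assume "e > 0"
    then obtain n where n: "1 / 2 ^ n < e / 2" using small[of "e / 2"] by auto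
    show "\<exists>d>0. \<forall>s\<in>?D. \<forall>t\<in>?D. dist t s < d \<longrightarrow> dist (r t) (r s) < e"
    proof (intro exI conjI ballI impI)
      show "(0::real) < 4 / 7 / 8 ^ n" by simp
      fix s t assume st: "s \<in> ?D" "t \<in> ?D" "dist t s < 4 / 7 / 8 ^ n"
      then obtain p q where pq: "p \<in> unit_square" "q \<in> unit_square" "s = square_code p" "t = square_code q"
        by blast
      have "\<bar>fst q - fst p\<bar> \<le> 1 / 2 ^ n \<and> \<bar>snd q - snd p\<bar> \<le> 1 / 2 ^ n"
        using pq st(3) by (intro square_code_separates) (auto simp: dist_real_def)
      moreover have "dist q p \<le> \<bar>fst q - fst p\<bar> + \<bar>snd q - snd p\<bar>"
        unfolding dist_prod_def dist_real_def power2_abs by (rule sqrt_sum_squares_le_sum_abs)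
      ultimately show "dist (r t) (r s) < e" using n pq r by simp
    qed
  qed
  then obtain g0 where g0: "uniformly_continuous_on (closure ?D) g0" "\<And>t. t \<in> ?D \<Longrightarrow> r t = g0 t"
    by (rule uniformly_continuous_on_extension_on_closure) blast
  obtain g where g: "continuous_on UNIV g" "\<And>t. t \<in> closure ?D \<Longrightarrow> g t = g0 t"
    by (rule Dugundji[of "UNIV :: (real \<times> real) set" UNIV "closure ?D" g0])
      (use uniformly_continuous_imp_continuous[OF g0(1)] in auto)
  have "g (square_code p) = p" if p: "p \<in> unit_square" for p
  proof -
    have D: "square_code p \<in> ?D" using p by (rule imageI)
    show ?thesis using g(2)[OF subsetD[OF closure_subset D]] g0(2)[OF D] r[OF p] by simp
  qed
  then show ?thesis using g(1) by blast
qed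

section \<open>Herglotz' theorem for the two-dimensional torus\<close>

text \<open>A geometric sum over the powers of a root of unity, which differs from 1 since
  \<open>M\<close> divides no nonzero \<open>l\<close> of modulus below \<open>M\<close>.\<close>

lemma sum_cis_powers:
  fixes l :: int
  assumes "M > 0" "\<bar>l\<bar> < int M"
  shows "(\<Sum>a<M. cis (2 * pi / M) powi (l * int a)) = (if l = 0 then of_nat M else 0)"
proof (cases "l = 0")
  case False
  let ?w = "cis (2 * pi / M) powi l"
  have w: "?w = cis (2 * pi * (real_of_int l / M))" by (simp add: cis_power_int mult.commute)
  have "?w \<noteq> 1"
  proof
    assume "?w = 1"
    then have "exp (\<i> * complex_of_real (2 * pi * (real_of_int l / M))) = 1"
      unfolding w by (simp add: cis_conv_exp)
    then obtain n :: int where "2 * pi * (real_of_int l / M) = of_int (2 * n) * pi"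
      unfolding exp_eq_1 by auto
    then have "real_of_int l = of_int n * of_nat M" using assms(1) by (simp add: field_simps)
    then have "l = n * int M" by (metis of_int_eq_iff of_int_mult of_int_of_nat_eq)
    then have "int M dvd \<bar>l\<bar>" by simp
    then show False using assms(2) False zdvd_not_zless[of "\<bar>l\<bar>" "int M"] by simp
  qed
  moreover have "?w ^ M = 1"
  proof -
    have "?w ^ M = cis (real M * (2 * pi * (real_of_int l / M)))" unfolding w by (rule Complex.DeMoivre)
    also have "real M * (2 * pi * (real_of_int l / M)) = 2 * pi * real_of_int l" using assms(1) by simp
    also have "cis \<dots> = 1" by (rule cis_multiple_2pi) simp
    finally show ?thesis .
  qed
  ultimately have "(\<Sum>a<M. ?w ^ a) = 0" by (simp add: geometric_sum)
  then show ?thesis using False by (simp add: power_int_mult)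
qed simp

lemma sum_Times_product:
  fixes f :: "'a \<Rightarrow> 'c::comm_semiring_0"
  shows "(\<Sum>x\<in>A \<times> B. f (fst x) * g (snd x)) = (\<Sum>a\<in>A. f a) * (\<Sum>b\<in>B. g b)"
  by (simp add: sum_product sum.cartesian_product case_prod_beta)

text \<open>Source of the Fejer factors \<open>1 - |j| / N\<close>: the pairs with
  \<open>p - q = j\<close> correspond to the \<open>p\<close> in an interval with
  \<open>N - |j|\<close> elements.\<close>

lemma count_differences:
  fixes j :: int and N :: nat
  assumes "\<bar>j\<bar> \<le> int N"
  shows "(\<Sum>p\<in>{0..<int N}. \<Sum>q\<in>{0..<int N}. if p - q = j then 1 else 0) = (of_int (int N - \<bar>j\<bar>) :: complex)"
proof -
  have "(\<Sum>q\<in>{0..<int N}. if p - q = j then 1 else 0 :: complex) = (if p - j \<in> {0..<int N} then 1 else 0)" for p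
  proof -
    have "(\<Sum>q\<in>{0..<int N}. if p - q = j then 1 else 0 :: complex) = (\<Sum>q\<in>{0..<int N}. if q = p - j then 1 else 0)"
      by (intro sum.cong refl if_cong) auto
    then show ?thesis by simp
  qed
  then have "(\<Sum>p\<in>{0..<int N}. \<Sum>q\<in>{0..<int N}. if p - q = j then 1 else 0) =
      (\<Sum>p\<in>{0..<int N}. if p \<in> {max 0 j..<min (int N) (int N + j)} then 1 else 0 :: complex)"
    by (intro sum.cong) auto
  also have "\<dots> = of_nat (card ({0..<int N} \<inter> {max 0 j..<min (int N) (int N + j)}))"
    unfolding sum.inter_restrict[OF finite_atLeastLessThan_int, symmetric] by simp
  also have "{0..<int N} \<inter> {max 0 j..<min (int N) (int N + j)} = {max 0 j..<min (int N) (int N + j)}"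
    using assms by auto
  also have "(of_nat (card \<dots>) :: complex) = of_int (int (card {max 0 j..<min (int N) (int N + j)}))"
    by (rule of_int_of_nat_eq[symmetric])
  also have "int (card {max 0 j..<min (int N) (int N + j)}) = int N - \<bar>j\<bar>"
  proof -
    have "max 0 j \<le> min (int N) (int N + j)" "min (int N) (int N + j) - max 0 j = int N - \<bar>j\<bar>"
      using assms by (auto simp: min_def max_def abs_if)
    then show ?thesis unfolding card_atLeastLessThan_int using assms by simp
  qed
  finally show ?thesis .
qed

text \<open>The Fejer kernel of order \<open>N\<close>, sampled at the roots of unity of order \<open>2 N\<close>, applied to \<open>c\<close>.\<close>

definition fejer_weight :: "(int \<Rightarrow> int \<Rightarrow> complex) \<Rightarrow> nat \<Rightarrow> nat \<times> nat \<Rightarrow> complex" where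
  "fejer_weight c N x =
     (\<Sum>p\<in>{0..<int N} \<times> {0..<int N}. \<Sum>q\<in>{0..<int N} \<times> {0..<int N}.
        cis (2 * pi / real (2 * N)) powi (- (fst p * int (fst x) + snd p * int (snd x))) *
        cnj (cis (2 * pi / real (2 * N)) powi (- (fst q * int (fst x) + snd q * int (snd x)))) *
        c (fst p - fst q) (snd p - snd q))"

lemma fejer_weight_nonneg:
  assumes "psd (\<lambda>p q. c (fst p - fst q) (snd p - snd q))"
  shows "fejer_weight c N x \<in> \<real>\<^sub>\<ge>\<^sub>0"
  unfolding fejer_weight_def by (rule psdD[OF assms]) simp

text \<open>Sampling at order \<open>2 N\<close> avoids aliasing: \<open>j - (p - q)\<close> has
  modulus below \<open>2 N\<close>, so orthogonality of the roots of unity keeps exactly the terms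
  with difference \<open>(j, k)\<close>, and counting them gives the last two factors.\<close>

lemma fejer_weight_sum:
  assumes N: "N > 0" and jk: "\<bar>j\<bar> \<le> int N" "\<bar>k\<bar> \<le> int N"
  defines "z \<equiv> cis (2 * pi / real (2 * N))"
  shows "(\<Sum>x\<in>{..<2 * N} \<times> {..<2 * N}. fejer_weight c N x * (z powi (j * int (fst x)) * z powi (k * int (snd x)))) =
    of_nat (2 * N) ^ 2 * c j k * (of_int (int N - \<bar>j\<bar>) * of_int (int N - \<bar>k\<bar>))"
proof -
  let ?I = "{0..<int N}" and ?A = "{..<2 * N}"
  have z0: "z \<noteq> 0" by (simp add: z_def)
  have cz: "cnj (z powi a) = z powi (- a)" for a
    by (simp add: z_def cis_power_int cis_cnj)
  have term_eq: "z powi (- (fst p * int (fst x) + snd p * int (snd x))) *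
        cnj (z powi (- (fst q * int (fst x) + snd q * int (snd x)))) *
        c (fst p - fst q) (snd p - snd q) * (z powi (j * int (fst x)) * z powi (k * int (snd x))) =
      c (fst p - fst q) (snd p - snd q) *
        (z powi ((j - (fst p - fst q)) * int (fst x)) * z powi ((k - (snd p - snd q)) * int (snd x)))"
    for p q :: "int \<times> int" and x :: "nat \<times> nat"
    unfolding cz
    by (simp add: power_int_add[OF disjI1[OF z0], symmetric] mult.assoc mult.left_commute algebra_simps)
  have orth: "(\<Sum>a\<in>?A. z powi ((j - (p - q)) * int a)) = of_nat (2 * N) * (if p - q = j then 1 else 0)"
    if "\<bar>j\<bar> \<le> int N" "p \<in> ?I" "q \<in> ?I" for j p q
  proof -
    have "\<bar>j - (p - q)\<bar> < int (2 * N)" using that by auto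
    from sum_cis_powers[OF _ this] show ?thesis using N unfolding z_def by simp
  qed
  have inner: "(\<Sum>x\<in>?A \<times> ?A. c (fst p - fst q) (snd p - snd q) *
        (z powi ((j - (fst p - fst q)) * int (fst x)) * z powi ((k - (snd p - snd q)) * int (snd x)))) =
      of_nat (2 * N) ^ 2 * c j k *
        ((if fst p - fst q = j then 1 else 0) * (if snd p - snd q = k then 1 else 0))"
    if "p \<in> ?I \<times> ?I" "q \<in> ?I \<times> ?I" for p q
  proof -
    have "(\<Sum>x\<in>?A \<times> ?A. z powi ((j - (fst p - fst q)) * int (fst x)) * z powi ((k - (snd p - snd q)) * int (snd x)))
        = (of_nat (2 * N) * (if fst p - fst q = j then 1 else 0)) *
          (of_nat (2 * N) * (if snd p - snd q = k then 1 else 0))"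
      using that jk
        sum_Times_product[where f = "\<lambda>a. z powi ((j - (fst p - fst q)) * int a)"
          and g = "\<lambda>a. z powi ((k - (snd p - snd q)) * int a)" and A = ?A and B = ?A]
      by (simp only: orth mem_Times_iff)
    then show ?thesis by (simp add: sum_distrib_left[symmetric] power2_eq_square)
  qed
  have "(\<Sum>x\<in>?A \<times> ?A. fejer_weight c N x * (z powi (j * int (fst x)) * z powi (k * int (snd x)))) =
      (\<Sum>x\<in>?A \<times> ?A. \<Sum>p\<in>?I \<times> ?I. \<Sum>q\<in>?I \<times> ?I. c (fst p - fst q) (snd p - snd q) *
        (z powi ((j - (fst p - fst q)) * int (fst x)) * z powi ((k - (snd p - snd q)) * int (snd x))))"
    unfolding fejer_weight_def z_def[symmetric] sum_distrib_right term_eq ..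
  also have "\<dots> = (\<Sum>p\<in>?I \<times> ?I. \<Sum>x\<in>?A \<times> ?A. \<Sum>q\<in>?I \<times> ?I. c (fst p - fst q) (snd p - snd q) *
        (z powi ((j - (fst p - fst q)) * int (fst x)) * z powi ((k - (snd p - snd q)) * int (snd x))))"
    by (rule sum.swap)
  also have "\<dots> = (\<Sum>p\<in>?I \<times> ?I. \<Sum>q\<in>?I \<times> ?I. \<Sum>x\<in>?A \<times> ?A. c (fst p - fst q) (snd p - snd q) *
        (z powi ((j - (fst p - fst q)) * int (fst x)) * z powi ((k - (snd p - snd q)) * int (snd x))))"
    by (intro sum.cong refl sum.swap)
  also have "\<dots> = (\<Sum>p\<in>?I \<times> ?I. \<Sum>q\<in>?I \<times> ?I. of_nat (2 * N) ^ 2 * c j k *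
        ((if fst p - fst q = j then 1 else 0) * (if snd p - snd q = k then 1 else 0)))"
    by (intro sum.cong refl inner)
  also have "\<dots> = of_nat (2 * N) ^ 2 * c j k * (\<Sum>p\<in>?I \<times> ?I. \<Sum>q\<in>?I \<times> ?I.
        (if fst p - fst q = j then 1 else 0) * (if snd p - snd q = k then 1 else 0))"
    by (simp only: sum_distrib_left)
  also have "(\<Sum>p\<in>?I \<times> ?I. \<Sum>q\<in>?I \<times> ?I.
        (if fst p - fst q = j then 1 else 0) * (if snd p - snd q = k then 1 else 0)) =
      (\<Sum>p\<in>?I \<times> ?I. (\<Sum>q\<in>?I. if fst p - q = j then 1 else 0) * (\<Sum>q\<in>?I. if snd p - q = k then 1 else 0 :: complex))"
    by (intro sum.cong refl sum_Times_product[where f = "\<lambda>q. if _ - q = j then 1 else 0"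
          and g = "\<lambda>q. if _ - q = k then 1 else 0"])
  also have "\<dots> = (\<Sum>p\<in>?I. \<Sum>q\<in>?I. if p - q = j then 1 else 0) * (\<Sum>p\<in>?I. \<Sum>q\<in>?I. if p - q = k then 1 else 0)"
    by (rule sum_Times_product[where f = "\<lambda>p. \<Sum>q\<in>?I. if p - q = j then 1 else 0"
          and g = "\<lambda>p. \<Sum>q\<in>?I. if p - q = k then 1 else 0"])
  also have "\<dots> = of_int (int N - \<bar>j\<bar>) * of_int (int N - \<bar>k\<bar>)"
    unfolding count_differences[OF jk(1)] count_differences[OF jk(2)] ..
  finally show ?thesis .
qed

text \<open>The sampled Fejer measures have the right moments up to factors tending to 1. Coding
  sample points by reals puts them on a bounded interval, so a subsequence converges weakly; the
  continuous curve makes the monomials bounded continuous functions of the parameter, so their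
  integrals converge too.\<close>

theorem Herglotz_torus:
  fixes c :: "int \<Rightarrow> int \<Rightarrow> complex"
  assumes psd: "psd (\<lambda>p q. c (fst p - fst q) (snd p - snd q))"
  shows "\<exists>(m :: real measure) a b. finite_measure m \<and> sets m = sets borel \<and>
    a \<in> borel_measurable borel \<and> b \<in> borel_measurable borel \<and>
    (\<forall>t. cmod (a t) = 1 \<and> cmod (b t) = 1) \<and>
    (\<forall>j k. (\<integral>t. a t powi j * b t powi k \<partial>m) = c j k)"
proof (cases "c 0 0 = 0")
  case True
  \<comment> \<open>Zero total mass forces every coefficient to vanish, and the normalisation of the
    other case is impossible.\<close>
  have zero: "c j k = 0" for j k
    using psd_zero[OF psd, of "(0, 0)" "(j, k)"] True by simp
  show ?thesis
  proof (intro exI conjI allI)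
    show "finite_measure (null_measure (borel :: real measure))" by standard simp
    show "(\<integral>t. (1::complex) powi j * 1 powi k \<partial>null_measure (borel :: real measure)) = c j k" for j k
      by (simp add: zero)
  qed auto
next
  case False
  define C where "C = Re (c 0 0)"
  have C: "c 0 0 = complex_of_real C" "0 < C"
    using psd_diag[OF psd, of "(0, 0)"] False
    by (auto simp: C_def complex_nonneg_Reals_iff complex_eq_iff)
  obtain g where g: "continuous_on UNIV g" "\<And>p. p \<in> unit_square \<Longrightarrow> g (square_code p) = p"
    using continuous_curve_through_square by blast
  define A where "A n = {..<2 * Suc n} \<times> {..<2 * Suc n}" for n :: nat
  define pt where "pt n x = (real (fst x) / real (2 * Suc n), real (snd x) / real (2 * Suc n))"
    for n and x :: "nat \<times> nat"
  \<comment> \<open>Normalised to total mass 1: the factors are the number of sample points, the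
    Fejer count at frequency 0, and the mass \<open>C\<close>.\<close>
  define w where "w n x = Re (fejer_weight c (Suc n) x) / ((real (2 * Suc n))\<^sup>2 * (real (Suc n))\<^sup>2 * C)" for n x
  define m where "m n = distr (point_measure (A n) (\<lambda>x. ennreal (w n x))) borel (\<lambda>x. square_code (pt n x))" for n
  have finA: "finite (A n)" for n by (simp add: A_def)
  have pt: "pt n x \<in> unit_square" if "x \<in> A n" for n x
    using that by (auto simp: A_def pt_def unit_square_def)
  have weight_real: "fejer_weight c N x = complex_of_real (Re (fejer_weight c N x))"
      "0 \<le> Re (fejer_weight c N x)" for N x
    using fejer_weight_nonneg[OF psd, of N x] by (auto simp: complex_nonneg_Reals_iff complex_eq_iff)
  have w0: "0 \<le> w n x" for n x unfolding w_def using weight_real(2) C(2) by simp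
  have w_eq: "complex_of_real (w n x) =
      fejer_weight c (Suc n) x / ((of_nat (2 * Suc n))\<^sup>2 * (of_nat (Suc n))\<^sup>2 * c 0 0)" for n x
    unfolding w_def of_real_divide weight_real(1)[symmetric] by (simp add: C(1))
  have moment: "(\<Sum>x\<in>A n. complex_of_real (w n x) * (cis (2 * pi * fst (pt n x)) powi j * cis (2 * pi * snd (pt n x)) powi k)) =
      c j k / c 0 0 * of_real ((1 - \<bar>real_of_int j\<bar> / Suc n) * (1 - \<bar>real_of_int k\<bar> / Suc n))"
    if jk: "\<bar>j\<bar> \<le> int (Suc n)" "\<bar>k\<bar> \<le> int (Suc n)" for n j k
  proof -
    let ?z = "cis (2 * pi / real (2 * Suc n))"
    have p: "cis (2 * pi * fst (pt n x)) powi j = ?z powi (j * int (fst x))"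
        "cis (2 * pi * snd (pt n x)) powi k = ?z powi (k * int (snd x))" for x
      unfolding cis_power_int by (simp_all add: pt_def ac_simps)
    have "(\<Sum>x\<in>A n. complex_of_real (w n x) * (cis (2 * pi * fst (pt n x)) powi j * cis (2 * pi * snd (pt n x)) powi k)) =
        (\<Sum>x\<in>A n. fejer_weight c (Suc n) x * (?z powi (j * int (fst x)) * ?z powi (k * int (snd x)))) /
          ((of_nat (2 * Suc n))\<^sup>2 * (of_nat (Suc n))\<^sup>2 * c 0 0)"
      unfolding p w_eq sum_divide_distrib by (intro sum.cong refl) simp
    also have "\<dots> = (of_nat (2 * Suc n) ^ 2 * c j k * (of_int (int (Suc n) - \<bar>j\<bar>) * of_int (int (Suc n) - \<bar>k\<bar>))) /
          ((of_nat (2 * Suc n))\<^sup>2 * (of_nat (Suc n))\<^sup>2 * c 0 0)"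
      unfolding A_def by (subst fejer_weight_sum) (use jk in auto)
    also have "\<dots> = c j k / c 0 0 * ((of_int (int (Suc n) - \<bar>j\<bar>) / of_nat (Suc n)) * (of_int (int (Suc n) - \<bar>k\<bar>) / of_nat (Suc n)))"
    proof -
      have "(of_nat (2 * Suc n) :: complex) \<noteq> 0" "(of_nat (Suc n) :: complex) \<noteq> 0"
        by (simp_all del: of_nat_Suc)
      then show ?thesis using False by (simp add: power2_eq_square del: of_nat_Suc of_nat_mult)
    qed
    finally have *: "(\<Sum>x\<in>A n. complex_of_real (w n x) * (cis (2 * pi * fst (pt n x)) powi j *
        cis (2 * pi * snd (pt n x)) powi k)) = c j k / c 0 0 *
        ((of_int (int (Suc n) - \<bar>j\<bar>) / of_nat (Suc n)) * (of_int (int (Suc n) - \<bar>k\<bar>) / of_nat (Suc n)))" .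
    have factor: "(of_int (int (Suc n) - \<bar>i\<bar>) / of_nat (Suc n) :: complex) = of_real (1 - \<bar>real_of_int i\<bar> / Suc n)" for i
    proof -
      have "of_int (int (Suc n) - \<bar>i\<bar>) / real (Suc n) = 1 - \<bar>real_of_int i\<bar> / Suc n"
        by (simp add: diff_divide_distrib del: of_nat_Suc)
      then show ?thesis by (metis of_real_divide of_real_of_int_eq of_real_of_nat_eq)
    qed
    show ?thesis unfolding * factor by (simp only: of_real_mult)
  qed
  have w_sum: "(\<Sum>x\<in>A n. w n x) = 1" for n
  proof -
    have "complex_of_real (\<Sum>x\<in>A n. w n x) = 1"
      using moment[of 0 n 0] False by simp
    then show ?thesis by (simp only: of_real_eq_1_iff)
  qed
  have pm: "prob_space (point_measure (A n) (\<lambda>x. ennreal (w n x)))" for n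
  proof
    show "emeasure (point_measure (A n) (\<lambda>x. ennreal (w n x))) (space (point_measure (A n) (\<lambda>x. ennreal (w n x)))) = 1"
      using w_sum[of n] w0 by (simp add: space_point_measure emeasure_point_measure_finite finA sum_ennreal)
  qed
  have rd: "real_distribution (m n)" for n
    unfolding real_distribution_def real_distribution_axioms_def m_def
    by (auto intro!: prob_space.prob_space_distr[OF pm])
  have int_m: "(\<integral>t. f t \<partial>m n) = (\<Sum>x\<in>A n. complex_of_real (w n x) * f (square_code (pt n x)))"
    if "f \<in> borel_measurable borel" for f :: "real \<Rightarrow> complex" and n
    unfolding m_def using that w0
    by (subst integral_distr) (auto simp: lebesgue_integral_point_measure_finite finA scaleR_conv_of_real)
  \<comment> \<open>All codes lie in \<open>[0, 3 / 7]\<close>, so one interval carries the full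
    mass of every measure.\<close>
  have "tight m"
    unfolding tight_def
  proof (intro conjI allI impI rd)
    fix e :: real assume e: "0 < e"
    have "measure (m n) {-1<..1} = 1" for n
    proof -
      let ?pm = "point_measure (A n) (\<lambda>x. ennreal (w n x))"
      interpret pm: prob_space ?pm by (rule pm)
      have "measure (m n) {-1<..1} = measure ?pm ((\<lambda>x. square_code (pt n x)) -` {-1<..1} \<inter> space ?pm)"
        unfolding m_def by (intro measure_distr) auto
      also have "(\<lambda>x. square_code (pt n x)) -` {-1<..1} \<inter> space ?pm = space ?pm"
      proof -
        have "-1 < square_code (pt n x) \<and> square_code (pt n x) \<le> 1" if "x \<in> A n" for x
          using square_code_bounds[OF pt[OF that]] by simp
        then show ?thesis by (auto simp: space_point_measure)
      qed
      finally show ?thesis using pm.prob_space by simp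
    qed
    then show "\<exists>a b. a < b \<and> (\<forall>n. 1 - e < measure (m n) {a<..b})"
      using e by (intro exI[of _ "-1"] exI[of _ 1]) simp
  qed
  from tight_imp_convergent_subsubsequence[OF this strict_mono_id] obtain r m0
    where r: "strict_mono r" and m0: "real_distribution m0" and wc: "weak_conv_m (m \<circ> r) m0"
    by (auto simp: comp_def id_def)
  interpret m0: real_distribution m0 by (rule m0)
  define a where "a t = cis (2 * pi * fst (g t))" for t
  define b where "b t = cis (2 * pi * snd (g t))" for t
  have cont: "continuous_on UNIV (\<lambda>t. a t powi j * b t powi k)" for j k
    unfolding a_def b_def by (intro continuous_intros g) auto
  have ab: "cmod (a t) = 1" "cmod (b t) = 1" for t by (simp_all add: a_def b_def)
  have lim: "(\<integral>t. a t powi j * b t powi k \<partial>m0) = c j k / c 0 0" for j k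
  proof -
    have "(\<lambda>n. \<integral>t. a t powi j * b t powi k \<partial>(m \<circ> r) n) \<longlonglongrightarrow> (\<integral>t. a t powi j * b t powi k \<partial>m0)"
    proof (rule weak_conv_imp_integral_bdd_continuous_conv)
      show "isCont (\<lambda>t. a t powi j * b t powi k) t" for t
        using cont by (simp add: continuous_on_eq_continuous_at)
      show "norm (a t powi j * b t powi k) \<le> 1" for t
        by (simp add: norm_mult norm_power_int ab)
    qed (use rd m0 wc in \<open>auto simp: comp_def\<close>)
    moreover have "(\<lambda>n. \<integral>t. a t powi j * b t powi k \<partial>m n) \<longlonglongrightarrow> c j k / c 0 0"
    proof -
      have "(\<lambda>n. c j k / c 0 0 * of_real ((1 - \<bar>real_of_int j\<bar> / Suc n) * (1 - \<bar>real_of_int k\<bar> / Suc n)))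
          \<longlonglongrightarrow> c j k / c 0 0 * of_real ((1 - 0) * (1 - 0))"
        by (intro tendsto_intros LIMSEQ_Suc[OF lim_const_over_n])
      moreover have "\<forall>\<^sub>F n in sequentially. c j k / c 0 0 *
          of_real ((1 - \<bar>real_of_int j\<bar> / Suc n) * (1 - \<bar>real_of_int k\<bar> / Suc n)) =
          (\<integral>t. a t powi j * b t powi k \<partial>m n)"
      proof (rule eventually_sequentiallyI)
        fix n assume n: "nat (max \<bar>j\<bar> \<bar>k\<bar>) \<le> n"
        have "(\<integral>t. a t powi j * b t powi k \<partial>m n) =
            (\<Sum>x\<in>A n. complex_of_real (w n x) * (cis (2 * pi * fst (pt n x)) powi j * cis (2 * pi * snd (pt n x)) powi k))"
          unfolding int_m[OF borel_measurable_continuous_onI[OF cont]]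
          by (intro sum.cong refl) (simp add: a_def b_def g(2)[OF pt])
        also have "\<dots> = c j k / c 0 0 *
            of_real ((1 - \<bar>real_of_int j\<bar> / Suc n) * (1 - \<bar>real_of_int k\<bar> / Suc n))"
          using n by (intro moment) auto
        finally show "c j k / c 0 0 *
            of_real ((1 - \<bar>real_of_int j\<bar> / Suc n) * (1 - \<bar>real_of_int k\<bar> / Suc n)) =
            (\<integral>t. a t powi j * b t powi k \<partial>m n)" by simp
      qed
      ultimately show ?thesis using Lim_transform_eventually by force
    qed
    then have "(\<lambda>n. \<integral>t. a t powi j * b t powi k \<partial>(m \<circ> r) n) \<longlonglongrightarrow> c j k / c 0 0"
      using LIMSEQ_subseq_LIMSEQ[OF _ r] by (fastforce simp: comp_def)
    ultimately show ?thesis using LIMSEQ_unique by blast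
  qed
  have [measurable]: "a \<in> borel_measurable borel" "b \<in> borel_measurable borel"
    unfolding a_def[abs_def] b_def[abs_def]
    by (intro borel_measurable_continuous_onI continuous_intros g)+
  have [measurable]: "(\<lambda>t. a t powi j * b t powi k) \<in> borel_measurable borel" for j k
    by (rule borel_measurable_continuous_onI[OF cont])
  show ?thesis
  proof (intro exI conjI allI)
    \<comment> \<open>A constant density undoes the normalisation by \<open>C\<close>.\<close>
    show "finite_measure (density m0 (\<lambda>_. ennreal C))"
      by standard (simp add: emeasure_density m0.emeasure_space_1 ennreal_mult_eq_top_iff)
    show "sets (density m0 (\<lambda>_. ennreal C)) = sets borel" by simp
    show "(\<integral>t. a t powi j * b t powi k \<partial>density m0 (\<lambda>_. ennreal C)) = c j k" for j k
      using C(2) False by (subst integral_density) (simp_all add: lim scaleR_conv_of_real C(1)[symmetric])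
  qed (simp_all add: ab)
qed

section \<open>The moment problem\<close>

lemma moment_positive_of_solution:
  assumes \<mu>: "moment_solution u \<mu>"
  shows "moment_positive u"
  unfolding moment_positive_def
proof (intro allI impI)
  fix \<alpha> :: "mindex \<Rightarrow> complex" assume fin: "finite {\<omega>. \<alpha> \<omega> \<noteq> 0}"
  let ?S = "{\<omega>. \<alpha> \<omega> \<noteq> 0}"
  let ?f = "\<lambda>z. \<Sum>\<omega>\<in>?S. \<alpha> \<omega> * moment_fun \<omega> z"
  note int = moment_solutionD(2)[OF \<mu>] and val = moment_solutionD(3)[OF \<mu>]
  have expand: "?f z * cnj (?f z) = (\<Sum>\<omega>\<in>?S. \<Sum>\<omega>'\<in>?S. (\<alpha> \<omega> * cnj (\<alpha> \<omega>')) * moment_fun (gram_index \<omega> \<omega>') z)" for z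
    unfolding cnj_sum sum_product moment_fun_gram_index by (intro sum.cong refl) simp
  have "(\<Sum>\<omega>\<in>?S. \<Sum>\<omega>'\<in>?S. \<alpha> \<omega> * cnj (\<alpha> \<omega>') * u (gram_index \<omega> \<omega>')) =
      (\<Sum>\<omega>\<in>?S. \<Sum>\<omega>'\<in>?S. \<integral>z. (\<alpha> \<omega> * cnj (\<alpha> \<omega>')) * moment_fun (gram_index \<omega> \<omega>') z \<partial>\<mu>)"
    by (simp add: val)
  also have "\<dots> = (\<integral>z. ?f z * cnj (?f z) \<partial>\<mu>)"
    unfolding expand by (simp add: Bochner_Integration.integral_sum int)
  also have "\<dots> = (\<integral>z. complex_of_real ((cmod (?f z))\<^sup>2) \<partial>\<mu>)"
    by (simp only: complex_norm_square)
  also have "\<dots> = complex_of_real (\<integral>z. (cmod (?f z))\<^sup>2 \<partial>\<mu>)"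
    by (rule integral_complex_of_real)
  also have "\<dots> \<in> \<real>\<^sub>\<ge>\<^sub>0" by (simp add: nonneg_Reals_of_real_iff)
  finally show "(\<Sum>\<omega>\<in>?S. \<Sum>\<omega>'\<in>?S. \<alpha> \<omega> * cnj (\<alpha> \<omega>') * u (gram_index \<omega> \<omega>')) \<in> \<real>\<^sub>\<ge>\<^sub>0" .
qed

lemma moment_relations_of_solution:
  assumes \<mu>: "moment_solution u \<mu>"
  shows "moment_relations u"
proof -
  note int = moment_solutionD(2)[OF \<mu>] and val = moment_solutionD(3)[OF \<mu>]
  have rel: "u \<omega>1 + c * u \<omega>2 = u \<omega>3"
    if "\<And>z. moment_fun \<omega>3 z = moment_fun \<omega>1 z + c * moment_fun \<omega>2 z" for \<omega>1 \<omega>2 \<omega>3 c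
    unfolding val[symmetric] that by (simp add: int)
  have base: "u (m + 1, k, l, n, r, t) + \<i> * u (m, k, l, n, r, t) = u (m, k + 1, l, n, r, t)"
    "u (m + 1, k, l, n, r, t) + (- \<i>) * u (m, k, l, n, r, t) = u (m, k, l + 1, n, r, t)"
    "u (m, k, l, n + 1, r, t) + \<i> * u (m, k, l, n, r, t) = u (m, k, l, n, r + 1, t)"
    "u (m, k, l, n + 1, r, t) + (- \<i>) * u (m, k, l, n, r, t) = u (m, k, l, n, r, t + 1)" for m k l n r t
    by (rule rel, simp only: moment_fun_bump, simp add: algebra_simps)+
  show ?thesis
    unfolding moment_relations_def
  proof (intro allI)
    fix m a n d :: nat and k l r t b c e f :: int
    have "m + 1 + a = (m + a) + 1" "n + 1 + d = (n + d) + 1" "k + 1 + c = (k + c) + 1"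
      "l + 1 + b = (l + b) + 1" "r + 1 + f = (r + f) + 1" "t + 1 + e = (t + e) + 1" by simp_all
    note shift = this
    show "u (m + 1 + a, k + c, l + b, n + d, r + f, t + e) + \<i> * u (m + a, k + c, l + b, n + d, r + f, t + e)
          = u (m + a, k + 1 + c, l + b, n + d, r + f, t + e) \<and>
        u (m + 1 + a, k + c, l + b, n + d, r + f, t + e) - \<i> * u (m + a, k + c, l + b, n + d, r + f, t + e)
          = u (m + a, k + c, l + 1 + b, n + d, r + f, t + e) \<and>
        u (m + a, k + c, l + b, n + 1 + d, r + f, t + e) + \<i> * u (m + a, k + c, l + b, n + d, r + f, t + e)
          = u (m + a, k + c, l + b, n + d, r + 1 + f, t + e) \<and>
        u (m + a, k + c, l + b, n + 1 + d, r + f, t + e) - \<i> * u (m + a, k + c, l + b, n + d, r + f, t + e)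
          = u (m + a, k + c, l + b, n + d, r + f, t + 1 + e)"
      unfolding shift base[symmetric] by simp
  qed
qed

lemma moment_solution_unique:
  assumes "moment_solution u \<mu>" "moment_solution u \<nu>"
  shows "\<mu> = \<nu>"
proof (rule measure_eqI_cayley)
  fix j k
  show "(\<integral>z. cayley (fst z) powi j * cayley (snd z) powi k \<partial>\<mu>) =
      (\<integral>z. cayley (fst z) powi j * cayley (snd z) powi k \<partial>\<nu>)"
    unfolding moment_fun_cayley[symmetric] moment_solutionD(3)[OF assms(1)] moment_solutionD(3)[OF assms(2)] ..
qed (use assms finite_measure_moment_solution moment_solutionD(1) in blast)+

text \<open>The moments with \<open>k + l = 2 N\<close> and \<open>r + t = 2 N\<close> are the trigonometric moments
  \<open>\<integral> w\<^sub>1\<^sup>j w\<^sub>2\<^sup>k d\<kappa>\<close> in the variables \<open>w = (x + i) / (x - i)\<close> of the measure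
  \<open>\<kappa> = (1 + x\<^sub>1\<^sup>2)\<^sup>N (1 + x\<^sub>2\<^sup>2)\<^sup>N \<mu>\<close>.\<close>

definition level_moment :: "(mindex \<Rightarrow> complex) \<Rightarrow> nat \<Rightarrow> int \<Rightarrow> int \<Rightarrow> complex" where
  "level_moment u N j k = u (0, j + int N, int N - j, 0, k + int N, int N - k)"

text \<open>In \<open>gram_index\<close> the offset \<open>N\<close> of the chosen indices enters
  once in each of the two paired exponents, and everything else depends on differences only.\<close>

lemma psd_level_moment:
  assumes "moment_positive u"
  shows "psd (\<lambda>p q. level_moment u N (fst p - fst q) (snd p - snd q))"
proof -
  define f :: "int \<times> int \<Rightarrow> mindex" where "f p = (0, fst p + int N, - fst p, 0, snd p + int N, - snd p)" for p
  have "inj f" by (auto simp: inj_def f_def prod_eq_iff)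
  from psd_reindex[OF psd_moment_kernel[OF assms] this] show ?thesis
    by (simp add: f_def level_moment_def algebra_simps)
qed

section \<open>Relations between consecutive levels\<close>

lemma moment_relations_2i:
  assumes "moment_relations u"
  shows "2 * \<i> * u (m, k, l, n, r, t) = u (m, k + 1, l, n, r, t) - u (m, k, l + 1, n, r, t)"
    "2 * \<i> * u (m, k, l, n, r, t) = u (m, k, l, n, r + 1, t) - u (m, k, l, n, r, t + 1)"
  by (simp_all add: moment_relationsD[OF assms])

text \<open>Squaring \<open>2 i = (x + i) - (x - i)\<close> gives
  \<open>4 = 2 (x + i) (x - i) - (x + i)^2 - (x - i)^2\<close>, which expresses a moment by moments
  of total exponent two higher.\<close>

lemma moment_relations_4:
  assumes "moment_relations u"
  shows "4 * u (m, k, l, n, r, t) =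
      2 * u (m, k + 1, l + 1, n, r, t) - u (m, k + 2, l, n, r, t) - u (m, k, l + 2, n, r, t)"
    "4 * u (m, k, l, n, r, t) =
      2 * u (m, k, l, n, r + 1, t + 1) - u (m, k, l, n, r + 2, t) - u (m, k, l, n, r, t + 2)"
proof -
  note R = moment_relations_2i[OF assms]
  have "- ((2 * \<i>) * (2 * \<i> * u (m, k, l, n, r, t))) =
      - (2 * \<i> * u (m, k + 1, l, n, r, t) - 2 * \<i> * u (m, k, l + 1, n, r, t))"
    by (simp only: R(1)[of m k l n r t] right_diff_distrib)
  also have "\<dots> = 2 * u (m, k + 1, l + 1, n, r, t) - u (m, k + 2, l, n, r, t) - u (m, k, l + 2, n, r, t)"
    by (simp add: R(1)[of m "k + 1"] R(1)[of m k "l + 1"] add.assoc)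
  finally show "4 * u (m, k, l, n, r, t) =
      2 * u (m, k + 1, l + 1, n, r, t) - u (m, k + 2, l, n, r, t) - u (m, k, l + 2, n, r, t)" by simp
  have "- ((2 * \<i>) * (2 * \<i> * u (m, k, l, n, r, t))) =
      - (2 * \<i> * u (m, k, l, n, r + 1, t) - 2 * \<i> * u (m, k, l, n, r, t + 1))"
    by (simp only: R(2)[of m k l n r t] right_diff_distrib)
  also have "\<dots> = 2 * u (m, k, l, n, r + 1, t + 1) - u (m, k, l, n, r + 2, t) - u (m, k, l, n, r, t + 2)"
    by (simp add: R(2)[of m k l n "r + 1"] R(2)[of m k l n r "t + 1"] add.assoc)
  finally show "4 * u (m, k, l, n, r, t) =
      2 * u (m, k, l, n, r + 1, t + 1) - u (m, k, l, n, r + 2, t) - u (m, k, l, n, r, t + 2)" by simp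
qed

text \<open>The coefficients are those of \<open>(2 - w\<^sub>1 - 1 / w\<^sub>1) (2 - w\<^sub>2 - 1
  / w\<^sub>2)\<close>; the 16 comes from using \<open>moment_relations_4\<close> once in each
  variable.\<close>

lemma level_moment_Suc:
  assumes "moment_relations u"
  shows "16 * level_moment u N j k =
    2 * (2 * level_moment u (Suc N) j k - level_moment u (Suc N) j (k + 1) - level_moment u (Suc N) j (k - 1))
    - (2 * level_moment u (Suc N) (j + 1) k - level_moment u (Suc N) (j + 1) (k + 1) - level_moment u (Suc N) (j + 1) (k - 1))
    - (2 * level_moment u (Suc N) (j - 1) k - level_moment u (Suc N) (j - 1) (k + 1) - level_moment u (Suc N) (j - 1) (k - 1))"
proof -
  note R = moment_relations_4[OF assms]
  have 2: "4 * u (0, a, b, 0, k + int N, int N - k) =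
      2 * u (0, a, b, 0, k + int (Suc N), int (Suc N) - k) - u (0, a, b, 0, k + 1 + int (Suc N), int (Suc N) - (k + 1))
      - u (0, a, b, 0, k - 1 + int (Suc N), int (Suc N) - (k - 1))" for a b
    unfolding R(2) by (simp add: algebra_simps)
  have "4 * u (0, j + int N, int N - j, 0, c, d) =
      2 * u (0, j + int (Suc N), int (Suc N) - j, 0, c, d) - u (0, j + 1 + int (Suc N), int (Suc N) - (j + 1), 0, c, d)
      - u (0, j - 1 + int (Suc N), int (Suc N) - (j - 1), 0, c, d)" for c d
    unfolding R(1) by (simp add: algebra_simps)
  note 1 = this
  have "16 * level_moment u N j k = 4 * (4 * u (0, j + int N, int N - j, 0, k + int N, int N - k))"
    unfolding level_moment_def by simp
  also have "\<dots> = 4 * (2 * u (0, j + int (Suc N), int (Suc N) - j, 0, k + int N, int N - k)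
      - u (0, j + 1 + int (Suc N), int (Suc N) - (j + 1), 0, k + int N, int N - k)
      - u (0, j - 1 + int (Suc N), int (Suc N) - (j - 1), 0, k + int N, int N - k))"
    by (simp only: 1)
  finally have
    "16 * level_moment u N j k =
      2 * (4 * u (0, j + int (Suc N), int (Suc N) - j, 0, k + int N, int N - k))
      - 4 * u (0, j + 1 + int (Suc N), int (Suc N) - (j + 1), 0, k + int N, int N - k)
      - 4 * u (0, j - 1 + int (Suc N), int (Suc N) - (j - 1), 0, k + int N, int N - k)"
    by (simp only: right_diff_distrib) simp
  then show ?thesis unfolding 2 level_moment_def .
qed

lemma one_minus_unit_squared:
  assumes "cmod w = 1"
  shows "complex_of_real ((cmod (1 - w))\<^sup>2) = 2 - w - w powi (-1)"
proof -
  have w: "w * cnj w = 1" using assms by (simp add: complex_norm_square[symmetric])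
  then have "w powi (-1) = cnj w" by (simp add: power_int_minus inverse_unique)
  then show ?thesis unfolding complex_norm_square by (simp add: algebra_simps w)
qed

lemma power_int_measurable [measurable]:
  fixes f :: "'a \<Rightarrow> complex"
  assumes [measurable]: "f \<in> borel_measurable M"
  shows "(\<lambda>t. f t powi j) \<in> borel_measurable M"
  unfolding power_int_def by measurable

text \<open>The density is the trigonometric polynomial with the coefficients of
  \<open>level_moment_Suc\<close>. Allowing any unimodular \<open>a\<close> and \<open>b\<close>
  serves both the Herglotz parameter and the Cayley coordinates of the plane.\<close>

lemma integral_level_moment_down:
  assumes rel: "moment_relations u" and M: "finite_measure M"
    and [measurable]: "a \<in> borel_measurable M" "b \<in> borel_measurable M"
    and ab: "\<And>t. cmod (a t) = 1" "\<And>t. cmod (b t) = 1"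
    and mom: "\<And>j k. (\<integral>t. a t powi j * b t powi k \<partial>M) = level_moment u (Suc N) j k"
  shows "(\<integral>t. complex_of_real ((cmod (1 - a t))\<^sup>2 * (cmod (1 - b t))\<^sup>2 / 16) *
    (a t powi j * b t powi k) \<partial>M) = level_moment u N j k"
proof -
  interpret finite_measure M by fact
  have ab0: "a t \<noteq> 0" "b t \<noteq> 0" for t using ab[of t] by auto
  have int: "integrable M (\<lambda>t. a t powi j * b t powi k)" for j k
    by (rule integrable_const_bound[of _ 1]) (auto simp: norm_mult norm_power_int ab)
  have eq: "complex_of_real ((cmod (1 - a t))\<^sup>2 * (cmod (1 - b t))\<^sup>2 / 16) * (a t powi j * b t powi k) =
      (2 * (2 * (a t powi j * b t powi k) - a t powi j * b t powi (k + 1) - a t powi j * b t powi (k - 1))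
       - (2 * (a t powi (j + 1) * b t powi k) - a t powi (j + 1) * b t powi (k + 1) - a t powi (j + 1) * b t powi (k - 1))
       - (2 * (a t powi (j - 1) * b t powi k) - a t powi (j - 1) * b t powi (k + 1) - a t powi (j - 1) * b t powi (k - 1))) / 16"
    for t
  proof -
    have sh: "w powi (i + 1) = w powi i * w" "w powi (i - 1) = w powi i * w powi (-1)" if "w \<noteq> 0" for w :: complex and i
      using that power_int_add[of w i "-1"] by (simp_all add: power_int_add)
    have D: "complex_of_real ((cmod (1 - a t))\<^sup>2 * (cmod (1 - b t))\<^sup>2 / 16) =
        (2 - a t - a t powi (-1)) * (2 - b t - b t powi (-1)) / 16"
      unfolding of_real_divide of_real_mult one_minus_unit_squared[OF ab(1)] one_minus_unit_squared[OF ab(2)]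
      by simp
    show ?thesis unfolding D sh[OF ab0(1)] sh[OF ab0(2)] by (simp add: algebra_simps)
  qed
  have "level_moment u N j k = 16 * level_moment u N j k / 16" by simp
  then show ?thesis
    unfolding eq level_moment_Suc[OF rel, of N j k] by (simp add: int mom)
qed

text \<open>The factor \<open>|1 - w\<^sub>1|\<^sup>2 |1 - w\<^sub>2|\<^sup>2\<close> kills the mass of the measure on the torus at the points
  that correspond to \<open>x\<^sub>1 = \<infinity>\<close> or \<open>x\<^sub>2 = \<infinity>\<close>; it is available since one passes from level \<open>N + 1\<close>
  to level \<open>N\<close>.\<close>

lemma level_measure_exists:
  assumes pos: "moment_positive u" and rel: "moment_relations u"
  shows "\<exists>K :: (real \<times> real) measure. finite_measure K \<and> sets K = sets borel \<and>
    (\<forall>j k. (\<integral>z. cayley (fst z) powi j * cayley (snd z) powi k \<partial>K) = level_moment u N j k)"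
proof -
  obtain m :: "real measure" and a b where m: "finite_measure m" "sets m = sets borel"
    and ab_m [measurable]: "a \<in> borel_measurable borel" "b \<in> borel_measurable borel"
    and ab: "\<And>t. cmod (a t) = 1" "\<And>t. cmod (b t) = 1"
    and mom: "\<And>j k. (\<integral>t. a t powi j * b t powi k \<partial>m) = level_moment u (Suc N) j k"
    using Herglotz_torus[OF psd_level_moment[OF pos, of "Suc N"]] by blast
  note [measurable_cong] = m(2)
  interpret m: finite_measure m by fact
  define D where "D t = (cmod (1 - a t))\<^sup>2 * (cmod (1 - b t))\<^sup>2 / 16" for t
  define X where "X t = (cayley_inv (a t), cayley_inv (b t))" for t
  have [measurable]: "D \<in> borel_measurable borel" unfolding D_def[abs_def] by measurable
  have [measurable]: "X \<in> borel_measurable borel"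
    unfolding X_def[abs_def] by (intro borel_measurable_Pair) measurable
  have D_nonneg: "0 \<le> D t" for t by (simp add: D_def)
  have norm_le: "(cmod (1 - w))\<^sup>2 \<le> 4" if "cmod w = 1" for w
    using power_mono[OF norm_triangle_ineq4[of 1 w], of 2] that by simp
  have D_le: "D t \<le> 1" for t
    using mult_mono[OF norm_le[OF ab(1)] norm_le[OF ab(2)], of t t] by (simp add: D_def)
  have trig_m [measurable]: "(\<lambda>z. cayley (fst z) powi j * cayley (snd z) powi k) \<in> borel_measurable borel"
    for j k
    using moment_fun_measurable[of "(0, j, - j, 0, k, - k)"] by (simp add: moment_fun_cayley[abs_def])
  let ?K = "distr (density m (\<lambda>t. ennreal (D t))) borel X"
  have fin_d: "finite_measure (density m (\<lambda>t. ennreal (D t)))"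
  proof
    have "emeasure (density m (\<lambda>t. ennreal (D t))) (space m) = (\<integral>\<^sup>+t. ennreal (D t) \<partial>m)"
      by (subst emeasure_density) (auto intro!: nn_integral_cong)
    also have "\<dots> \<le> (\<integral>\<^sup>+t. 1 \<partial>m)" using D_le by (intro nn_integral_mono) simp
    also have "\<dots> < \<infinity>" by (simp add: m.emeasure_finite less_top[symmetric])
    finally show "emeasure (density m (\<lambda>t. ennreal (D t))) (space (density m (\<lambda>t. ennreal (D t)))) \<noteq> \<infinity>"
      by simp
  qed
  \<comment> \<open>\<open>cayley\<close> inverts \<open>cayley_inv\<close> on the circle except at
    1, and wherever \<open>a t\<close> or \<open>b t\<close> is 1 the weight \<open>D t\<close>
    vanishes.\<close>
  have point: "D t *\<^sub>R (cayley (fst (X t)) powi j * cayley (snd (X t)) powi k) =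
      complex_of_real (D t) * (a t powi j * b t powi k)" for t j k
  proof (cases "a t = 1 \<or> b t = 1")
    case True
    then show ?thesis by (auto simp: D_def)
  next
    case False
    then show ?thesis by (simp add: X_def cayley_cayley_inv ab scaleR_conv_of_real)
  qed
  have "(\<integral>z. cayley (fst z) powi j * cayley (snd z) powi k \<partial>?K) = level_moment u N j k" for j k
  proof -
    have "(\<integral>z. cayley (fst z) powi j * cayley (snd z) powi k \<partial>?K) =
        (\<integral>t. cayley (fst (X t)) powi j * cayley (snd (X t)) powi k \<partial>density m (\<lambda>t. ennreal (D t)))"
      by (rule integral_distr) measurable
    also have "\<dots> = (\<integral>t. D t *\<^sub>R (cayley (fst (X t)) powi j * cayley (snd (X t)) powi k) \<partial>m)"
      using measurable_compose[OF _ trig_m[of j k], of X borel]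
      by (intro integral_density) (auto simp: D_nonneg)
    also have "\<dots> = level_moment u N j k"
      unfolding point unfolding D_def by (rule integral_level_moment_down[OF rel m(1) _ _ ab mom]) measurable
    finally show ?thesis .
  qed
  then show ?thesis
    using finite_measure.finite_measure_distr[OF fin_d, of X borel] by (intro exI[of _ ?K]) simp
qed


section \<open>Assembly of the levels into one measure on the plane\<close>

lemma one_minus_cayley: "(cmod (1 - cayley x))\<^sup>2 = 4 / (1 + x\<^sup>2)"
proof -
  have "1 - cayley x = - 2 * \<i> / (complex_of_real x - \<i>)"
    unfolding cayley_def by (simp add: field_simps)
  then show ?thesis
    by (simp add: norm_divide norm_mult norm_of_real_plus_i power_divide add_nonneg_nonneg)
qed

text \<open>The reciprocal, in plane coordinates, of the factor that lowers the level by
  one.\<close>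

definition plane_weight :: "real \<times> real \<Rightarrow> real" where
  "plane_weight z = (1 + (fst z)\<^sup>2) * (1 + (snd z)\<^sup>2)"

lemma plane_weight_pos: "0 < plane_weight z"
  by (simp add: plane_weight_def add_pos_nonneg)

lemma plane_weight_measurable [measurable]: "plane_weight \<in> borel_measurable borel"
  unfolding plane_weight_def[abs_def] by (intro borel_measurable_continuous_onI continuous_intros)

text \<open>As \<open>(x + i) (x - i) = 1 + x\<^sup>2\<close>, the common offset \<open>N\<close>
  produces the weight, and the remaining opposite exponents produce powers of the Cayley
  transform.\<close>

lemma moment_fun_level:
  "moment_fun (0, j + int N, int N - j, 0, k + int N, int N - k) z =
     complex_of_real (plane_weight z ^ N) * (cayley (fst z) powi j * cayley (snd z) powi k)"
proof -
  have one: "(complex_of_real x + \<i>) powi (i + int N) * (complex_of_real x - \<i>) powi (int N - i) =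
      complex_of_real ((1 + x\<^sup>2) ^ N) * cayley x powi i" for x i
  proof -
    have "(complex_of_real x + \<i>) * (complex_of_real x - \<i>) = complex_of_real (1 + x\<^sup>2)"
      by (simp add: algebra_simps power2_eq_square)
    then have "complex_of_real ((1 + x\<^sup>2) ^ N) = (complex_of_real x + \<i>) ^ N * (complex_of_real x - \<i>) ^ N"
      by (simp only: of_real_power power_mult_distrib[symmetric])
    moreover have "p powi (i + int N) * q powi (int N - i) = (p ^ N * q ^ N) * (p / q) powi i"
      if "p \<noteq> 0" "q \<noteq> 0" for p q :: complex
      using that by (simp add: power_int_add power_int_diff power_int_divide_distrib)
    ultimately show ?thesis unfolding cayley_def by simp
  qed
  show ?thesis
    unfolding moment_fun_apply plane_weight_def power_mult_distrib of_real_mult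
    using one[of "fst z" j] one[of "snd z" k] by (simp add: mult.assoc mult.left_commute)
qed

text \<open>Each level measure is the next one divided by the weight, as both have the same
  trigonometric moments. So \<open>K 0\<close> has density \<open>1 / plane_weight^N\<close> with
  respect to every \<open>K N\<close> and reproduces the moments of all levels; linear relations
  reach the remaining indices.\<close>

lemma moment_solution_exists:
  assumes pos: "moment_positive u" and rel: "moment_relations u"
  shows "\<exists>\<mu>. moment_solution u \<mu>"
proof -
  have "\<forall>N. \<exists>K :: (real \<times> real) measure. finite_measure K \<and> sets K = sets borel \<and>
      (\<forall>j k. (\<integral>z. cayley (fst z) powi j * cayley (snd z) powi k \<partial>K) = level_moment u N j k)"
    by (intro allI level_measure_exists pos rel)
  from choice[OF this] obtain K where
    fin: "\<And>N. finite_measure (K N)" and sets: "\<And>N. sets (K N) = sets (borel :: (real \<times> real) measure)"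
    and mom: "\<And>N j k. (\<integral>z. cayley (fst z) powi j * cayley (snd z) powi k \<partial>K N) = level_moment u N j k"
    by blast
  note [measurable_cong] = sets
  have [measurable]: "(\<lambda>z :: real \<times> real. cayley (fst z)) \<in> borel_measurable borel"
    "(\<lambda>z :: real \<times> real. cayley (snd z)) \<in> borel_measurable borel"
    by (intro borel_measurable_continuous_onI continuous_intros)+
  have step: "K N = density (K (Suc N)) (\<lambda>z. ennreal (1 / plane_weight z))" for N
  proof (rule measure_eqI_cayley)
    interpret finite_measure "K (Suc N)" by (rule fin)
    have le: "1 / plane_weight z \<le> 1" for z
    proof -
      have "1 * 1 \<le> plane_weight z" unfolding plane_weight_def by (intro mult_mono) auto
      then show ?thesis by simp
    qed
    show "finite_measure (density (K (Suc N)) (\<lambda>z. ennreal (1 / plane_weight z)))"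
    proof
      have "emeasure (density (K (Suc N)) (\<lambda>z. ennreal (1 / plane_weight z))) (space (K (Suc N))) =
          (\<integral>\<^sup>+z. ennreal (1 / plane_weight z) \<partial>K (Suc N))"
        by (subst emeasure_density) (auto intro!: nn_integral_cong)
      also have "\<dots> \<le> (\<integral>\<^sup>+z. 1 \<partial>K (Suc N))" using le by (intro nn_integral_mono) simp
      also have "\<dots> < \<infinity>" by (simp add: emeasure_finite less_top[symmetric])
      finally show "emeasure (density (K (Suc N)) (\<lambda>z. ennreal (1 / plane_weight z)))
          (space (density (K (Suc N)) (\<lambda>z. ennreal (1 / plane_weight z)))) \<noteq> \<infinity>"
        by simp
    qed
    fix j k
    have "(\<integral>z. cayley (fst z) powi j * cayley (snd z) powi k \<partial>density (K (Suc N)) (\<lambda>z. ennreal (1 / plane_weight z))) =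
        (\<integral>z. (1 / plane_weight z) *\<^sub>R (cayley (fst z) powi j * cayley (snd z) powi k) \<partial>K (Suc N))"
      by (rule integral_density) (auto simp: plane_weight_pos less_imp_le)
    also have "\<dots> = (\<integral>z. complex_of_real ((cmod (1 - cayley (fst z)))\<^sup>2 * (cmod (1 - cayley (snd z)))\<^sup>2 / 16) *
        (cayley (fst z) powi j * cayley (snd z) powi k) \<partial>K (Suc N))"
      unfolding one_minus_cayley plane_weight_def scaleR_conv_of_real by simp
    also have "\<dots> = level_moment u N j k"
      by (rule integral_level_moment_down[OF rel fin _ _ _ _ mom]) (auto simp: norm_cayley)
    finally show "(\<integral>z. cayley (fst z) powi j * cayley (snd z) powi k \<partial>K N) =
        (\<integral>z. cayley (fst z) powi j * cayley (snd z) powi k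
          \<partial>density (K (Suc N)) (\<lambda>z. ennreal (1 / plane_weight z)))"
      by (simp add: mom)
  qed (simp_all add: fin sets)
  define \<mu> where "\<mu> = K 0"
  have dens: "\<mu> = density (K N) (\<lambda>z. ennreal (1 / plane_weight z ^ N))" for N
  proof (induction N)
    case 0
    show ?case by (simp add: \<mu>_def density_1)
  next
    case (Suc N)
    have "\<mu> = density (density (K (Suc N)) (\<lambda>z. ennreal (1 / plane_weight z))) (\<lambda>z. ennreal (1 / plane_weight z ^ N))"
      using Suc by (simp add: step[symmetric])
    also have "\<dots> = density (K (Suc N)) (\<lambda>z. ennreal (1 / plane_weight z) * ennreal (1 / plane_weight z ^ N))"
      by (rule density_density_eq) measurable
    also have "(\<lambda>z. ennreal (1 / plane_weight z) * ennreal (1 / plane_weight z ^ N)) =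
        (\<lambda>z. ennreal (1 / plane_weight z ^ Suc N))"
      using plane_weight_pos by (auto simp: ennreal_mult[symmetric] less_imp_le)
    finally show ?case .
  qed
  define R where "R \<omega> \<longleftrightarrow> integrable \<mu> (moment_fun \<omega>) \<and> (\<integral>z. moment_fun \<omega> z \<partial>\<mu>) = u \<omega>" for \<omega>
  have level: "R (0, k, l, 0, r, t)" if "k + l = 2 * int N" "r + t = 2 * int N" for k l r t N
  proof -
    define i j where "i = k - int N" and "j = r - int N"
    have idx: "(0, k, l, 0, r, t) = (0, i + int N, int N - i, 0, j + int N, int N - j)"
      using that by (auto simp: i_def j_def)
    let ?f = "moment_fun (0, i + int N, int N - i, 0, j + int N, int N - j)"
    let ?g = "\<lambda>z. cayley (fst z) powi i * cayley (snd z) powi j"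
    have q: "plane_weight z ^ N \<noteq> 0" for z using plane_weight_pos[of z] by simp
    have eq: "(1 / plane_weight z ^ N) *\<^sub>R ?f z = ?g z" for z
      unfolding moment_fun_level scaleR_conv_of_real using q[of z] by (simp add: field_simps)
    interpret finite_measure "K N" by (rule fin)
    have "integrable (K N) ?g"
      by (rule integrable_const_bound[of _ 1]) (auto simp: norm_mult norm_power_int)
    then have "integrable \<mu> ?f"
      unfolding dens[of N] by (subst integrable_density) (auto simp: eq plane_weight_pos less_imp_le)
    moreover have "(\<integral>z. ?f z \<partial>\<mu>) = (\<integral>z. ?g z \<partial>K N)"
      unfolding dens[of N] by (subst integral_density) (auto simp: eq plane_weight_pos less_imp_le)
    ultimately show ?thesis unfolding R_def idx by (simp add: mom level_moment_def)
  qed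
  have lin: "R \<omega>3" if "R \<omega>1" "R \<omega>2" "\<And>z. moment_fun \<omega>3 z = c * moment_fun \<omega>1 z + d * moment_fun \<omega>2 z"
    "u \<omega>3 = c * u \<omega>1 + d * u \<omega>2" for \<omega>1 \<omega>2 \<omega>3 c d
  proof -
    have "moment_fun \<omega>3 = (\<lambda>z. c * moment_fun \<omega>1 z + d * moment_fun \<omega>2 z)" using that(3) by auto
    then show ?thesis using that(1,2,4) unfolding R_def by simp
  qed
  \<comment> \<open>\<open>2 i = (x + i) - (x - i)\<close> expresses an index through two of total
    exponent one higher.\<close>
  have down1: "R (m, k, l, n, r, t)" if "R (m, k + 1, l, n, r, t)" "R (m, k, l + 1, n, r, t)" for m k l n r t
  proof (rule lin[OF that])
    show "moment_fun (m, k, l, n, r, t) z =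
        (1 / (2 * \<i>)) * moment_fun (m, k + 1, l, n, r, t) z + (- 1 / (2 * \<i>)) * moment_fun (m, k, l + 1, n, r, t) z" for z
      unfolding moment_fun_bump by (simp add: field_simps)
    show "u (m, k, l, n, r, t) = (1 / (2 * \<i>)) * u (m, k + 1, l, n, r, t) + (- 1 / (2 * \<i>)) * u (m, k, l + 1, n, r, t)"
      unfolding moment_relationsD[OF rel] by (simp add: field_simps)
  qed
  have down2: "R (m, k, l, n, r, t)" if "R (m, k, l, n, r + 1, t)" "R (m, k, l, n, r, t + 1)" for m k l n r t
  proof (rule lin[OF that])
    show "moment_fun (m, k, l, n, r, t) z =
        (1 / (2 * \<i>)) * moment_fun (m, k, l, n, r + 1, t) z + (- 1 / (2 * \<i>)) * moment_fun (m, k, l, n, r, t + 1) z" for z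
      unfolding moment_fun_bump by (simp add: field_simps)
    show "u (m, k, l, n, r, t) = (1 / (2 * \<i>)) * u (m, k, l, n, r + 1, t) + (- 1 / (2 * \<i>)) * u (m, k, l, n, r, t + 1)"
      unfolding moment_relationsD[OF rel] by (simp add: field_simps)
  qed
  \<comment> \<open>\<open>x = (x + i) - i\<close> trades a power of \<open>x\<close> for integer
    exponents.\<close>
  have up1: "R (m + 1, k, l, n, r, t)" if "R (m, k + 1, l, n, r, t)" "R (m, k, l, n, r, t)" for m k l n r t
    by (rule lin[OF that, of _ 1 "- \<i>"])
      (unfold moment_fun_bump moment_relationsD[OF rel], simp_all add: algebra_simps)
  have up2: "R (m, k, l, n + 1, r, t)" if "R (m, k, l, n, r + 1, t)" "R (m, k, l, n, r, t)" for m k l n r t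
    by (rule lin[OF that, of _ 1 "- \<i>"])
      (unfold moment_fun_bump moment_relationsD[OF rel], simp_all add: algebra_simps)
  \<comment> \<open>\<open>level\<close> covers exponent sums equal to \<open>2 N\<close> only;
    induction on the deficit \<open>i\<close> descends from there.\<close>
  have degree1: "R (0, k, l, 0, r, t)" if "k + l = 2 * int N - int i" "r + t = 2 * int N" for k l r t N i
    using that(1)
  proof (induction i arbitrary: k l)
    case 0
    then show ?case using level that(2) by simp
  next
    case (Suc i)
    show ?case by (rule down1) (use Suc in auto)
  qed
  have degree2: "R (0, k, l, 0, r, t)" if "k + l = 2 * int N - int i" "r + t = 2 * int N - int j" for k l r t N i j
    using that(2)
  proof (induction j arbitrary: r t)
    case 0
    then show ?case using degree1 that(1) by simp
  next
    case (Suc j)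
    show ?case by (rule down2) (use Suc in auto)
  qed
  have R0: "R (0, k, l, 0, r, t)" for k l r t
  proof -
    \<comment> \<open>Large enough that both exponent sums are at most \<open>2 N\<close>, whatever
      their signs.\<close>
    define N where "N = nat (\<bar>k + l\<bar> + \<bar>r + t\<bar>)"
    have "int N = \<bar>k + l\<bar> + \<bar>r + t\<bar>" by (simp add: N_def)
    then have "k + l \<le> 2 * int N" "r + t \<le> 2 * int N" by arith+
    then show ?thesis
      by (intro degree2[of k l N "nat (2 * int N - (k + l))" r t "nat (2 * int N - (r + t))"]) auto
  qed
  \<comment> \<open>\<open>k\<close> must vary in the induction, since \<open>up1\<close> refers to
    \<open>k + 1\<close>.\<close>
  have R1: "R (m, k, l, 0, r, t)" for m k l r t
    by (induction m arbitrary: k) (use R0 up1 in auto)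
  have R2: "R (m, k, l, n, r, t)" for m k l n r t
    by (induction n arbitrary: r) (use R1 up2 in auto)
  have "R \<omega>" for \<omega> by (cases \<omega>) (simp only: R2)
  then have "moment_solution u \<mu>"
    unfolding moment_solution_def R_def \<mu>_def using sets by blast
  then show ?thesis ..
qed

text \<open>A Gram family is exhibited in \<open>ell2\<close>, whereas the formula covers Gram
  families in every Hilbert space type and every joint spectral measure: uniqueness identifies the
  solution with the scalar measure of the zero-index vector.\<close>

theorem theorem2p2:
  fixes u :: "mindex \<Rightarrow> complex"
  shows
    "((\<exists>\<mu>. moment_solution u \<mu>) \<longleftrightarrow> moment_positive u \<and> moment_relations u) \<and>
     (moment_positive u \<and> moment_relations u \<longrightarrow>
        (\<exists>!\<mu>. moment_solution u \<mu>) \<and>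
        (\<exists>x :: mindex \<Rightarrow> ell2. gram_family u x) \<and>
        (\<forall>x :: mindex \<Rightarrow> 'h::chilbert_space. gram_family u x \<longrightarrow>
           (\<exists>E. joint_spectral_measure x E) \<and>
           (\<forall>E \<mu>. joint_spectral_measure x E \<longrightarrow> moment_solution u \<mu> \<longrightarrow>
              (\<forall>\<Delta>\<in>sets borel.
                 complex_of_real (measure \<mu> \<Delta>) =
                   cinner (E \<Delta> (x (0, 0, 0, 0, 0, 0))) (x (0, 0, 0, 0, 0, 0))))))"
proof (intro conjI impI allI)
  show "(\<exists>\<mu>. moment_solution u \<mu>) \<longleftrightarrow> moment_positive u \<and> moment_relations u"
    using moment_positive_of_solution moment_relations_of_solution moment_solution_exists by blast
next
  assume "moment_positive u \<and> moment_relations u"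
  then have pos: "moment_positive u" and rel: "moment_relations u" by auto
  obtain \<mu> where \<mu>: "moment_solution u \<mu>" using moment_solution_exists[OF pos rel] by blast
  show "\<exists>!\<mu>. moment_solution u \<mu>" using \<mu> moment_solution_unique by blast
  show "\<exists>x :: mindex \<Rightarrow> ell2. gram_family u x" by (rule gram_family_ell2_exists[OF pos])
  fix x :: "mindex \<Rightarrow> 'h" assume x: "gram_family u x"
  show "\<exists>E. joint_spectral_measure x E" by (rule joint_spectral_measure_exists[OF \<mu> x])
  fix E \<nu>
  assume J: "joint_spectral_measure x E" and \<nu>: "moment_solution u \<nu>"
  let ?x0 = "x (0, 0, 0, 0, 0, 0)"
  have "\<nu> = scalar_spectral_measure E ?x0"
    by (rule moment_solution_unique[OF \<nu> moment_solution_of_joint_spectral_measure[OF x rel J]])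
  moreover have "spectral_measure_on (closed_span x) E"
    using J unfolding joint_spectral_measure_def by blast
  moreover have "?x0 \<in> closed_span x"
    unfolding closed_span_def by (intro subsetD[OF closure_subset] complex_vector.span_base) simp
  ultimately show "\<forall>\<Delta>\<in>sets borel. complex_of_real (measure \<nu> \<Delta>) = cinner (E \<Delta> ?x0) ?x0"
    using measure_scalar_spectral_measure by blast
qed

end
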